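(* Let $\mathbb K$ be a field, $R=\mathbb K[x_1,\dots,x_n]$, and let $I=(m_1,\dots,m_q)\subseteq R$ be a squarefree monomial ideal with minimal monomial generators $m_1,\dots,m_q$. If $q\le 5$, then $I$ admits a minimal pruned resolution.
   Context: For a monomial ideal $I$ with minimal generators in a fixed order $m_1,\dots,m_q$ and $\sigma\subseteq\{1,\dots,q\}$ put $m_\sigma=\mathrm{lcm}(m_i: i\in\sigma)$, $m_\emptyset=1$. The Taylor resolution of $R/I$ is supported on the full simplex $X_{\mathrm{Taylor}}$ on $q$ vertices; the face $\sigma$ has homological degree $|\sigma|$ and multidegree the exponent of $m_\sigma$. Pruning algorithm: for $j=1,\dots,q$ successively (step $j$), for every $\sigma\not\ni j$ with $m_\sigma=m_{\sigma\cup\{j\}}$ and such that neither $\sigma$ nor $\sigma\cup\{j\}$ belongs to a previously selected edge, select (prune) the edge $\{\sigma,\sigma\cup\{j\}\}$. The selected edges form a homogeneous acyclic matching on $X_{\mathrm{Taylor}}$, and discrete Morse theory (Batzies–Welker) yields a $\mathbb Z^n$-graded CW-complex, with cells corresponding to the faces in no selected edge (critical faces), supporting a free resolution of $R/I$: the pruned resolution for the given order. Its module in homological degree $i$ is the direct sum of $R(-\deg m_\sigma)$ over critical $\sigma$ with $|\sigma|=i$; so it is minimal iff, for all $i,\alpha$, the number of critical $\sigma$ with $|\sigma|=i$ and multidegree $\alpha$ equals the multigraded Betti number $\beta_{i,\alpha}(R/I)$. The ideal $I$ admits a minimal pruned resolution if there is an order of its minimal generators for which the pruned resolution is minimal. 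*)

theory Defs
  imports
    "HOL-Library.Poly_Mapping"
    "Jordan_Normal_Form.Matrix_Kernel"
begin

text \<open>
  A monomial is given by its exponent vector, of type \<open>'n \<Rightarrow>\<^sub>0 nat\<close>, and
  \<open>('n \<Rightarrow>\<^sub>0 nat) \<Rightarrow>\<^sub>0 'k\<close>, with the convolution product of \<open>Poly_Mapping\<close>, is the
  polynomial ring over \<open>'k\<close> in the variables indexed by the finite type \<open>'n\<close>.
\<close>

type_synonym 'n mon = "'n \<Rightarrow>\<^sub>0 nat"
type_synonym ('n, 'k) mpoly = "'n mon \<Rightarrow>\<^sub>0 'k"
type_synonym 'n mdegree = "'n \<Rightarrow> int"

definition mpoly_monom :: "'n mon \<Rightarrow> ('n, 'k::field) mpoly"
  where "mpoly_monom t = Poly_Mapping.single t 1"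

definition squarefree_mon :: "'n mon \<Rightarrow> bool"
  where "squarefree_mon t \<longleftrightarrow> (\<forall>x. Poly_Mapping.lookup t x \<le> 1)"

text \<open>
  The list \<open>ms\<close> enumerates, in a fixed order and without repetition, the minimal monomial
  generators of the ideal \<open>I\<close>.  Here \<open>module.span (*)\<close> is the span in the ring seen as a
  module over itself, that is, the generated ideal.
\<close>

definition minimal_generators :: "('n, 'k::field) mpoly set \<Rightarrow> 'n mon list \<Rightarrow> bool"
  where "minimal_generators I ms \<longleftrightarrow>
    I = Modules.module.span (*) (mpoly_monom ` set ms) \<and>
    (\<forall>i < length ms. \<forall>j < length ms.
       i \<noteq> j \<longrightarrow> \<not> (mpoly_monom (ms ! i) :: ('n, 'k) mpoly) dvd mpoly_monom (ms ! j))"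


subsection \<open>Multigraded Betti numbers\<close>

text \<open>Zero is homogeneous of every degree, including degrees with negative entries.\<close>

definition homogeneous :: "'n mdegree \<Rightarrow> ('n, 'k::field) mpoly \<Rightarrow> bool"
  where "homogeneous \<alpha> f \<longleftrightarrow> (\<forall>t \<in> Poly_Mapping.keys f. \<forall>x. int (Poly_Mapping.lookup t x) = \<alpha> x)"

text \<open>
  A \<open>\<int>\<^sup>n\<close>-graded resolution of \<open>R/I\<close> by free modules of finite rank.  The module in
  homological degree \<open>i\<close> is the direct sum of the \<open>R(-\<alpha>)\<close> with \<open>\<alpha>\<close> running through the list
  \<open>sh i\<close>.  The matrix \<open>d i\<close> is the differential from homological degree \<open>i + 1\<close> to
  homological degree \<open>i\<close>, and \<open>\<epsilon>\<close> lifts the augmentation from the module in homological degree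
  \<open>0\<close> onto \<open>R/I\<close> to a map into \<open>R\<close>.  A map of graded degree zero from \<open>R(-\<beta>)\<close> to \<open>R(-\<alpha>)\<close> is
  multiplication by a homogeneous element of degree \<open>\<beta> - \<alpha>\<close>.
\<close>

definition graded_free_resolution ::
  "('n, 'k::field) mpoly set \<Rightarrow> (nat \<Rightarrow> 'n mdegree list) \<Rightarrow>
   (nat \<Rightarrow> ('n, 'k) mpoly mat) \<Rightarrow> ('n, 'k) mpoly vec \<Rightarrow> bool"
  where "graded_free_resolution I sh d \<epsilon> \<longleftrightarrow>
    (\<forall>i. d i \<in> carrier_mat (length (sh i)) (length (sh (Suc i)))) \<and>
    (\<forall>i. \<forall>a < length (sh i). \<forall>b < length (sh (Suc i)).
       homogeneous (\<lambda>x. (sh (Suc i) ! b) x - (sh i ! a) x) (d i $$ (a, b))) \<and>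
    \<epsilon> \<in> carrier_vec (length (sh 0)) \<and>
    (\<forall>a < length (sh 0). homogeneous (sh 0 ! a) (\<epsilon> $ a)) \<and>
    (\<forall>f. \<exists>v \<in> carrier_vec (length (sh 0)). f - \<epsilon> \<bullet> v \<in> I) \<and>
    {v \<in> carrier_vec (length (sh 0)). \<epsilon> \<bullet> v \<in> I} =
      (\<lambda>w. d 0 *\<^sub>v w) ` carrier_vec (length (sh 1)) \<and>
    (\<forall>i. mat_kernel (d i) = (\<lambda>w. d (Suc i) *\<^sub>v w) ` carrier_vec (length (sh (Suc (Suc i)))))"

text \<open>
  Minimality: all entries of the differentials lie in the ideal generated by the variables,
  that is, have zero constant coefficient.
\<close>

definition minimal_graded_free_resolution ::
  "('n, 'k::field) mpoly set \<Rightarrow> (nat \<Rightarrow> 'n mdegree list) \<Rightarrow>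
   (nat \<Rightarrow> ('n, 'k) mpoly mat) \<Rightarrow> ('n, 'k) mpoly vec \<Rightarrow> bool"
  where "minimal_graded_free_resolution I sh d \<epsilon> \<longleftrightarrow>
    graded_free_resolution I sh d \<epsilon> \<and>
    (\<forall>i. \<forall>a < length (sh i). \<forall>b < length (sh (Suc i)). Poly_Mapping.lookup (d i $$ (a, b)) 0 = 0)"

text \<open>
  \<open>betti I i \<alpha>\<close> is the multigraded Betti number of \<open>R/I\<close> (not of \<open>I\<close>): the multiplicity of
  \<open>R(-\<alpha>)\<close> in homological degree \<open>i\<close> of the minimal graded free resolution, which is unique up to
  isomorphism.
\<close>

definition betti :: "('n, 'k::field) mpoly set \<Rightarrow> nat \<Rightarrow> 'n mdegree \<Rightarrow> nat"
  where "betti I i \<alpha> =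
    (THE b. \<exists>sh d \<epsilon>. minimal_graded_free_resolution I sh d \<epsilon> \<and> b = count_list (sh i) \<alpha>)"


subsection \<open>The pruned resolution\<close>

text \<open>
  Faces of the Taylor simplex are subsets of \<open>{..<length ms}\<close>, vertices being numbered from \<open>0\<close>.
  The multidegree of a face \<open>\<sigma>\<close> is the exponent vector of the least common multiple of the
  \<open>ms ! i\<close> with \<open>i \<in> \<sigma>\<close>; the inserted \<open>0\<close> accounts for the empty face.
\<close>

definition mdeg :: "'n mon list \<Rightarrow> nat set \<Rightarrow> 'n mdegree"
  where "mdeg ms \<sigma> = (\<lambda>x. Max (insert 0 ((\<lambda>i. int (Poly_Mapping.lookup (ms ! i) x)) ` \<sigma>)))"

text \<open>
  \<open>pruned_edges ms j\<close> is the set of edges selected in the first \<open>j\<close> steps.  The edges eligible in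
  one step are pairwise disjoint, so they can be selected simultaneously.
\<close>

primrec pruned_edges :: "'n mon list \<Rightarrow> nat \<Rightarrow> nat set set set"
  where
    "pruned_edges ms 0 = {}"
  | "pruned_edges ms (Suc j) = pruned_edges ms j \<union>
      {{\<sigma>, insert j \<sigma>} | \<sigma>. \<sigma> \<subseteq> {..<length ms} \<and> j \<notin> \<sigma> \<and>
         mdeg ms \<sigma> = mdeg ms (insert j \<sigma>) \<and>
         \<sigma> \<notin> \<Union> (pruned_edges ms j) \<and> insert j \<sigma> \<notin> \<Union> (pruned_edges ms j)}"

definition critical_faces :: "'n mon list \<Rightarrow> nat set set"
  where "critical_faces ms = Pow {..<length ms} - \<Union> (pruned_edges ms (length ms))"

text \<open>
  The pruned resolution for the order \<open>ms\<close> has in homological degree \<open>i\<close> the direct sum of the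
  \<open>R(-mdeg ms \<sigma>)\<close> over the critical faces \<open>\<sigma>\<close> with \<open>i\<close> vertices; it is minimal if and only if its
  graded ranks are the multigraded Betti numbers.
\<close>

definition pruned_resolution_minimal :: "('n, 'k::field) mpoly set \<Rightarrow> 'n mon list \<Rightarrow> bool"
  where "pruned_resolution_minimal I ms \<longleftrightarrow>
    (\<forall>i \<alpha>. card {\<sigma> \<in> critical_faces ms. card \<sigma> = i \<and> mdeg ms \<sigma> = \<alpha>} = betti I i \<alpha>)"

definition admits_minimal_pruned_resolution :: "('n, 'k::field) mpoly set \<Rightarrow> bool"
  where "admits_minimal_pruned_resolution I \<longleftrightarrow>
    (\<exists>ms. minimal_generators I ms \<and> pruned_resolution_minimal I ms)"

end

theory Submission
  imports Defs "Jordan_Normal_Form.Determinant"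
begin

text \<open>A multigraded free resolution is exact if and only if, for every degree \<open>\<gamma>\<close>, the basis elements of
  degree at most \<open>\<gamma>\<close> span an exact complex of vector spaces; so it can be handled through its scalar
  coefficients.  In this form, cancelling the pruned pairs of the Taylor complex one after another by
  Gaussian elimination leaves a resolution on the critical faces.  Its coefficient between faces
  \<open>x\<close> and \<open>y\<close> with \<open>card y = Suc (card x)\<close> and the same multidegree can only be nonzero if the first
  vertex in which \<open>x\<close> and \<open>y\<close> differ belongs to \<open>x\<close>.  If no two critical faces are in this position, the
  resolution is minimal, and the graded ranks of a minimal resolution are unique because two such
  resolutions are homotopy equivalent.

  The position only occurs for multidegrees divisible by at least four generators.  Call a set of four
  of the five generators closed if the fifth does not divide its least common multiple.  With two closed
  sets every order works.  With exactly one, the fifth generator plays no role, and the order of the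
  four others has to avoid at most five of the six possible pairs at its beginning.  With none, only the
  top multidegree matters; an order works that starts with two generators whose least common multiple is
  not the top one while that of the three others is, apart from two configurations that are remedied
  by starting with another pair.\<close>

subsection \<open>Multigraded resolutions in scalar form\<close>

text \<open>The differential left by the pruning has no manageable closed form: each cancellation of
  a pair \<open>s\<close>, \<open>t = insert j s\<close> changes coefficients between other faces.
  Only their vanishing is tracked. The correction from \<open>y\<close> to \<open>x\<close> is a
  product of a coefficient between \<open>t\<close> and \<open>x\<close> and one between
  \<open>y\<close> and \<open>s\<close>; since \<open>s\<close> and \<open>t\<close> have the same
  vertices below \<open>j\<close>, comparisons of first differences compose along it, whatever the
  values are. The resulting criterion \<open>lex_good\<close> mentions neither the field nor a
  differential. The algorithm only pairs faces of equal multidegree, so it runs separately in each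
  multidegree \<alpha>, on a family of faces that is upward closed among the generators dividing the
  monomial of degree \<alpha>. Upward closure makes the step at the first such generator remove
  every face without it, which leaves few possible bad pairs. With five generators a family is a
  Boolean function of five arguments, and reordering the generators permutes its arguments; choosing
  the order becomes a finite propositional question.\<close>

definition supp :: "('b \<Rightarrow> 'd::order) \<Rightarrow> 'b set \<Rightarrow> 'd \<Rightarrow> ('b \<Rightarrow> 'k::zero) set"
  where "supp deg X \<gamma> = {v. \<forall>x. v x \<noteq> 0 \<longrightarrow> x \<in> X \<and> deg x \<le> \<gamma>}"

definition lin_ext :: "'b set \<Rightarrow> ('b \<Rightarrow> 'c \<Rightarrow> 'k) \<Rightarrow> ('b \<Rightarrow> 'k) \<Rightarrow> 'c \<Rightarrow> 'k::comm_ring_1"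
  where "lin_ext X \<phi> v = (\<lambda>x. \<Sum>y\<in>X. \<phi> y x * v y)"

definition unit_at :: "'b \<Rightarrow> 'b \<Rightarrow> 'k::zero_neq_one"
  where "unit_at y = (\<lambda>x. if x = y then 1 else 0)"

definition pairing :: "'b set \<Rightarrow> ('b \<Rightarrow> 'k::comm_ring_1) \<Rightarrow> ('b \<Rightarrow> 'k) \<Rightarrow> 'k"
  where "pairing X e v = (\<Sum>x\<in>X. e x * v x)"

text \<open>\<open>R/I\<close> is one-dimensional in degree \<gamma> if \<open>M \<gamma>\<close>
  holds and zero otherwise, so in homological degree 0 every vector is a cycle when
  \<open>M \<gamma>\<close> fails. Treating the augmentation as a case of \<open>cycle\<close> gives
  a single exactness axiom for all homological degrees.\<close>

definition cycle :: "('d \<Rightarrow> bool) \<Rightarrow> (nat \<Rightarrow> 'b set) \<Rightarrow> ('b \<Rightarrow> 'b \<Rightarrow> 'k) \<Rightarrow> ('b \<Rightarrow> 'k::comm_ring_1) \<Rightarrow>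
    nat \<Rightarrow> 'd \<Rightarrow> ('b \<Rightarrow> 'k) \<Rightarrow> bool"
  where "cycle M B D e i \<gamma> v =
    (case i of 0 \<Rightarrow> M \<gamma> \<longrightarrow> pairing (B 0) e v = 0 | Suc j \<Rightarrow> lin_ext (B i) D v = (\<lambda>_. 0))"

lemma supp_zero [simp]: "(\<lambda>_. 0) \<in> supp deg X \<gamma>"
  by (simp add: supp_def)

lemma supp_mono: "v \<in> supp deg X \<gamma> \<Longrightarrow> \<gamma> \<le> \<delta> \<Longrightarrow> v \<in> supp deg X \<delta>"
  by (auto simp: supp_def intro: order_trans)

lemma supp_diff: "v \<in> supp deg X \<gamma> \<Longrightarrow> w \<in> supp deg X \<gamma> \<Longrightarrow> (\<lambda>x. v x - w x :: 'k::ring_1) \<in> supp deg X \<gamma>"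
  unfolding supp_def by (smt (verit) diff_0_right mem_Collect_eq)

lemma supp_scale: "v \<in> supp deg X \<gamma> \<Longrightarrow> (\<lambda>x. a * v x :: 'k::ring_1) \<in> supp deg X \<gamma>"
  unfolding supp_def by (auto dest: mult_not_zero)

lemma supp_unit_at: "y \<in> X \<Longrightarrow> unit_at y \<in> supp deg X (deg y)"
  by (auto simp: supp_def unit_at_def)

lemma lin_ext_zero [simp]: "lin_ext X \<phi> (\<lambda>_. 0) = (\<lambda>_. 0)"
  by (simp add: lin_ext_def)

lemma lin_ext_diff: "lin_ext X \<phi> (\<lambda>x. v x - w x) = (\<lambda>x. lin_ext X \<phi> v x - lin_ext X \<phi> w x)"
  by (simp add: lin_ext_def algebra_simps sum_subtractf)

lemma lin_ext_cong: "(\<And>y. y \<in> X \<Longrightarrow> v y \<noteq> 0 \<Longrightarrow> \<phi> y = \<psi> y) \<Longrightarrow> lin_ext X \<phi> v = lin_ext X \<psi> v"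
  unfolding lin_ext_def by (intro ext sum.cong refl) (metis mult_zero_right)

lemma lin_ext_supp:
  assumes "\<And>y. y \<in> X \<Longrightarrow> \<phi> y \<in> supp deg' X' (deg y)" "v \<in> supp deg X \<gamma>"
  shows "lin_ext X \<phi> v \<in> supp deg' X' \<gamma>"
proof -
  have "x \<in> X' \<and> deg' x \<le> \<gamma>" if "lin_ext X \<phi> v x \<noteq> 0" for x
  proof -
    obtain y where y: "y \<in> X" "\<phi> y x * v y \<noteq> 0"
      using \<open>lin_ext X \<phi> v x \<noteq> 0\<close> unfolding lin_ext_def by (metis (mono_tags, lifting) sum.neutral)
    then have "\<phi> y x \<noteq> 0" "v y \<noteq> 0" by auto
    then show ?thesis
      using assms y unfolding supp_def by (auto intro: order_trans)
  qed
  then show ?thesis by (auto simp: supp_def)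
qed

lemma lin_ext_lin_ext: "lin_ext X' \<psi> (lin_ext X \<phi> v) = lin_ext X (\<lambda>y. lin_ext X' \<psi> (\<phi> y)) v"
  unfolding lin_ext_def
  by (rule ext) (simp add: sum_distrib_left sum_distrib_right mult.assoc, rule sum.swap)

lemma pairing_lin_ext: "pairing X' e (lin_ext X \<phi> v) = (\<Sum>y\<in>X. pairing X' e (\<phi> y) * v y)"
  unfolding lin_ext_def pairing_def
  by (simp add: sum_distrib_left sum_distrib_right mult.assoc, rule sum.swap)

lemma lin_ext_unit_at: "finite X \<Longrightarrow> y \<in> X \<Longrightarrow> lin_ext X \<phi> (unit_at y) = \<phi> y"
proof -
  assume "finite X" "y \<in> X"
  have "(\<Sum>z\<in>X. \<phi> z x * unit_at y z) = (\<Sum>z\<in>X. if z = y then \<phi> z x else 0)" for x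
    by (rule sum.cong) (auto simp: unit_at_def)
  then show ?thesis
    using \<open>finite X\<close> \<open>y \<in> X\<close> by (simp add: lin_ext_def)
qed

lemma pairing_unit_at: "finite X \<Longrightarrow> y \<in> X \<Longrightarrow> pairing X e (unit_at y) = e y"
proof -
  assume "finite X" "y \<in> X"
  have "(\<Sum>z\<in>X. e z * unit_at y z) = (\<Sum>z\<in>X. if z = y then e z else 0)"
    by (rule sum.cong) (auto simp: unit_at_def)
  then show ?thesis
    using \<open>finite X\<close> \<open>y \<in> X\<close> by (simp add: pairing_def)
qed

lemma lin_ext_unit: "finite X \<Longrightarrow> v \<in> supp deg X \<gamma> \<Longrightarrow> lin_ext X unit_at v = v"
proof -
  assume X: "finite X" and v: "v \<in> supp deg X \<gamma>"
  have "(\<Sum>z\<in>X. unit_at z x * v z) = (\<Sum>z\<in>X. if x = z then v z else 0)" for x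
    by (rule sum.cong) (auto simp: unit_at_def)
  then show ?thesis
    using X v by (force simp: lin_ext_def supp_def)
qed

lemma pairing_diff: "pairing X e (\<lambda>x. v x - w x) = pairing X e v - pairing X e w"
  by (simp add: pairing_def algebra_simps sum_subtractf)

text \<open>\<open>D y x\<close> is the scalar coefficient of \<open>x\<close> in the boundary of \<open>y\<close>, and \<open>M \<gamma>\<close> says that the monomial of
  degree \<open>\<gamma>\<close> exists and lies outside the ideal.\<close>

locale based_resolution =
  fixes M :: "'d::order \<Rightarrow> bool" and B :: "nat \<Rightarrow> 'b set" and deg :: "'b \<Rightarrow> 'd"
    and D :: "'b \<Rightarrow> 'b \<Rightarrow> 'k::field" and e :: "'b \<Rightarrow> 'k"
  assumes fin: "finite (B i)"
    and D_supp: "y \<in> B (Suc i) \<Longrightarrow> D y \<in> supp deg (B i) (deg y)"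
    and e_deg: "x \<in> B 0 \<Longrightarrow> e x \<noteq> 0 \<Longrightarrow> deg x \<le> \<gamma> \<Longrightarrow> M \<gamma> \<Longrightarrow> M (deg x)"
    and e_surj: "M \<gamma> \<Longrightarrow> \<exists>x\<in>B 0. deg x \<le> \<gamma> \<and> e x \<noteq> 0"
    and exact: "v \<in> supp deg (B i) \<gamma> \<Longrightarrow>
      cycle M B D e i \<gamma> v \<longleftrightarrow> (\<exists>w\<in>supp deg (B (Suc i)) \<gamma>. v = lin_ext (B (Suc i)) D w)"
begin

lemma cycle_boundary:
  assumes "w \<in> supp deg (B (Suc i)) \<gamma>"
  shows "cycle M B D e i \<gamma> (lin_ext (B (Suc i)) D w)"
  using exact[OF lin_ext_supp[OF D_supp assms]] assms by blast

lemma cycle_D: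
  assumes "y \<in> B (Suc i)"
  shows "cycle M B D e i (deg y) (D y)"
  using cycle_boundary[OF supp_unit_at[OF assms]] lin_ext_unit_at[OF fin assms, of D] by simp

lemma DD: "y \<in> B (Suc (Suc i)) \<Longrightarrow> lin_ext (B (Suc i)) D (D y) = (\<lambda>_. 0)"
  using cycle_D[of y "Suc i"] by (simp add: cycle_def)

lemma eD: "y \<in> B (Suc 0) \<Longrightarrow> M (deg y) \<Longrightarrow> pairing (B 0) e (D y) = 0"
  using cycle_D[of y 0] by (simp add: cycle_def)

section \<open>Comparison of resolutions: lifts of the identity of \<open>R/I\<close> and their
  homotopies\<close>

definition chain_map_to ::
  "(nat \<Rightarrow> 'c set) \<Rightarrow> ('c \<Rightarrow> 'd) \<Rightarrow> ('c \<Rightarrow> 'c \<Rightarrow> 'k) \<Rightarrow> ('c \<Rightarrow> 'k) \<Rightarrow> (nat \<Rightarrow> 'b \<Rightarrow> 'c \<Rightarrow> 'k) \<Rightarrow> bool"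
  where "chain_map_to B' deg' D' e' \<phi> \<longleftrightarrow>
    (\<forall>i. \<forall>y\<in>B i. \<phi> i y \<in> supp deg' (B' i) (deg y)) \<and>
    (\<forall>y\<in>B 0. \<forall>\<gamma>. deg y \<le> \<gamma> \<longrightarrow> M \<gamma> \<longrightarrow> pairing (B' 0) e' (\<phi> 0 y) = e y) \<and>
    (\<forall>i. \<forall>y\<in>B (Suc i). lin_ext (B' (Suc i)) D' (\<phi> (Suc i) y) = lin_ext (B i) (\<phi> i) (D y))"

definition minimal :: bool
  where "minimal \<longleftrightarrow> (\<forall>i. \<forall>x\<in>B i. \<forall>y\<in>B (Suc i). deg x = deg y \<longrightarrow> D y x = 0)"

text \<open>This is the comparison theorem for free resolutions: the images of basis elements are
  chosen degree by degree, each as a preimage under \<open>D'\<close> of a vector that is a cycle by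
  the previous choice. The predicate \<open>P\<close> carries that cycle condition along.\<close>

lemma lift:
  fixes B' :: "nat \<Rightarrow> 'c set"
  assumes "based_resolution M B' deg' D' e'"
  shows "\<exists>\<phi>. chain_map_to B' deg' D' e' \<phi>"
proof -
  interpret R': based_resolution M B' deg' D' e' by (rule assms)
  define P where "P i f \<longleftrightarrow> (\<forall>y\<in>B i. f y \<in> supp deg' (B' i) (deg y)) \<and>
     (i = 0 \<longrightarrow> (\<forall>y\<in>B 0. \<forall>\<gamma>. deg y \<le> \<gamma> \<longrightarrow> M \<gamma> \<longrightarrow> pairing (B' 0) e' (f y) = e y)) \<and>
     (\<forall>y\<in>B (Suc i). cycle M B' D' e' i (deg y) (lin_ext (B i) f (D y)))" for i and f :: "'b \<Rightarrow> 'c \<Rightarrow> 'k"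
  define Q where "Q i f g \<longleftrightarrow> (\<forall>y\<in>B (Suc i). lin_ext (B' (Suc i)) D' (g y) = lin_ext (B i) f (D y))"
    for i and f g :: "'b \<Rightarrow> 'c \<Rightarrow> 'k"
  have base: "\<exists>f. P 0 f"
  proof -
    \<comment> \<open>Zero is a legitimate image when \<open>M (deg y)\<close> fails: by
      \<open>e_deg\<close>, \<open>e y\<close> must then vanish as soon as \<open>deg y\<close> lies
      below some degree satisfying \<open>M\<close>.\<close>
    have "\<exists>u. u \<in> supp deg' (B' 0) (deg y) \<and> (if M (deg y) then pairing (B' 0) e' u = e y else u = (\<lambda>_. 0))"
      if y: "y \<in> B 0" for y
    proof (cases "M (deg y)")
      case True
      then obtain x where x: "x \<in> B' 0" "deg' x \<le> deg y" "e' x \<noteq> 0"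
        using R'.e_surj by blast
      have "(\<lambda>z. (e y / e' x) * unit_at x z) \<in> supp deg' (B' 0) (deg y)"
        using x by (intro supp_scale) (auto intro: supp_mono supp_unit_at)
      moreover have "pairing (B' 0) e' (\<lambda>z. (e y / e' x) * unit_at x z) =
          (e y / e' x) * pairing (B' 0) e' (unit_at x)"
        by (simp add: pairing_def sum_distrib_left sum_divide_distrib mult_ac)
      ultimately show ?thesis
        using True x by (intro exI[of _ "\<lambda>z. (e y / e' x) * unit_at x z"])
          (simp add: pairing_unit_at R'.fin)
    qed auto
    then obtain f where f: "\<And>y. y \<in> B 0 \<Longrightarrow> f y \<in> supp deg' (B' 0) (deg y) \<and>
        (if M (deg y) then pairing (B' 0) e' (f y) = e y else f y = (\<lambda>_. 0))"
      by metis
    have f_aug: "pairing (B' 0) e' (f z) = e z" if z: "z \<in> B 0" "deg z \<le> \<gamma>" "M \<gamma>" for z \<gamma>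
    proof (cases "M (deg z)")
      case False
      then have "e z = 0" using e_deg[OF z(1) _ z(2,3)] by blast
      then show ?thesis using f[OF z(1)] False by (simp add: pairing_def)
    qed (use f[OF z(1)] in auto)
    have "pairing (B' 0) e' (lin_ext (B 0) f (D y)) = 0" if y: "y \<in> B (Suc 0)" "M (deg y)" for y
    proof -
      have "pairing (B' 0) e' (f z) * D y z = e z * D y z" if z: "z \<in> B 0" for z
        using f_aug[OF z _ y(2)] D_supp[OF y(1)] by (cases "D y z = 0") (auto simp: supp_def)
      then have "pairing (B' 0) e' (lin_ext (B 0) f (D y)) = pairing (B 0) e (D y)"
        unfolding pairing_lin_ext unfolding pairing_def[of "B 0"] by (intro sum.cong refl)
      then show ?thesis using eD[OF y] by simp
    qed
    then show ?thesis
      using f f_aug by (intro exI[of _ f]) (auto simp: P_def cycle_def)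
  qed
  have step: "\<exists>g. P (Suc i) g \<and> Q i f g" if P: "P i f" for i f
  proof -
    have "\<exists>w\<in>supp deg' (B' (Suc i)) (deg y). lin_ext (B i) f (D y) = lin_ext (B' (Suc i)) D' w"
      if y: "y \<in> B (Suc i)" for y
    proof -
      have "lin_ext (B i) f (D y) \<in> supp deg' (B' i) (deg y)"
        using P D_supp[OF y] by (intro lin_ext_supp) (auto simp: P_def)
      then show ?thesis
        using R'.exact P y by (auto simp: P_def)
    qed
    then obtain g where g: "\<And>y. y \<in> B (Suc i) \<Longrightarrow> g y \<in> supp deg' (B' (Suc i)) (deg y)"
      "\<And>y. y \<in> B (Suc i) \<Longrightarrow> lin_ext (B i) f (D y) = lin_ext (B' (Suc i)) D' (g y)"
      by metis
    have "cycle M B' D' e' (Suc i) (deg y) (lin_ext (B (Suc i)) g (D y))" if y: "y \<in> B (Suc (Suc i))" for y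
    proof -
      have "lin_ext (B' (Suc i)) D' (lin_ext (B (Suc i)) g (D y)) =
          lin_ext (B (Suc i)) (\<lambda>z. lin_ext (B i) f (D z)) (D y)"
        unfolding lin_ext_lin_ext by (intro lin_ext_cong) (simp add: g)
      also have "\<dots> = lin_ext (B i) f (lin_ext (B (Suc i)) D (D y))"
        by (simp add: lin_ext_lin_ext)
      finally show ?thesis using DD[OF y] by (simp add: cycle_def)
    qed
    then show ?thesis using g by (intro exI[of _ g]) (auto simp: P_def Q_def)
  qed
  obtain \<phi> where "\<forall>i. P i (\<phi> i)" "\<forall>i. Q i (\<phi> i) (\<phi> (Suc i))"
    using dependent_nat_choice[of P Q, OF base step] by auto
  then show ?thesis
    unfolding chain_map_to_def P_def Q_def by (intro exI[of _ \<phi>]) auto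
qed

text \<open>A chain endomorphism lifting the identity is homotopic to the identity, and by minimality the
  homotopy contributes nothing between basis elements of the same degree.\<close>

lemma minimal_endomorphism:
  assumes min: minimal and \<theta>: "chain_map_to B deg D e \<theta>"
  shows "x \<in> B i \<Longrightarrow> y \<in> B i \<Longrightarrow> deg x = deg y \<Longrightarrow> \<theta> i y x = unit_at y x"
proof -
  \<comment> \<open>The value that the boundary of the next homotopy must take at \<open>y\<close>:
    \<theta> minus the identity, minus the previous homotopy applied to \<open>D y\<close>. In
    degree 0 there is no previous homotopy and the argument \<open>h\<close> is ignored, hence
    \<open>undefined\<close> below.\<close>
  define pre :: "nat \<Rightarrow> ('b \<Rightarrow> 'b \<Rightarrow> 'k) \<Rightarrow> 'b \<Rightarrow> 'b \<Rightarrow> 'k" where "pre i h y = (case i of 0 \<Rightarrow> (\<lambda>x. \<theta> 0 y x - unit_at y x) |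
      Suc j \<Rightarrow> (\<lambda>x. \<theta> i y x - unit_at y x - lin_ext (B j) h (D y) x))"
    for i h y
  define P where "P i h \<longleftrightarrow> (\<forall>y\<in>B i. h y \<in> supp deg (B (Suc i)) (deg y)) \<and>
     (i = 0 \<longrightarrow> (\<forall>y\<in>B 0. lin_ext (B (Suc 0)) D (h y) = pre 0 undefined y)) \<and>
     (\<forall>y\<in>B (Suc i). cycle M B D e (Suc i) (deg y) (pre (Suc i) h y))" for i h
  define Q where "Q i h g \<longleftrightarrow> (\<forall>y\<in>B (Suc i). lin_ext (B (Suc (Suc i))) D (g y) = pre (Suc i) h y)" for i h g
  have \<theta>_supp: "\<And>i y. y \<in> B i \<Longrightarrow> \<theta> i y \<in> supp deg (B i) (deg y)"
    and \<theta>_comm: "\<And>i y. y \<in> B (Suc i) \<Longrightarrow> lin_ext (B (Suc i)) D (\<theta> (Suc i) y) = lin_ext (B i) (\<theta> i) (D y)"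
    using \<theta> by (auto simp: chain_map_to_def)
  have D_unit: "lin_ext (B i) unit_at (D y) = D y" if "y \<in> B (Suc i)" for i y
    using lin_ext_unit[OF fin D_supp[OF that]] .
  have pre_D: "lin_ext (B (Suc i)) D (pre (Suc i) h y) =
      (\<lambda>x. lin_ext (B i) (\<lambda>z. \<lambda>x. \<theta> i z x - unit_at z x) (D y) x - lin_ext (B i) (\<lambda>z. lin_ext (B (Suc i)) D (h z)) (D y) x)"
    if y: "y \<in> B (Suc i)" for i h y
  proof -
    have "lin_ext (B i) (\<lambda>z. \<lambda>x. \<theta> i z x - unit_at z x) (D y) =
       (\<lambda>x. lin_ext (B i) (\<theta> i) (D y) x - lin_ext (B i) unit_at (D y) x)"
      by (simp add: lin_ext_def algebra_simps sum_subtractf)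
    then show ?thesis
      by (simp add: pre_def lin_ext_diff \<theta>_comm[OF y] lin_ext_unit_at[OF fin y] D_unit[OF y] lin_ext_lin_ext)
  qed
  have base: "\<exists>h. P 0 h"
  proof -
    have "\<exists>w\<in>supp deg (B (Suc 0)) (deg y). pre 0 undefined y = lin_ext (B (Suc 0)) D w" if y: "y \<in> B 0" for y
    proof -
      have "pre 0 undefined y \<in> supp deg (B 0) (deg y)"
        using supp_diff[OF \<theta>_supp[OF y] supp_unit_at[OF y]] by (simp add: pre_def)
      moreover have "cycle M B D e 0 (deg y) (pre 0 undefined y)"
        using \<theta> y by (auto simp: cycle_def pre_def pairing_diff chain_map_to_def pairing_unit_at fin)
      ultimately show ?thesis using exact by blast
    qed
    then obtain h where h: "\<And>y. y \<in> B 0 \<Longrightarrow> h y \<in> supp deg (B (Suc 0)) (deg y)"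
      "\<And>y. y \<in> B 0 \<Longrightarrow> pre 0 undefined y = lin_ext (B (Suc 0)) D (h y)"
      by metis
    have "lin_ext (B (Suc 0)) D (pre (Suc 0) h y) = (\<lambda>_. 0)" if y: "y \<in> B (Suc 0)" for y
    proof -
      have "lin_ext (B 0) (\<lambda>z. lin_ext (B (Suc 0)) D (h z)) (D y) = lin_ext (B 0) (pre 0 undefined) (D y)"
        by (intro lin_ext_cong) (simp add: h)
      moreover have "pre 0 undefined = (\<lambda>y x. \<theta> 0 y x - unit_at y x)"
        by (simp add: pre_def fun_eq_iff)
      ultimately show ?thesis
        using pre_D[OF y, of h] by simp
    qed
    then show ?thesis using h by (intro exI[of _ h]) (auto simp: P_def cycle_def)
  qed
  have step: "\<exists>g. P (Suc i) g \<and> Q i h g" if P: "P i h" for i h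
  proof -
    have "\<exists>w\<in>supp deg (B (Suc (Suc i))) (deg y). pre (Suc i) h y = lin_ext (B (Suc (Suc i))) D w"
      if y: "y \<in> B (Suc i)" for y
    proof -
      have "lin_ext (B i) h (D y) \<in> supp deg (B (Suc i)) (deg y)"
        using P D_supp[OF y] by (intro lin_ext_supp) (auto simp: P_def)
      then have "pre (Suc i) h y \<in> supp deg (B (Suc i)) (deg y)"
        using supp_diff[OF supp_diff[OF \<theta>_supp[OF y] supp_unit_at[OF y]]] by (simp add: pre_def)
      then show ?thesis using exact P y by (auto simp: P_def)
    qed
    then obtain g where g: "\<And>y. y \<in> B (Suc i) \<Longrightarrow> g y \<in> supp deg (B (Suc (Suc i))) (deg y)"
      "\<And>y. y \<in> B (Suc i) \<Longrightarrow> pre (Suc i) h y = lin_ext (B (Suc (Suc i))) D (g y)"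
      by metis
    have "lin_ext (B (Suc (Suc i))) D (pre (Suc (Suc i)) g y) = (\<lambda>_. 0)" if y: "y \<in> B (Suc (Suc i))" for y
    proof -
      have "lin_ext (B (Suc i)) (\<lambda>z. lin_ext (B (Suc (Suc i))) D (g z)) (D y) = lin_ext (B (Suc i)) (pre (Suc i) h) (D y)"
        by (intro lin_ext_cong) (simp add: g)
      also have "\<dots> = (\<lambda>x. lin_ext (B (Suc i)) (\<lambda>z. \<lambda>x. \<theta> (Suc i) z x - unit_at z x) (D y) x
           - lin_ext (B (Suc i)) (\<lambda>z. lin_ext (B i) h (D z)) (D y) x)"
        by (simp add: pre_def lin_ext_def algebra_simps sum_subtractf)
      also have "lin_ext (B (Suc i)) (\<lambda>z. lin_ext (B i) h (D z)) (D y) = lin_ext (B i) h (lin_ext (B (Suc i)) D (D y))"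
        by (simp add: lin_ext_lin_ext)
      also have "\<dots> = (\<lambda>_. 0)" by (simp add: DD[OF y])
      finally show ?thesis
        using pre_D[OF y, of g] by simp
    qed
    then show ?thesis using g by (intro exI[of _ g]) (auto simp: P_def Q_def cycle_def)
  qed
  obtain h where h: "\<forall>i. P i (h i)" "\<forall>i. Q i (h i) (h (Suc i))"
    using dependent_nat_choice[of P Q, OF base step] by auto
  have h_supp: "\<And>i y. y \<in> B i \<Longrightarrow> h i y \<in> supp deg (B (Suc i)) (deg y)"
    using h by (auto simp: P_def)
  \<comment> \<open>A nonzero summand at \<open>z\<close> would give
    \<open>deg x \<le> deg z \<le> deg y = deg x\<close>, so all degrees are equal and minimality
    makes \<open>D z x\<close> vanish. The same squeeze proves \<open>hD\<close>.\<close>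
  have Dh: "lin_ext (B (Suc i)) D (h i y) x = 0" if "x \<in> B i" "y \<in> B i" "deg x = deg y" for i x y
    unfolding lin_ext_def
  proof (intro sum.neutral ballI)
    fix z assume z: "z \<in> B (Suc i)"
    show "D z x * h i y z = 0"
    proof (rule ccontr)
      assume "D z x * h i y z \<noteq> 0"
      then have "deg x \<le> deg z" "deg z \<le> deg y" "D z x \<noteq> 0"
        using D_supp[OF z] h_supp[OF that(2)] by (auto simp: supp_def)
      then show False using min that z by (force simp: minimal_def)
    qed
  qed
  have hD: "lin_ext (B i) (h i) (D y) x = 0" if "x \<in> B (Suc i)" "y \<in> B (Suc i)" "deg x = deg y" for i x y
    unfolding lin_ext_def
  proof (intro sum.neutral ballI)
    fix z assume z: "z \<in> B i"
    show "h i z x * D y z = 0"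
    proof (rule ccontr)
      assume "h i z x * D y z \<noteq> 0"
      then have "deg x \<le> deg z" "deg z \<le> deg y" "D y z \<noteq> 0"
        using D_supp[OF that(2)] h_supp[OF z] by (auto simp: supp_def)
      then show False using min that z by (force simp: minimal_def)
    qed
  qed
  show "\<theta> i y x = unit_at y x" if xy: "x \<in> B i" "y \<in> B i" "deg x = deg y"
  proof (cases i)
    case 0
    then have "lin_ext (B (Suc 0)) D (h 0 y) x = pre 0 undefined y x"
      using h(1) xy by (auto simp: P_def)
    then show ?thesis using Dh[OF xy] 0 by (simp add: pre_def)
  next
    case (Suc j)
    then have "lin_ext (B (Suc i)) D (h i y) x = pre i (h j) y x"
      using h(2) xy by (auto simp: Q_def)
    then show ?thesis using Dh[OF xy] hD[of x j y] xy Suc by (simp add: pre_def)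
  qed
qed

end

text \<open>Otherwise pad \<open>p\<close> with zero columns and \<open>q\<close> with zero rows to
  square matrices of size \<open>card X\<close>. A one-sided inverse of a square matrix is
  two-sided, but the product in the other order has a zero row.\<close>

lemma card_le_of_left_inverse:
  fixes p :: "'a \<Rightarrow> 'b \<Rightarrow> 'k::field"
  assumes fin: "finite X" "finite Y"
    and pq: "\<And>x y. x \<in> X \<Longrightarrow> y \<in> X \<Longrightarrow> (\<Sum>z\<in>Y. p x z * q z y) = (if x = y then 1 else 0)"
  shows "card X \<le> card Y"
proof (rule ccontr)
  assume "\<not> card X \<le> card Y"
  define n where "n = card X"
  define m where "m = card Y"
  have mn: "m < n" using \<open>\<not> card X \<le> card Y\<close> by (simp add: m_def n_def)
  obtain f where f: "bij_betw f {0..<n} X" using ex_bij_betw_nat_finite[OF fin(1)] n_def by auto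
  obtain g where g: "bij_betw g {0..<m} Y" using ex_bij_betw_nat_finite[OF fin(2)] m_def by auto
  define P where "P = mat n n (\<lambda>(i,j). if j < m then p (f i) (g j) else 0)"
  define Q where "Q = mat n n (\<lambda>(j,i). if j < m then q (g j) (f i) else 0)"
  have PQ: "P * Q = 1\<^sub>m n"
  proof (rule eq_matI)
    fix i j assume "i < dim_row (1\<^sub>m n)" "j < dim_col (1\<^sub>m n)"
    then have ij: "i < n" "j < n" by auto
    have "(P * Q) $$ (i,j) = (\<Sum>k\<in>{0..<n}. if k < m then p (f i) (g k) * q (g k) (f j) else 0)"
      using ij by (auto simp: P_def Q_def scalar_prod_def intro!: sum.cong)
    also have "\<dots> = (\<Sum>k\<in>{0..<m}. p (f i) (g k) * q (g k) (f j))"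
      using mn by (intro sum.mono_neutral_cong_right) auto
    also have "\<dots> = (\<Sum>z\<in>Y. p (f i) z * q z (f j))"
      by (rule sum.reindex_bij_betw[OF g])
    also have "\<dots> = (if f i = f j then 1 else 0)"
      using ij f by (intro pq) (auto dest: bij_betwE)
    also have "\<dots> = 1\<^sub>m n $$ (i,j)"
      using ij f by (auto simp: bij_betw_def inj_on_def)
    finally show "(P * Q) $$ (i,j) = 1\<^sub>m n $$ (i,j)" .
  qed (auto simp: P_def Q_def)
  have "Q * P = 1\<^sub>m n"
    by (rule mat_mult_left_right_inverse[OF _ _ PQ]) (auto simp: P_def Q_def)
  moreover have "(Q * P) $$ (m,m) = 0"
    using mn by (simp add: P_def Q_def scalar_prod_def)
  ultimately show False using mn by simp
qed

text \<open>The identity of the minimal resolution lifts through the other one. In degree \<alpha>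
  the composite is the identity by \<open>minimal_endomorphism\<close>, and only basis elements of
  degree exactly \<alpha> contribute to it, since degrees can only decrease along each of the two
  maps.\<close>

lemma minimal_card_le:
  fixes D :: "'b \<Rightarrow> 'b \<Rightarrow> 'k::field" and D' :: "'c \<Rightarrow> 'c \<Rightarrow> 'k"
  assumes "based_resolution M B deg D e" "based_resolution.minimal B deg D"
    and "based_resolution M B' deg' D' e'"
  shows "card {x \<in> B i. deg x = \<alpha>} \<le> card {x \<in> B' i. deg' x = \<alpha>}"
proof -
  interpret R: based_resolution M B deg D e by fact
  interpret R': based_resolution M B' deg' D' e' by fact
  obtain \<phi> where \<phi>: "R.chain_map_to B' deg' D' e' \<phi>" using R.lift assms(3) by blast
  obtain \<psi> where \<psi>: "R'.chain_map_to B deg D e \<psi>" using R'.lift assms(1) by blast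
  have \<phi>_supp: "\<And>i y. y \<in> B i \<Longrightarrow> \<phi> i y \<in> supp deg' (B' i) (deg y)"
    and \<psi>_supp: "\<And>i y. y \<in> B' i \<Longrightarrow> \<psi> i y \<in> supp deg (B i) (deg' y)"
    using \<phi> \<psi> by (auto simp: R.chain_map_to_def R'.chain_map_to_def)
  define \<theta> where "\<theta> i y = lin_ext (B' i) (\<psi> i) (\<phi> i y)" for i y
  have "R.chain_map_to B deg D e \<theta>"
    unfolding R.chain_map_to_def
  proof (intro conjI allI ballI impI)
    show "\<theta> i y \<in> supp deg (B i) (deg y)" if "y \<in> B i" for i y
      unfolding \<theta>_def by (rule lin_ext_supp[OF \<psi>_supp \<phi>_supp]) (use that in auto)
    show "pairing (B 0) e (\<theta> 0 y) = e y" if y: "y \<in> B 0" "deg y \<le> \<gamma>" "M \<gamma>" for y \<gamma>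
    proof -
      have "pairing (B 0) e (\<psi> 0 z) * \<phi> 0 y z = e' z * \<phi> 0 y z" if z: "z \<in> B' 0" for z
      proof (cases "\<phi> 0 y z = 0")
        case False
        then have "deg' z \<le> \<gamma>" using \<phi>_supp[OF y(1)] y by (auto simp: supp_def intro: order_trans)
        then show ?thesis using \<psi> z y by (auto simp: R'.chain_map_to_def)
      qed simp
      then have "pairing (B 0) e (\<theta> 0 y) = pairing (B' 0) e' (\<phi> 0 y)"
        unfolding \<theta>_def pairing_lin_ext unfolding pairing_def[of "B' 0"] by (intro sum.cong refl)
      then show ?thesis
        using \<phi> y by (auto simp: R.chain_map_to_def)
    qed
    show "lin_ext (B (Suc i)) D (\<theta> (Suc i) y) = lin_ext (B i) (\<theta> i) (D y)" if y: "y \<in> B (Suc i)" for i y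
    proof -
      have "lin_ext (B (Suc i)) D (\<theta> (Suc i) y) = lin_ext (B' (Suc i)) (\<lambda>z. lin_ext (B (Suc i)) D (\<psi> (Suc i) z)) (\<phi> (Suc i) y)"
        unfolding \<theta>_def by (simp add: lin_ext_lin_ext)
      also have "\<dots> = lin_ext (B' (Suc i)) (\<lambda>z. lin_ext (B' i) (\<psi> i) (D' z)) (\<phi> (Suc i) y)"
        using \<psi> by (intro lin_ext_cong) (auto simp: R'.chain_map_to_def)
      also have "\<dots> = lin_ext (B' i) (\<psi> i) (lin_ext (B' (Suc i)) D' (\<phi> (Suc i) y))"
        by (simp add: lin_ext_lin_ext)
      also have "\<dots> = lin_ext (B' i) (\<psi> i) (lin_ext (B i) (\<phi> i) (D y))"
        using \<phi> y by (simp add: R.chain_map_to_def)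
      also have "\<dots> = lin_ext (B i) (\<theta> i) (D y)"
        unfolding \<theta>_def by (simp add: lin_ext_lin_ext)
      finally show ?thesis .
    qed
  qed
  then have unit: "\<theta> i y x = unit_at y x" if "x \<in> B i" "y \<in> B i" "deg x = deg y" for x y
    using R.minimal_endomorphism[OF assms(2)] that by blast
  have "(\<Sum>z\<in>{z \<in> B' i. deg' z = \<alpha>}. \<psi> i z x * \<phi> i y z) = (if x = y then 1 else 0)"
    if xy: "x \<in> {x \<in> B i. deg x = \<alpha>}" "y \<in> {x \<in> B i. deg x = \<alpha>}" for x y
  proof -
    have "\<psi> i z x * \<phi> i y z = 0" if z: "z \<in> B' i" "deg' z \<noteq> \<alpha>" for z
    proof (rule ccontr)
      assume "\<psi> i z x * \<phi> i y z \<noteq> 0"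
      then have "deg x \<le> deg' z" "deg' z \<le> deg y"
        using \<psi>_supp[OF z(1)] \<phi>_supp[of y i] xy by (auto simp: supp_def)
      then show False using xy z by auto
    qed
    then have "(\<Sum>z\<in>{z \<in> B' i. deg' z = \<alpha>}. \<psi> i z x * \<phi> i y z) = (\<Sum>z\<in>B' i. \<psi> i z x * \<phi> i y z)"
      by (intro sum.mono_neutral_left) (auto simp: R'.fin)
    also have "\<dots> = unit_at y x"
      using unit[of x y] xy by (simp add: \<theta>_def lin_ext_def)
    finally show ?thesis by (simp add: unit_at_def)
  qed
  then show ?thesis
    by (intro card_le_of_left_inverse[where p = "\<lambda>x z. \<psi> i z x" and q = "\<lambda>z y. \<phi> i y z"])
      (auto simp: R.fin R'.fin)
qed

subsection \<open>From polynomial matrices to scalars\<close>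

definition mon_exp :: "'n mon \<Rightarrow> 'n mdegree"
  where "mon_exp t = (\<lambda>x. int (Poly_Mapping.lookup t x))"

definition exp_mon :: "'n::finite mdegree \<Rightarrow> 'n mon"
  where "exp_mon \<gamma> = Abs_poly_mapping (\<lambda>x. nat (\<gamma> x))"

text \<open>The degree of a matrix entry is a difference of degrees and may have negative entries,
  where the graded piece of the ring is zero; \<open>hterm\<close> and \<open>hcoeff\<close> both
  return 0 there.\<close>

definition hterm :: "'n::finite mdegree \<Rightarrow> 'k \<Rightarrow> ('n, 'k::field) mpoly"
  where "hterm \<gamma> a = (if \<forall>x. 0 \<le> \<gamma> x then Poly_Mapping.single (exp_mon \<gamma>) a else 0)"

definition hcoeff :: "'n::finite mdegree \<Rightarrow> ('n, 'k::field) mpoly \<Rightarrow> 'k"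
  where "hcoeff \<gamma> p = (if \<forall>x. 0 \<le> \<gamma> x then Poly_Mapping.lookup p (exp_mon \<gamma>) else 0)"

lemma lookup_exp_mon [simp]: "Poly_Mapping.lookup (exp_mon \<gamma>) x = nat (\<gamma> x)"
  by (simp add: exp_mon_def)

lemma exp_mon_mon_exp [simp]: "exp_mon (mon_exp t) = t"
  by (rule poly_mapping_eqI) (simp add: mon_exp_def)

lemma mon_exp_exp_mon: "(\<And>x. 0 \<le> \<gamma> x) \<Longrightarrow> mon_exp (exp_mon \<gamma>) = \<gamma>"
  by (simp add: mon_exp_def fun_eq_iff)

lemma mon_exp_nonneg [simp]: "0 \<le> mon_exp t x"
  by (simp add: mon_exp_def)

lemma hcoeff_mon_exp [simp]: "hcoeff (mon_exp t) p = Poly_Mapping.lookup p t"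
  by (simp add: hcoeff_def)

lemma mpoly_eq_sum: "p = (\<Sum>u\<in>Poly_Mapping.keys p. Poly_Mapping.single u (Poly_Mapping.lookup p u))"
  by (rule poly_mapping_eqI)
    (simp add: lookup_sum lookup_single when_def in_keys_iff)

lemma lookup_single_times:
  fixes p :: "'a::cancel_comm_monoid_add \<Rightarrow>\<^sub>0 'k::comm_ring_1"
  shows "Poly_Mapping.lookup (Poly_Mapping.single s a * p) t =
    (\<Sum>u\<in>Poly_Mapping.keys p. (a * Poly_Mapping.lookup p u when s + u = t))"
proof -
  have "Poly_Mapping.single s a * p =
      (\<Sum>u\<in>Poly_Mapping.keys p. Poly_Mapping.single (s + u) (a * Poly_Mapping.lookup p u))"
    by (subst mpoly_eq_sum[of p]) (simp add: sum_distrib_left mult_single)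
  then show ?thesis by (simp add: lookup_sum lookup_single)
qed

lemma lookup_single_times_add:
  fixes p :: "'a::cancel_comm_monoid_add \<Rightarrow>\<^sub>0 'k::comm_ring_1"
  shows "Poly_Mapping.lookup (Poly_Mapping.single s a * p) (s + t) = a * Poly_Mapping.lookup p t"
  by (simp add: lookup_single_times when_def in_keys_iff)

lemma hcoeff_hterm: "hcoeff \<gamma> (hterm \<delta> a) = (if \<gamma> = \<delta> \<and> (\<forall>x. 0 \<le> \<gamma> x) then a else 0)"
proof -
  have "exp_mon \<delta> = exp_mon \<gamma> \<longleftrightarrow> \<delta> = \<gamma>" if "\<forall>x. 0 \<le> \<gamma> x" "\<forall>x. 0 \<le> \<delta> x"
    using mon_exp_exp_mon that by metis
  then show ?thesis by (auto simp: hcoeff_def hterm_def lookup_single when_def)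
qed

lemma hcoeff_0 [simp]: "hcoeff \<gamma> 0 = 0"
  by (simp add: hcoeff_def)

lemma hcoeff_diff: "hcoeff \<gamma> (p - q) = hcoeff \<gamma> p - hcoeff \<gamma> q"
  by (simp add: hcoeff_def lookup_minus)

lemma hcoeff_sum:
  fixes f :: "'i \<Rightarrow> ('n::finite, 'k::field) mpoly"
  shows "hcoeff \<gamma> (sum f A) = (\<Sum>a\<in>A. hcoeff \<gamma> (f a))"
proof (cases "\<forall>x. 0 \<le> \<gamma> x")
  case False
  then have "hcoeff \<gamma> p = 0" for p :: "('n, 'k) mpoly"
    by (simp only: hcoeff_def if_False)
  then show ?thesis by simp
qed (simp add: hcoeff_def lookup_sum)

text \<open>If \<delta> has a negative entry, the left side is 0 while the right side need not be.
  Later uses therefore first split off the case of a zero scalar; a nonzero scalar guarantees a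
  nonnegative degree.\<close>

lemma hcoeff_hterm_times:
  assumes "\<forall>x. 0 \<le> \<delta> x"
  shows "hcoeff \<gamma> (hterm \<delta> a * p) = a * hcoeff (\<lambda>x. \<gamma> x - \<delta> x) p"
proof (cases "\<forall>x. 0 \<le> \<gamma> x - \<delta> x")
  case True
  then have "\<forall>x. 0 \<le> \<gamma> x" using assms by (metis add_nonneg_nonneg diff_add_cancel)
  moreover have "exp_mon \<gamma> = exp_mon \<delta> + exp_mon (\<lambda>x. \<gamma> x - \<delta> x)"
    using True assms by (intro poly_mapping_eqI) (simp add: lookup_add flip: nat_add_distrib)
  ultimately show ?thesis
    using True assms by (simp add: hcoeff_def hterm_def lookup_single_times_add)
next
  case False
  have "exp_mon \<delta> + u \<noteq> exp_mon \<gamma>" if "\<forall>x. 0 \<le> \<gamma> x" for u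
  proof
    assume "exp_mon \<delta> + u = exp_mon \<gamma>"
    then have "nat (\<delta> x) + Poly_Mapping.lookup u x = nat (\<gamma> x)" for x
      by (metis lookup_add lookup_exp_mon)
    then have "0 \<le> \<gamma> x - \<delta> x" for x
      using that[rule_format, of x] assms[rule_format, of x]
      by (metis diff_ge_0_iff_ge le_add1 nat_le_eq_zle order_trans nle_le)
    then show False using False by blast
  qed
  then show ?thesis
    using False assms by (auto simp: hcoeff_def hterm_def lookup_single_times when_def)
qed

text \<open>The grading by exponent vectors is so fine that each graded piece of the ring has
  dimension at most one. Hence a homogeneous matrix entry carries exactly one scalar.\<close>

lemma homogeneous_eq_hterm: "homogeneous \<delta> f \<Longrightarrow> f = hterm \<delta> (hcoeff \<delta> f)"
proof (rule poly_mapping_eqI)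
  fix t assume f: "homogeneous \<delta> f"
  have *: "mon_exp t = \<delta>" if "Poly_Mapping.lookup f t \<noteq> 0"
    using f that by (auto simp: homogeneous_def mon_exp_def in_keys_iff)
  show "Poly_Mapping.lookup f t = Poly_Mapping.lookup (hterm \<delta> (hcoeff \<delta> f)) t"
  proof (cases "mon_exp t = \<delta>")
    case True
    then show ?thesis by (auto simp: hterm_def hcoeff_def)
  next
    case False
    then have "exp_mon \<delta> \<noteq> t" if "\<forall>x. 0 \<le> \<delta> x" using that mon_exp_exp_mon by metis
    then show ?thesis using * False by (auto simp: hterm_def lookup_single when_def)
  qed
qed

lemma homogeneous_hterm: "homogeneous \<delta> (hterm \<delta> a)"
  by (auto simp: homogeneous_def hterm_def split: if_splits)

lemma hcoeff_eqI: "(\<And>\<gamma>. hcoeff \<gamma> p = hcoeff \<gamma> q) \<Longrightarrow> p = q"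
  by (rule poly_mapping_eqI) (metis hcoeff_mon_exp)

section \<open>Degree components of vectors and matrices over the polynomial ring\<close>

definition idx :: "'b list \<Rightarrow> 'b \<Rightarrow> nat"
  where "idx xs x = (SOME a. a < length xs \<and> xs ! a = x)"

lemma idx_nth: "distinct xs \<Longrightarrow> a < length xs \<Longrightarrow> idx xs (xs ! a) = a"
  unfolding idx_def by (rule some_equality) (auto simp: nth_eq_iff_index_eq)

lemma sum_set_distinct: "distinct xs \<Longrightarrow> sum f (set xs) = (\<Sum>a<length xs. f (xs ! a))"
  by (simp add: sum.distinct_set_conv_list sum_list_sum_nth atLeast0LessThan)

text \<open>The component of degree \<gamma> of a vector in the direct sum of the
  \<open>R(-deg x)\<close>, read as scalars on the basis \<open>xs\<close>. In the other direction,
  \<open>unstrand\<close> builds a vector concentrated in degree \<gamma>.\<close>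

definition strand :: "'b list \<Rightarrow> ('b \<Rightarrow> 'n::finite mdegree) \<Rightarrow> 'n mdegree \<Rightarrow> ('n, 'k::field) mpoly vec \<Rightarrow> 'b \<Rightarrow> 'k"
  where "strand xs deg \<gamma> w = (\<lambda>x. if x \<in> set xs then hcoeff (\<lambda>i. \<gamma> i - deg x i) (w $ idx xs x) else 0)"

definition unstrand :: "'b list \<Rightarrow> ('b \<Rightarrow> 'n::finite mdegree) \<Rightarrow> 'n mdegree \<Rightarrow> ('b \<Rightarrow> 'k) \<Rightarrow> ('n, 'k::field) mpoly vec"
  where "unstrand xs deg \<gamma> v = vec (length xs) (\<lambda>a. hterm (\<lambda>i. \<gamma> i - deg (xs ! a) i) (v (xs ! a)))"

lemma unstrand_carrier [simp]: "unstrand xs deg \<gamma> v \<in> carrier_vec (length xs)"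
  by (simp add: unstrand_def)

lemma strand_nth: "distinct xs \<Longrightarrow> a < length xs \<Longrightarrow>
    strand xs deg \<gamma> w (xs ! a) = hcoeff (\<lambda>i. \<gamma> i - deg (xs ! a) i) (w $ a)"
  by (simp add: strand_def idx_nth)

lemma strand_supp: "strand xs deg \<gamma> w \<in> supp deg (set xs) \<gamma>"
  by (auto simp: strand_def supp_def hcoeff_def le_fun_def split: if_splits)

lemma strand_unstrand:
  assumes "distinct xs" "v \<in> supp deg (set xs) \<gamma>"
  shows "strand xs deg \<delta> (unstrand xs deg \<gamma> v) = (if \<delta> = \<gamma> then v else (\<lambda>_. 0))"
proof
  fix x
  show "strand xs deg \<delta> (unstrand xs deg \<gamma> v) x = (if \<delta> = \<gamma> then v else (\<lambda>_. 0)) x"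
  proof (cases "x \<in> set xs")
    case True
    then obtain a where a: "a < length xs" "x = xs ! a" by (metis in_set_conv_nth)
    have "(\<lambda>i. \<delta> i - deg x i) = (\<lambda>i. \<gamma> i - deg x i) \<longleftrightarrow> \<delta> = \<gamma>"
      by (auto simp: fun_eq_iff)
    moreover have "v x \<noteq> 0 \<Longrightarrow> 0 \<le> \<gamma> i - deg x i" for i
      using assms(2) by (auto simp: supp_def le_fun_def)
    ultimately show ?thesis
      using a assms(1) by (auto simp: strand_nth unstrand_def hcoeff_hterm)
  next
    case False
    then show ?thesis using assms(2) by (auto simp: strand_def supp_def)
  qed
qed

lemma strand_inj:
  assumes "distinct xs" "u \<in> carrier_vec (length xs)" "v \<in> carrier_vec (length xs)"
    and eq: "\<And>\<gamma>. strand xs deg \<gamma> u = strand xs deg \<gamma> v"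
  shows "u = v"
proof (rule eq_vecI)
  fix a assume a: "a < dim_vec v"
  have "hcoeff \<gamma> (u $ a) = hcoeff \<gamma> (v $ a)" for \<gamma>
    using fun_cong[OF eq[of "\<lambda>i. \<gamma> i + deg (xs ! a) i"], of "xs ! a"] a assms(1-3)
    by (simp add: strand_nth)
  then show "u $ a = v $ a" by (rule hcoeff_eqI)
qed (use assms in auto)

lemma strand_zero [simp]: "distinct xs \<Longrightarrow> strand xs deg \<gamma> (0\<^sub>v (length xs)) = (\<lambda>_. 0)"
proof
  fix x assume "distinct xs"
  show "strand xs deg \<gamma> (0\<^sub>v (length xs)) x = 0"
  proof (cases "x \<in> set xs")
    case True
    then obtain a where "a < length xs" "x = xs ! a" by (metis in_set_conv_nth)
    then show ?thesis using \<open>distinct xs\<close> by (simp add: strand_nth)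
  qed (simp add: strand_def)
qed

text \<open>Polynomials have finitely many terms, so scalars given in all degrees assemble to a
  vector only after restriction to a finite set \<open>\<Gamma>\<close> of degrees.\<close>

lemma glue_strands:
  assumes dist: "distinct ys" and fin: "finite \<Gamma>" and W: "\<And>\<gamma>. W \<gamma> \<in> supp deg (set ys) \<gamma>"
  obtains w :: "('n::finite, 'k::field) mpoly vec" where "w \<in> carrier_vec (length ys)"
    "\<And>\<gamma>. strand ys deg \<gamma> w = (if \<gamma> \<in> \<Gamma> then W \<gamma> else (\<lambda>_. 0))"
proof -
  define w where "w = vec (length ys) (\<lambda>b. \<Sum>\<gamma>\<in>\<Gamma>. unstrand ys deg \<gamma> (W \<gamma>) $ b)"
  have "strand ys deg \<gamma> w = (if \<gamma> \<in> \<Gamma> then W \<gamma> else (\<lambda>_. 0))" for \<gamma>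
  proof
    fix y
    show "strand ys deg \<gamma> w y = (if \<gamma> \<in> \<Gamma> then W \<gamma> else (\<lambda>_. 0)) y"
    proof (cases "y \<in> set ys")
      case True
      then obtain b where b: "b < length ys" "y = ys ! b" by (metis in_set_conv_nth)
      have "strand ys deg \<gamma> w y = (\<Sum>\<delta>\<in>\<Gamma>. strand ys deg \<gamma> (unstrand ys deg \<delta> (W \<delta>)) y)"
        using b dist by (simp add: strand_nth w_def hcoeff_sum)
      also have "\<dots> = (\<Sum>\<delta>\<in>\<Gamma>. if \<gamma> = \<delta> then W \<delta> y else 0)"
        using W dist by (intro sum.cong refl) (simp add: strand_unstrand)
      finally show ?thesis using fin by simp
    next
      case False
      then show ?thesis using W[of \<gamma>] by (auto simp: strand_def supp_def)
    qed
  qed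
  then show ?thesis using that[of w] by (simp add: w_def)
qed

locale graded_presentation =
  fixes xs ys :: "'b list" and deg :: "'b \<Rightarrow> 'n::finite mdegree"
    and A :: "('n, 'k::field) mpoly mat" and D :: "'b \<Rightarrow> 'b \<Rightarrow> 'k"
  assumes dist: "distinct xs" "distinct ys"
    and carr: "A \<in> carrier_mat (length xs) (length ys)"
    and hom: "\<And>a b. a < length xs \<Longrightarrow> b < length ys \<Longrightarrow>
      homogeneous (\<lambda>i. deg (ys ! b) i - deg (xs ! a) i) (A $$ (a, b))"
    and D_nth: "\<And>a b. a < length xs \<Longrightarrow> b < length ys \<Longrightarrow>
      D (ys ! b) (xs ! a) = hcoeff (\<lambda>i. deg (ys ! b) i - deg (xs ! a) i) (A $$ (a, b))"
    and D_out: "\<And>x y. y \<in> set ys \<Longrightarrow> x \<notin> set xs \<Longrightarrow> D y x = 0"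
begin

lemma A_nth: "a < length xs \<Longrightarrow> b < length ys \<Longrightarrow>
    A $$ (a, b) = hterm (\<lambda>i. deg (ys ! b) i - deg (xs ! a) i) (D (ys ! b) (xs ! a))"
  using homogeneous_eq_hterm[OF hom] D_nth by simp

lemma D_supp: "y \<in> set ys \<Longrightarrow> D y \<in> supp deg (set xs) (deg y)"
proof -
  assume y: "y \<in> set ys"
  have "x \<in> set xs \<and> deg x \<le> deg y" if "D y x \<noteq> 0" for x
  proof -
    have x: "x \<in> set xs" using D_out[OF y] that by blast
    then obtain a b where ab: "a < length xs" "x = xs ! a" "b < length ys" "y = ys ! b"
      using y by (metis in_set_conv_nth)
    have "D y x = 0 \<or> (\<forall>i. 0 \<le> deg y i - deg x i)"
      unfolding ab(2,4) D_nth[OF ab(1,3)] hcoeff_def by (auto split: if_splits)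
    then show ?thesis using x that by (auto simp: le_fun_def)
  qed
  then show ?thesis by (simp add: supp_def)
qed

lemma strand_mult:
  assumes w: "w \<in> carrier_vec (length ys)"
  shows "strand xs deg \<gamma> (A *\<^sub>v w) = lin_ext (set ys) D (strand ys deg \<gamma> w)"
proof
  fix x
  show "strand xs deg \<gamma> (A *\<^sub>v w) x = lin_ext (set ys) D (strand ys deg \<gamma> w) x"
  proof (cases "x \<in> set xs")
    case True
    then obtain a where a: "a < length xs" "x = xs ! a" by (metis in_set_conv_nth)
    have "hcoeff (\<lambda>i. \<gamma> i - deg x i) (A $$ (a, b) * w $ b) =
        D (ys ! b) x * hcoeff (\<lambda>i. \<gamma> i - deg (ys ! b) i) (w $ b)" if b: "b < length ys" for b
    proof (cases "D (ys ! b) x = 0")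
      case True
      then show ?thesis using A_nth a b by (simp add: hterm_def)
    next
      case False
      then have "deg x \<le> deg (ys ! b)" using D_supp[of "ys ! b"] b by (auto simp: supp_def)
      then show ?thesis using A_nth a b
        by (simp add: hcoeff_hterm_times le_fun_def)
    qed
    then show ?thesis
      using a w carr dist
      by (simp add: strand_nth lin_ext_def sum_set_distinct scalar_prod_def hcoeff_sum atLeast0LessThan)
  next
    case False
    then show ?thesis using D_out by (auto simp: strand_def lin_ext_def)
  qed
qed

lemma lift_strands:
  assumes v: "v \<in> carrier_vec (length xs)"
    and l: "\<And>\<gamma>. \<exists>w\<in>supp deg (set ys) \<gamma>. strand xs deg \<gamma> v = lin_ext (set ys) D w"
  shows "\<exists>w\<in>carrier_vec (length ys). v = A *\<^sub>v w"
proof -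
  \<comment> \<open>Outside this finite set all components of \<open>v\<close> vanish: a degree is
    an exponent of the entry at \<open>a\<close>, shifted by the degree of the basis element
    \<open>xs ! a\<close>.\<close>
  define \<Gamma> where "\<Gamma> = (\<Union>a<length xs. (\<lambda>t. \<lambda>i. mon_exp t i + deg (xs ! a) i) ` Poly_Mapping.keys (v $ a))"
  have fin: "finite \<Gamma>" by (simp add: \<Gamma>_def)
  have out: "strand xs deg \<gamma> v = (\<lambda>_. 0)" if "\<gamma> \<notin> \<Gamma>" for \<gamma>
  proof
    fix x
    show "strand xs deg \<gamma> v x = 0"
    proof (rule ccontr)
      assume x: "strand xs deg \<gamma> v x \<noteq> 0"
      then have "x \<in> set xs" unfolding strand_def by metis
      then obtain a where a: "a < length xs" "x = xs ! a" by (metis in_set_conv_nth)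
      have "hcoeff (\<lambda>i. \<gamma> i - deg (xs ! a) i) (v $ a) \<noteq> 0"
        using x a dist by (simp add: strand_nth)
      then have nn: "\<forall>i. 0 \<le> \<gamma> i - deg (xs ! a) i"
        and k: "exp_mon (\<lambda>i. \<gamma> i - deg (xs ! a) i) \<in> Poly_Mapping.keys (v $ a)"
        by (auto simp: hcoeff_def in_keys_iff split: if_splits)
      have "\<gamma> = (\<lambda>i. mon_exp (exp_mon (\<lambda>i. \<gamma> i - deg (xs ! a) i)) i + deg (xs ! a) i)"
        using nn by (simp add: mon_exp_exp_mon)
      then have "\<gamma> \<in> \<Gamma>" unfolding \<Gamma>_def using a k by blast
      then show False using that by blast
    qed
  qed
  obtain W where W: "\<And>\<gamma>. W \<gamma> \<in> supp deg (set ys) \<gamma>" "\<And>\<gamma>. strand xs deg \<gamma> v = lin_ext (set ys) D (W \<gamma>)"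
    using l by metis
  obtain w where w: "w \<in> carrier_vec (length ys)"
    "\<And>\<gamma>. strand ys deg \<gamma> w = (if \<gamma> \<in> \<Gamma> then W \<gamma> else (\<lambda>_. 0))"
    using glue_strands[OF dist(2) fin W(1)] by metis
  have "strand xs deg \<gamma> (A *\<^sub>v w) = strand xs deg \<gamma> v" for \<gamma>
    using W out w by (simp add: strand_mult)
  then have "A *\<^sub>v w = v"
    using carr v w by (intro strand_inj[OF dist(1), where deg = deg]) auto
  then show ?thesis using w by (intro bexI[of _ w]) auto
qed

end

locale graded_data =
  fixes I :: "('n::finite, 'k::field) mpoly set" and xs :: "nat \<Rightarrow> 'b list" and deg :: "'b \<Rightarrow> 'n mdegree"
    and d :: "nat \<Rightarrow> ('n, 'k) mpoly mat" and \<epsilon> :: "('n, 'k) mpoly vec"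
    and D :: "'b \<Rightarrow> 'b \<Rightarrow> 'k" and e :: "'b \<Rightarrow> 'k"
  assumes I_iff: "\<And>f. f \<in> I \<longleftrightarrow> (\<forall>t\<in>Poly_Mapping.keys f. mpoly_monom t \<in> I)"
    and I_add: "\<And>s t. mpoly_monom t \<in> I \<Longrightarrow> mpoly_monom (s + t) \<in> I"
    and pres: "\<And>i. graded_presentation (xs i) (xs (Suc i)) deg (d i) D"
    and eps_carr: "\<epsilon> \<in> carrier_vec (length (xs 0))"
    and eps_hom: "\<And>a. a < length (xs 0) \<Longrightarrow> homogeneous (deg (xs 0 ! a)) (\<epsilon> $ a)"
    and e_nth: "\<And>a. a < length (xs 0) \<Longrightarrow> e (xs 0 ! a) = hcoeff (deg (xs 0 ! a)) (\<epsilon> $ a)"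
begin

definition std :: "'n mdegree \<Rightarrow> bool"
  where "std \<gamma> \<longleftrightarrow> (\<forall>x. 0 \<le> \<gamma> x) \<and> mpoly_monom (exp_mon \<gamma>) \<notin> I"

lemma mem_I_iff: "f \<in> I \<longleftrightarrow> (\<forall>\<gamma>. std \<gamma> \<longrightarrow> hcoeff \<gamma> f = 0)"
proof
  assume "f \<in> I"
  then show "\<forall>\<gamma>. std \<gamma> \<longrightarrow> hcoeff \<gamma> f = 0"
    using I_iff[of f] by (auto simp: std_def hcoeff_def in_keys_iff)
next
  assume *: "\<forall>\<gamma>. std \<gamma> \<longrightarrow> hcoeff \<gamma> f = 0"
  have "mpoly_monom t \<in> I" if "t \<in> Poly_Mapping.keys f" for t
    using *[rule_format, of "mon_exp t"] that by (auto simp: std_def in_keys_iff)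
  then show "f \<in> I" using I_iff by blast
qed

lemma dist: "distinct (xs i)"
  using pres[of i] by (simp add: graded_presentation_def)

lemma d_carr: "d i \<in> carrier_mat (length (xs i)) (length (xs (Suc i)))"
  using pres[of i] by (simp add: graded_presentation_def)

lemma e_nonneg: "x \<in> set (xs 0) \<Longrightarrow> e x \<noteq> 0 \<Longrightarrow> 0 \<le> deg x i"
  using e_nth by (auto simp: in_set_conv_nth hcoeff_def split: if_splits)

lemma hcoeff_eps:
  assumes w: "w \<in> carrier_vec (length (xs 0))"
  shows "hcoeff \<gamma> (\<epsilon> \<bullet> w) = pairing (set (xs 0)) e (strand (xs 0) deg \<gamma> w)"
proof -
  have "hcoeff \<gamma> (\<epsilon> $ a * w $ a) = e (xs 0 ! a) * hcoeff (\<lambda>i. \<gamma> i - deg (xs 0 ! a) i) (w $ a)"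
    if a: "a < length (xs 0)" for a
  proof -
    have eq: "\<epsilon> $ a = hterm (deg (xs 0 ! a)) (e (xs 0 ! a))"
      using homogeneous_eq_hterm[OF eps_hom[OF a]] e_nth[OF a] by simp
    show ?thesis
    proof (cases "e (xs 0 ! a) = 0")
      case True
      then show ?thesis unfolding eq by (simp add: hterm_def)
    next
      case False
      then show ?thesis unfolding eq using e_nonneg[of "xs 0 ! a"] a by (simp add: hcoeff_hterm_times)
    qed
  qed
  then show ?thesis
    using w dist eps_carr
    by (simp add: scalar_prod_def hcoeff_sum pairing_def sum_set_distinct strand_nth atLeast0LessThan)
qed

abbreviation cyc where "cyc \<equiv> cycle std (\<lambda>i. set (xs i)) D e"

lemma eps_mem_iff:
  assumes "v \<in> carrier_vec (length (xs 0))"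
  shows "\<epsilon> \<bullet> v \<in> I \<longleftrightarrow> (\<forall>\<gamma>. cyc 0 \<gamma> (strand (xs 0) deg \<gamma> v))"
  using assms by (simp add: mem_I_iff hcoeff_eps cycle_def)

lemma kernel_iff:
  assumes v: "v \<in> carrier_vec (length (xs (Suc i)))"
  shows "v \<in> mat_kernel (d i) \<longleftrightarrow> (\<forall>\<gamma>. cyc (Suc i) \<gamma> (strand (xs (Suc i)) deg \<gamma> v))"
proof -
  interpret graded_presentation "xs i" "xs (Suc i)" deg "d i" D by (rule pres)
  have "v \<in> mat_kernel (d i) \<longleftrightarrow> d i *\<^sub>v v = 0\<^sub>v (length (xs i))"
    using v d_carr[of i] by (auto simp: mat_kernel_def)
  also have "\<dots> \<longleftrightarrow> (\<forall>\<gamma>. strand (xs i) deg \<gamma> (d i *\<^sub>v v) = strand (xs i) deg \<gamma> (0\<^sub>v (length (xs i))))"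
    using strand_inj[OF dist(1), of "d i *\<^sub>v v" "0\<^sub>v (length (xs i))" deg] mult_mat_vec_carrier[OF d_carr v] by auto
  finally show ?thesis using v dist by (simp add: strand_mult cycle_def)
qed

lemma kernel_carr: "v \<in> mat_kernel (d i) \<Longrightarrow> v \<in> carrier_vec (length (xs (Suc i)))"
  using d_carr[of i] by (auto simp: mat_kernel_def)

lemma image_iff:
  assumes v: "v \<in> carrier_vec (length (xs i))"
  shows "v \<in> (\<lambda>w. d i *\<^sub>v w) ` carrier_vec (length (xs (Suc i))) \<longleftrightarrow>
    (\<forall>\<gamma>. \<exists>w\<in>supp deg (set (xs (Suc i))) \<gamma>. strand (xs i) deg \<gamma> v = lin_ext (set (xs (Suc i))) D w)"
proof -
  interpret graded_presentation "xs i" "xs (Suc i)" deg "d i" D by (rule pres)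
  show ?thesis
    using lift_strands[OF v] strand_mult strand_supp by (fastforce simp: image_def)
qed

text \<open>All strands of \<open>unstrand\<close> in other degrees vanish, and zero is always a
  cycle.\<close>

lemma unstrand_cycle_iff:
  assumes v: "v \<in> supp deg (set (xs i)) \<gamma>"
  shows "(\<forall>\<delta>. cyc i \<delta> (strand (xs i) deg \<delta> (unstrand (xs i) deg \<gamma> v))) \<longleftrightarrow> cyc i \<gamma> v"
  using v by (auto simp: strand_unstrand dist cycle_def pairing_def split: nat.splits)

lemma unstrand_image_iff:
  assumes v: "v \<in> supp deg (set (xs i)) \<gamma>"
  shows "unstrand (xs i) deg \<gamma> v \<in> (\<lambda>w. d i *\<^sub>v w) ` carrier_vec (length (xs (Suc i))) \<longleftrightarrow>
    (\<exists>w\<in>supp deg (set (xs (Suc i))) \<gamma>. v = lin_ext (set (xs (Suc i))) D w)"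
proof -
  have z: "\<exists>w\<in>supp deg (set (xs (Suc i))) \<delta>. (\<lambda>_. 0) = lin_ext (set (xs (Suc i))) D w" for \<delta>
    by (rule bexI[of _ "\<lambda>_. 0"]) auto
  show ?thesis
    unfolding image_iff[OF unstrand_carrier] strand_unstrand[OF dist v] using z by auto
qed

text \<open>From left to right, exactness over the ring is applied to vectors concentrated in one
  degree. From right to left, a vector is lifted strand by strand and the finitely many lifts are
  glued.\<close>

lemma resolution_iff:
  "graded_free_resolution I (\<lambda>i. map deg (xs i)) d \<epsilon> \<longleftrightarrow>
   based_resolution std (\<lambda>i. set (xs i)) deg D e"
proof
  assume g: "graded_free_resolution I (\<lambda>i. map deg (xs i)) d \<epsilon>"
  show "based_resolution std (\<lambda>i. set (xs i)) deg D e"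
  proof
    show "finite (set (xs i))" for i by simp
    show "D y \<in> supp deg (set (xs i)) (deg y)" if "y \<in> set (xs (Suc i))" for y i
      using graded_presentation.D_supp[OF pres that] .
    show "std (deg x)" if "x \<in> set (xs 0)" "e x \<noteq> 0" "deg x \<le> \<gamma>" "std \<gamma>" for x \<gamma>
    proof -
      have nn: "\<forall>i. 0 \<le> deg x i" using e_nonneg that by blast
      \<comment> \<open>If the monomial of degree \<open>deg x\<close> were in \<open>I\<close>, so
        would be its multiple of degree \<gamma>.\<close>
      have "exp_mon \<gamma> = exp_mon (\<lambda>i. \<gamma> i - deg x i) + exp_mon (deg x)"
        using nn that(3) by (intro poly_mapping_eqI) (simp add: lookup_add le_fun_def flip: nat_add_distrib)
      then show ?thesis using that(4) I_add nn unfolding std_def by metis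
    qed
    show "\<exists>x\<in>set (xs 0). deg x \<le> \<gamma> \<and> e x \<noteq> 0" if "std \<gamma>" for \<gamma>
    proof (rule ccontr)
      assume n: "\<not> (\<exists>x\<in>set (xs 0). deg x \<le> \<gamma> \<and> e x \<noteq> 0)"
      \<comment> \<open>Surjectivity onto \<open>R/I\<close> is tested on the monomial of degree
        \<gamma>. Without a suitable \<open>x\<close> the coefficient of
        \<open>\<epsilon> \<bullet> v\<close> in degree \<gamma> is 0, so the difference keeps the
        coefficient 1 at a monomial outside \<open>I\<close>.\<close>
      obtain v where v: "v \<in> carrier_vec (length (xs 0))" "hterm \<gamma> 1 - \<epsilon> \<bullet> v \<in> I"
        using g unfolding graded_free_resolution_def by (metis length_map)
      have "hcoeff \<gamma> (hterm \<gamma> 1 - \<epsilon> \<bullet> v) = 0" using v(2) that mem_I_iff by blast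
      moreover have "pairing (set (xs 0)) e (strand (xs 0) deg \<gamma> v) = 0"
        unfolding pairing_def using n strand_supp[of "xs 0" deg \<gamma> v]
        by (intro sum.neutral) (auto simp: supp_def)
      ultimately show False
        using that by (simp add: hcoeff_diff hcoeff_eps[OF v(1)] hcoeff_hterm std_def)
    qed
    show "cyc i \<gamma> v \<longleftrightarrow> (\<exists>w\<in>supp deg (set (xs (Suc i))) \<gamma>. v = lin_ext (set (xs (Suc i))) D w)"
      if v: "v \<in> supp deg (set (xs i)) \<gamma>" for i \<gamma> v
    proof (cases i)
      case 0
      have "{v \<in> carrier_vec (length (xs 0)). \<epsilon> \<bullet> v \<in> I} =
          (\<lambda>w. d 0 *\<^sub>v w) ` carrier_vec (length (xs (Suc 0)))"
        using g by (simp add: graded_free_resolution_def)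
      then have "\<epsilon> \<bullet> unstrand (xs 0) deg \<gamma> v \<in> I \<longleftrightarrow>
          unstrand (xs 0) deg \<gamma> v \<in> (\<lambda>w. d 0 *\<^sub>v w) ` carrier_vec (length (xs (Suc 0)))"
        by (metis (mono_tags, lifting) mem_Collect_eq unstrand_carrier)
      then show ?thesis
        using v unfolding 0 by (simp only: eps_mem_iff[OF unstrand_carrier] unstrand_cycle_iff unstrand_image_iff)
    next
      case (Suc j)
      have "mat_kernel (d j) = (\<lambda>w. d (Suc j) *\<^sub>v w) ` carrier_vec (length (xs (Suc (Suc j))))"
        using g by (simp add: graded_free_resolution_def)
      then have "unstrand (xs (Suc j)) deg \<gamma> v \<in> mat_kernel (d j) \<longleftrightarrow>
          unstrand (xs (Suc j)) deg \<gamma> v \<in> (\<lambda>w. d (Suc j) *\<^sub>v w) ` carrier_vec (length (xs (Suc (Suc j))))"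
        by simp
      then show ?thesis
        using v unfolding Suc by (simp only: kernel_iff[OF unstrand_carrier] unstrand_cycle_iff unstrand_image_iff)
    qed
  qed
next
  assume "based_resolution std (\<lambda>i. set (xs i)) deg D e"
  then interpret R: based_resolution std "\<lambda>i. set (xs i)" deg D e .
  have cyc_image: "(\<forall>\<gamma>. cyc i \<gamma> (strand (xs i) deg \<gamma> v)) \<longleftrightarrow>
      v \<in> (\<lambda>w. d i *\<^sub>v w) ` carrier_vec (length (xs (Suc i)))"
    if "v \<in> carrier_vec (length (xs i))" for v i
    using that by (simp only: image_iff R.exact[OF strand_supp])
  show "graded_free_resolution I (\<lambda>i. map deg (xs i)) d \<epsilon>"
    unfolding graded_free_resolution_def
  proof (intro conjI allI impI)
    show "d i \<in> carrier_mat (length (map deg (xs i))) (length (map deg (xs (Suc i))))" for i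
      using d_carr by simp
    show "homogeneous (\<lambda>x. (map deg (xs (Suc i)) ! b) x - (map deg (xs i) ! a) x) (d i $$ (a, b))"
      if "a < length (map deg (xs i))" "b < length (map deg (xs (Suc i)))" for i a b
      using graded_presentation.hom[OF pres, of a i b] that by simp
    show "\<epsilon> \<in> carrier_vec (length (map deg (xs 0)))" using eps_carr by simp
    show "homogeneous (map deg (xs 0) ! a) (\<epsilon> $ a)" if "a < length (map deg (xs 0))" for a
      using eps_hom that by simp
    show "\<exists>v\<in>carrier_vec (length (map deg (xs 0))). f - \<epsilon> \<bullet> v \<in> I" for f
    proof -
      have "\<exists>u\<in>supp deg (set (xs 0)) \<gamma>. std \<gamma> \<longrightarrow> pairing (set (xs 0)) e u = hcoeff \<gamma> f" for \<gamma>
      proof (cases "std \<gamma>")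
        case True
        then obtain x where x: "x \<in> set (xs 0)" "deg x \<le> \<gamma>" "e x \<noteq> 0" using R.e_surj by blast
        have "pairing (set (xs 0)) e (\<lambda>z. (hcoeff \<gamma> f / e x) * unit_at x z) =
            (hcoeff \<gamma> f / e x) * pairing (set (xs 0)) e (unit_at x)"
          by (simp add: pairing_def sum_distrib_left sum_divide_distrib mult_ac)
        moreover have "(\<lambda>z. (hcoeff \<gamma> f / e x) * unit_at x z) \<in> supp deg (set (xs 0)) \<gamma>"
          using x by (intro supp_scale) (auto intro: supp_mono supp_unit_at)
        ultimately show ?thesis using x by (force simp: pairing_unit_at)
      qed (use supp_zero in blast)
      then obtain W where W: "\<And>\<gamma>. W \<gamma> \<in> supp deg (set (xs 0)) \<gamma>"
        "\<And>\<gamma>. std \<gamma> \<Longrightarrow> pairing (set (xs 0)) e (W \<gamma>) = hcoeff \<gamma> f" by metis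
      have "finite (mon_exp ` Poly_Mapping.keys f)" by simp
      then obtain v where v: "v \<in> carrier_vec (length (xs 0))"
        "\<And>\<gamma>. strand (xs 0) deg \<gamma> v = (if \<gamma> \<in> mon_exp ` Poly_Mapping.keys f then W \<gamma> else (\<lambda>_. 0))"
        using glue_strands[OF dist _ W(1)] by metis
      have "hcoeff \<gamma> f = 0" if "\<gamma> \<notin> mon_exp ` Poly_Mapping.keys f" for \<gamma>
      proof (rule ccontr)
        assume "hcoeff \<gamma> f \<noteq> 0"
        then have "\<forall>x. 0 \<le> \<gamma> x" "exp_mon \<gamma> \<in> Poly_Mapping.keys f"
          by (auto simp: hcoeff_def in_keys_iff split: if_splits)
        then show False using that mon_exp_exp_mon[of \<gamma>] by (metis imageI)
      qed
      then have "f - \<epsilon> \<bullet> v \<in> I"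
        using W(2) v by (auto simp: mem_I_iff hcoeff_diff hcoeff_eps pairing_def)
      then show ?thesis using v by auto
    qed
    show "{v \<in> carrier_vec (length (map deg (xs 0))). \<epsilon> \<bullet> v \<in> I} =
        (\<lambda>w. d 0 *\<^sub>v w) ` carrier_vec (length (map deg (xs 1)))"
    proof -
      have "(\<lambda>w. d 0 *\<^sub>v w) ` carrier_vec (length (xs (Suc 0))) \<subseteq> carrier_vec (length (xs 0))"
        using d_carr[of 0] by auto
      then show ?thesis using eps_mem_iff cyc_image[of _ 0] by auto
    qed
    show "mat_kernel (d i) = (\<lambda>w. d (Suc i) *\<^sub>v w) ` carrier_vec (length (map deg (xs (Suc (Suc i)))))" for i
    proof -
      have "(\<lambda>w. d (Suc i) *\<^sub>v w) ` carrier_vec (length (xs (Suc (Suc i)))) \<subseteq> carrier_vec (length (xs (Suc i)))"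
        using d_carr[of "Suc i"] by auto
      then have "v \<in> mat_kernel (d i) \<longleftrightarrow>
          v \<in> (\<lambda>w. d (Suc i) *\<^sub>v w) ` carrier_vec (length (xs (Suc (Suc i))))" for v
        using kernel_iff[of v i] kernel_carr[of v i] cyc_image[of v "Suc i"] by blast
      then show ?thesis by auto
    qed
  qed
qed

text \<open>A homogeneous entry has a nonzero constant coefficient only if its degree is zero, and
  then this coefficient is the scalar recorded by \<open>D\<close>.\<close>

lemma minimal_resolution_iff:
  assumes "based_resolution std (\<lambda>i. set (xs i)) deg D e"
  shows "minimal_graded_free_resolution I (\<lambda>i. map deg (xs i)) d \<epsilon> \<longleftrightarrow>
    based_resolution.minimal (\<lambda>i. set (xs i)) deg D"
proof -
  interpret R: based_resolution std "\<lambda>i. set (xs i)" deg D e by fact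
  have ex0: "exp_mon (\<lambda>_. 0) = (0 :: 'n mon)"
    by (rule poly_mapping_eqI) simp
  have eq: "Poly_Mapping.lookup (d i $$ (a, b)) 0 =
      (if deg (xs i ! a) = deg (xs (Suc i) ! b) then D (xs (Suc i) ! b) (xs i ! a) else 0)"
    if ab: "a < length (xs i)" "b < length (xs (Suc i))" for i a b
  proof -
    have "Poly_Mapping.lookup (d i $$ (a, b)) 0 = hcoeff (\<lambda>_. 0) (d i $$ (a, b))"
      by (simp add: hcoeff_def ex0)
    then show ?thesis
      unfolding graded_presentation.A_nth[OF pres ab] by (auto simp: hcoeff_hterm fun_eq_iff)
  qed
  show ?thesis
    using resolution_iff assms
    by (auto simp: minimal_graded_free_resolution_def R.minimal_def eq all_set_conv_all_nth)
qed

end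

subsection \<open>Gaussian elimination\<close>

lemma supp_sub: "v \<in> supp deg X \<gamma> \<Longrightarrow> X \<subseteq> Y \<Longrightarrow> v \<in> supp deg Y \<gamma>"
  by (auto simp: supp_def)

text \<open>Gaussian elimination of the pair \<open>s\<close>, \<open>t\<close>: the quotient by the subcomplex spanned by \<open>t\<close> and its
  boundary is a retract of the original complex, which transfers exactness.\<close>

definition eliminate :: "'b \<Rightarrow> 'b \<Rightarrow> ('b \<Rightarrow> 'b \<Rightarrow> 'k::field) \<Rightarrow> 'b \<Rightarrow> 'b \<Rightarrow> 'k"
  where "eliminate s t D = (\<lambda>y x. if x = s \<or> x = t then 0 else D y x - D t x * D y s / D t s)"

lemma eliminate_based_resolution:
  fixes D :: "'b \<Rightarrow> 'b \<Rightarrow> 'k::field"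
  assumes R: "based_resolution M B deg D e"
    and s: "s \<in> B l" and t: "t \<in> B (Suc l)" and eq: "deg s = deg t" and nz: "D t s \<noteq> 0"
    and disj: "\<And>i j. i \<noteq> j \<Longrightarrow> B i \<inter> B j = {}"
  shows "based_resolution M (\<lambda>i. B i - {s, t}) deg (eliminate s t D) e"
proof -
  interpret R: based_resolution M B deg D e by fact
  define C where "C i = B i - {s, t}" for i
  define E where "E = eliminate s t D"
  have s_iff: "s \<in> B i \<longleftrightarrow> i = l" for i using s disj by blast
  have t_iff: "t \<in> B i \<longleftrightarrow> i = Suc l" for i using t disj by blast
  have st: "s \<noteq> t" using s_iff t_iff s t by force
  have CB: "C i \<subseteq> B i" for i by (auto simp: C_def)
  have Cfin: "finite (C i)" for i using R.fin[of i] by (simp add: C_def)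
  have Dt: "D t \<in> supp deg (B l) (deg t)" using R.D_supp[OF t] .
  have Dtt: "D t t = 0" using Dt t_iff by (auto simp: supp_def)
  \<comment> \<open>The projection to the quotient: the multiple of \<open>D t\<close> that clears
    the coefficient at \<open>s\<close> is subtracted, and \<open>t\<close> is dropped.\<close>
  define \<pi> where "\<pi> v = (\<lambda>x. if x = s \<or> x = t then 0 else v x - D t x * v s / D t s)" for v
  \<comment> \<open>The inclusion of the retract: in the homological degree of \<open>t\<close>, the
    multiple of \<open>t\<close> is added that makes the coefficient of the boundary at
    \<open>s\<close> vanish. Elsewhere nothing has to be corrected.\<close>
  define \<iota> where "\<iota> i v = (if i = Suc l then (\<lambda>x. if x = t then - (\<Sum>y\<in>C i. D y s * v y) / D t s else v x) else v)"
    for i v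
  have E_supp: "E y \<in> supp deg (C i) (deg y)" if y: "y \<in> B (Suc i)" for y i
  proof -
    have "x \<in> C i \<and> deg x \<le> deg y" if "E y x \<noteq> 0" for x
    proof -
      have xst: "x \<noteq> s" "x \<noteq> t" using that by (auto simp: E_def eliminate_def split: if_splits)
      have "D y x \<noteq> 0 \<or> (D t x \<noteq> 0 \<and> D y s \<noteq> 0)"
        using that xst by (auto simp: E_def eliminate_def)
      then have "x \<in> B i \<and> deg x \<le> deg y"
      proof
        assume "D y x \<noteq> 0"
        then show ?thesis using R.D_supp[OF y] by (auto simp: supp_def)
      next
        assume a: "D t x \<noteq> 0 \<and> D y s \<noteq> 0"
        then have "s \<in> B i" "deg s \<le> deg y" using R.D_supp[OF y] by (auto simp: supp_def)
        moreover have "x \<in> B l" "deg x \<le> deg t" using Dt a by (auto simp: supp_def)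
        ultimately show ?thesis using s_iff eq by (auto intro: order_trans)
      qed
      then show ?thesis using xst by (simp add: C_def)
    qed
    then show ?thesis by (simp add: supp_def)
  qed
  have \<pi>_supp: "\<pi> v \<in> supp deg (C i) \<gamma>" if v: "v \<in> supp deg (B i) \<gamma>" for v i \<gamma>
  proof -
    have "x \<in> C i \<and> deg x \<le> \<gamma>" if "\<pi> v x \<noteq> 0" for x
    proof -
      have xst: "x \<noteq> s" "x \<noteq> t" using that by (auto simp: \<pi>_def split: if_splits)
      have "v x \<noteq> 0 \<or> (D t x \<noteq> 0 \<and> v s \<noteq> 0)"
        using that xst by (auto simp: \<pi>_def)
      then have "x \<in> B i \<and> deg x \<le> \<gamma>"
      proof
        assume "v x \<noteq> 0"
        then show ?thesis using v by (auto simp: supp_def)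
      next
        assume a: "D t x \<noteq> 0 \<and> v s \<noteq> 0"
        then have "s \<in> B i" "deg s \<le> \<gamma>" using v by (auto simp: supp_def)
        moreover have "x \<in> B l" "deg x \<le> deg t" using Dt a by (auto simp: supp_def)
        ultimately show ?thesis using s_iff eq by (auto intro: order_trans)
      qed
      then show ?thesis using xst by (simp add: C_def)
    qed
    then show ?thesis by (simp add: supp_def)
  qed
  have \<iota>_supp: "\<iota> i v \<in> supp deg (B i) \<gamma>" if v: "v \<in> supp deg (C i) \<gamma>" for v i \<gamma>
  proof -
    have "deg t \<le> \<gamma>" if nz: "(\<Sum>y\<in>C (Suc l). D y s * v y) \<noteq> 0" and "i = Suc l"
    proof -
      obtain y where y: "y \<in> C (Suc l)" "D y s * v y \<noteq> 0"
        using nz by (metis (mono_tags, lifting) sum.neutral)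
      then have "deg s \<le> deg y" using R.D_supp[of y l] CB by (auto simp: supp_def)
      moreover have "deg y \<le> \<gamma>" using y v by (auto simp: supp_def)
      ultimately show ?thesis using eq by auto
    qed
    then show ?thesis
      using v CB t by (auto simp: supp_def \<iota>_def split: if_splits)
  qed
  have C_off: "C i = B i" if "i \<noteq> l" "i \<noteq> Suc l" for i
    using that s_iff t_iff by (auto simp: C_def)
  have Ct: "B (Suc l) = insert t (C (Suc l))" "t \<notin> C (Suc l)"
    using t s_iff[of "Suc l"] by (auto simp: C_def)
  have Cs: "B l = insert s (C l)" "s \<notin> C l"
    using s t_iff[of l] by (auto simp: C_def)
  have sum_Bt: "(\<Sum>y\<in>B (Suc l). f y) = f t + (\<Sum>y\<in>C (Suc l). f y)" for f :: "'b \<Rightarrow> 'k"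
    unfolding Ct(1) using Ct(2) Cfin by simp
  have sum_Bs: "(\<Sum>y\<in>B l. f y) = f s + (\<Sum>y\<in>C l. f y)" for f :: "'b \<Rightarrow> 'k"
    unfolding Cs(1) using Cs(2) Cfin by simp
  have E_eq: "E y x = D y x" if "y \<in> B (Suc i)" "i \<noteq> l" "x \<noteq> s" "x \<noteq> t" for y x i
  proof -
    have "D y s = 0" using R.D_supp[OF that(1)] that(2) s_iff by (auto simp: supp_def)
    then show ?thesis using that by (simp add: E_def eliminate_def)
  qed
  have D\<iota>: "lin_ext (B (Suc i)) D (\<iota> (Suc i) v) = \<iota> i (lin_ext (C (Suc i)) E v)"
    if v: "v \<in> supp deg (C (Suc i)) \<gamma>" for v i \<gamma>
  proof (cases "i = l")
    case True
    define S where "S = (\<Sum>y\<in>C (Suc l). D y s * v y)"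
    have "lin_ext (B (Suc l)) D (\<iota> (Suc l) v) x = (\<Sum>y\<in>C (Suc l). D y x * v y) - D t x * S / D t s" for x
    proof -
      have "(\<Sum>y\<in>C (Suc l). D y x * \<iota> (Suc l) v y) = (\<Sum>y\<in>C (Suc l). D y x * v y)"
        using Ct by (intro sum.cong refl) (auto simp: \<iota>_def)
      then show ?thesis
        by (simp add: lin_ext_def sum_Bt) (simp add: \<iota>_def S_def)
    qed
    moreover have "\<iota> l (lin_ext (C (Suc l)) E v) x =
        (if x = s \<or> x = t then 0 else (\<Sum>y\<in>C (Suc l). D y x * v y) - D t x * S / D t s)" for x
      by (simp add: \<iota>_def lin_ext_def E_def eliminate_def S_def algebra_simps sum_subtractf
          sum_distrib_left sum_divide_distrib)
    moreover have "(\<Sum>y\<in>C (Suc l). D y t * v y) = 0"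
    proof (intro sum.neutral ballI)
      fix y assume "y \<in> C (Suc l)"
      then have "D y t = 0" using R.D_supp[of y l] CB t_iff by (fastforce simp: supp_def)
      then show "D y t * v y = 0" by simp
    qed
    ultimately show ?thesis using nz Dtt True by (auto simp: S_def)
  next
    case False
    have \<iota>v: "\<iota> (Suc i) v = v" using False by (simp add: \<iota>_def)
    show ?thesis
    proof (cases "i = Suc l")
      case True
      have C2: "C (Suc i) = B (Suc i)" using True by (intro C_off) auto
      have E2: "E y x = D y x" if "y \<in> B (Suc i)" "x \<noteq> t" for y x
      proof (cases "x = s")
        case True
        have "D y s = 0" using R.D_supp[OF that(1)] \<open>i = Suc l\<close> s_iff by (auto simp: supp_def)
        then show ?thesis using True by (simp add: E_def eliminate_def)
      next
        case False
        then show ?thesis using E_eq[OF that(1), of x] that \<open>i = Suc l\<close> by simp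
      qed
      \<comment> \<open>Read off at \<open>s\<close>, the vanishing double boundary determines the
        coefficient of the boundary of \<open>v\<close> at \<open>t\<close> from the other ones. It
        is precisely the coefficient that \<open>\<iota>\<close> inserts.\<close>
      have bb: "lin_ext (B (Suc l)) D (lin_ext (B (Suc i)) D v) s = 0"
        using R.cycle_boundary[OF supp_sub[OF v CB]] by (simp add: cycle_def True)
      have ex: "lin_ext (C (Suc i)) E v x = lin_ext (B (Suc i)) D v x" if "x \<noteq> t" for x
        unfolding C2 lin_ext_def using E2 that by (intro sum.cong) auto
      have "D t s * lin_ext (B (Suc i)) D v t + (\<Sum>y\<in>C (Suc l). D y s * lin_ext (B (Suc i)) D v y) = 0"
        using bb unfolding lin_ext_def[of "B (Suc l)"] sum_Bt .
      then have "lin_ext (B (Suc i)) D v t = - (\<Sum>y\<in>C (Suc l). D y s * lin_ext (B (Suc i)) D v y) / D t s"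
        using nz by (simp add: field_simps add_eq_0_iff)
      also have "(\<Sum>y\<in>C (Suc l). D y s * lin_ext (B (Suc i)) D v y) = (\<Sum>y\<in>C (Suc l). D y s * lin_ext (C (Suc i)) E v y)"
        by (intro sum.cong refl) (metis ex Ct(2))
      finally show ?thesis
        using ex unfolding \<iota>v by (simp add: \<iota>_def True fun_eq_iff)
    next
      case F2: False
      have "lin_ext (C (Suc i)) E v x = lin_ext (B (Suc i)) D v x" for x
      proof -
        have "E y x * v y = D y x * v y" if "y \<in> C (Suc i)" for y
        proof (cases "x = s \<or> x = t")
          case True
          then have "D y x = 0" using R.D_supp[of y i] that CB False F2 s_iff t_iff
            by (fastforce simp: supp_def)
          then show ?thesis using True by (auto simp: E_def eliminate_def)
        next
          case False
          then show ?thesis using E_eq[of y i x] that CB \<open>i \<noteq> l\<close> by auto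
        qed
        moreover have "(\<Sum>y\<in>B (Suc i). D y x * v y) = (\<Sum>y\<in>C (Suc i). D y x * v y)"
          using v CB R.fin by (intro sum.mono_neutral_right) (auto simp: supp_def)
        ultimately show ?thesis unfolding lin_ext_def by (metis (no_types, lifting) sum.cong)
      qed
      then show ?thesis using F2 unfolding \<iota>v by (simp add: \<iota>_def fun_eq_iff)
    qed
  qed
  have D\<pi>: "lin_ext (C (Suc i)) E (\<pi> w) = \<pi> (lin_ext (B (Suc i)) D w)" if w: "w \<in> supp deg (B (Suc i)) \<gamma>" for w i \<gamma>
  proof (cases "i = l")
    case True
    have ws: "w s = 0" using w True s_iff by (auto simp: supp_def)
    have pw: "\<pi> w y = w y" if "y \<in> C (Suc l)" for y
      using that ws by (auto simp: \<pi>_def C_def)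
    show ?thesis
    proof
      fix x
      show "lin_ext (C (Suc i)) E (\<pi> w) x = \<pi> (lin_ext (B (Suc i)) D w) x"
      proof (cases "x = s \<or> x = t")
        case True
        then show ?thesis by (auto simp: lin_ext_def E_def eliminate_def \<pi>_def)
      next
        case False
        have "lin_ext (C (Suc l)) E (\<pi> w) x =
            (\<Sum>y\<in>C (Suc l). D y x * w y) - D t x * (\<Sum>y\<in>C (Suc l). D y s * w y) / D t s"
          using False pw by (simp add: lin_ext_def E_def eliminate_def algebra_simps sum_subtractf
              sum_distrib_left sum_divide_distrib)
        moreover have "\<pi> (lin_ext (B (Suc l)) D w) x = D t x * w t + (\<Sum>y\<in>C (Suc l). D y x * w y) -
            D t x * (D t s * w t + (\<Sum>y\<in>C (Suc l). D y s * w y)) / D t s"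
          using False by (simp add: lin_ext_def sum_Bt \<pi>_def)
        ultimately show ?thesis using nz \<open>i = l\<close> by (simp add: distrib_left add_divide_distrib)
      qed
    qed
  next
    case False
    have bs: "lin_ext (B (Suc i)) D w s = 0"
    proof -
      have "lin_ext (B (Suc i)) D w \<in> supp deg (B i) \<gamma>" using lin_ext_supp[OF R.D_supp w] .
      then show ?thesis using False s_iff by (auto simp: supp_def)
    qed
    show ?thesis
    proof
      fix x
      show "lin_ext (C (Suc i)) E (\<pi> w) x = \<pi> (lin_ext (B (Suc i)) D w) x"
      proof (cases "x = s \<or> x = t")
        case True
        then show ?thesis by (auto simp: lin_ext_def E_def eliminate_def \<pi>_def)
      next
        case xst: False
        have "lin_ext (C (Suc i)) E (\<pi> w) x = (\<Sum>y\<in>C (Suc i). D y x * \<pi> w y)"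
          unfolding lin_ext_def using E_eq[of _ i x] CB False xst by (intro sum.cong) auto
        also have "\<dots> = (\<Sum>y\<in>B (Suc i). D y x * w y)"
        proof (cases "Suc i = l")
          case True
          have "(\<Sum>y\<in>C l. D y x * \<pi> w y) =
              (\<Sum>y\<in>C l. D y x * w y) - (\<Sum>y\<in>C l. D y x * D t y) * w s / D t s"
          proof -
            have "D y x * \<pi> w y = D y x * w y - D y x * D t y * w s / D t s" if "y \<in> C l" for y
              using that by (auto simp: C_def \<pi>_def algebra_simps)
            then show ?thesis by (simp add: sum_subtractf sum_distrib_right sum_divide_distrib)
          qed
          \<comment> \<open>Here \<open>\<pi>\<close> subtracts a multiple of \<open>D t\<close>,
            whose boundary is zero; the only term missing from the sum is the one at
            \<open>s\<close>.\<close>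
          moreover have "(\<Sum>y\<in>C l. D y x * D t y) = - (D s x * D t s)"
          proof -
            have "lin_ext (B (Suc i)) D (D t) x = 0" using R.DD[of t i] t True by simp
            then have "D s x * D t s + (\<Sum>y\<in>C l. D y x * D t y) = 0"
              unfolding True lin_ext_def sum_Bs .
            then show ?thesis by (simp add: add_eq_0_iff)
          qed
          ultimately have "(\<Sum>y\<in>C l. D y x * \<pi> w y) = (\<Sum>y\<in>C l. D y x * w y) + D s x * w s"
            using nz by simp
          also have "\<dots> = (\<Sum>y\<in>B l. D y x * w y)"
            by (simp add: sum_Bs)
          finally show ?thesis using True by simp
        next
          case F2: False
          have "w s = 0" using w F2 s_iff[of "Suc i"] by (auto simp: supp_def)
          moreover have "C (Suc i) = B (Suc i)" using False F2 by (intro C_off) auto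
          moreover have "t \<notin> B (Suc i)" "s \<notin> B (Suc i)" using False F2 s_iff t_iff by auto
          ultimately show ?thesis by (intro sum.cong) (auto simp: \<pi>_def)
        qed
        finally show ?thesis using xst bs by (simp add: \<pi>_def lin_ext_def)
      qed
    qed
  qed
  have \<pi>\<iota>: "\<pi> (\<iota> i v) = v" if v: "v \<in> supp deg (C i) \<gamma>" for v i \<gamma>
  proof -
    have "v s = 0" "v t = 0" using v by (auto simp: supp_def C_def)
    then show ?thesis using st by (auto simp: \<pi>_def \<iota>_def fun_eq_iff)
  qed
  have aug_\<iota>: "pairing (B 0) e (\<iota> 0 v) = pairing (C 0) e v" if v: "v \<in> supp deg (C 0) \<gamma>" for v \<gamma>
    unfolding pairing_def \<iota>_def using v CB R.fin
    by simp (intro sum.mono_neutral_right, auto simp: supp_def)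
  have cyc: "cycle M C E e i \<gamma> v \<longleftrightarrow> cycle M B D e i \<gamma> (\<iota> i v)" if v: "v \<in> supp deg (C i) \<gamma>" for v i \<gamma>
  proof (cases i)
    case 0
    then show ?thesis using aug_\<iota> v by (auto simp: cycle_def)
  next
    case (Suc j)
    have Ev: "lin_ext (C (Suc j)) E v \<in> supp deg (C j) \<gamma>"
      by (rule lin_ext_supp[OF _ v[unfolded Suc]]) (use E_supp CB in blast)
    have "\<iota> j (lin_ext (C (Suc j)) E v) = (\<lambda>_. 0) \<longleftrightarrow> lin_ext (C (Suc j)) E v = (\<lambda>_. 0)"
    proof
      assume "\<iota> j (lin_ext (C (Suc j)) E v) = (\<lambda>_. 0)"
      then have "\<pi> (\<iota> j (lin_ext (C (Suc j)) E v)) = (\<lambda>_. 0)" by (simp add: \<pi>_def fun_eq_iff)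
      then show "lin_ext (C (Suc j)) E v = (\<lambda>_. 0)" using \<pi>\<iota>[OF Ev] by simp
    qed (auto simp: \<iota>_def)
    then show ?thesis using D\<iota>[OF v[unfolded Suc]] Suc by (simp add: cycle_def)
  qed
  have "based_resolution M C deg E e"
  proof
    show "finite (C i)" for i by (rule Cfin)
    show "E y \<in> supp deg (C i) (deg y)" if "y \<in> C (Suc i)" for y i
      using E_supp that CB by blast
    show "M (deg x)" if "x \<in> C 0" "e x \<noteq> 0" "deg x \<le> \<gamma>" "M \<gamma>" for x \<gamma>
      using R.e_deg[OF _ that(2-4)] that(1) CB by blast
    show "\<exists>x\<in>C 0. deg x \<le> \<gamma> \<and> e x \<noteq> 0" if std: "M \<gamma>" for \<gamma>
    proof -
      obtain x where x: "x \<in> B 0" "deg x \<le> \<gamma>" "e x \<noteq> 0" using R.e_surj[OF std] by blast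
      show ?thesis
      proof (cases "x = s")
        case True
        have l: "l = 0" using x True s_iff by auto
        have "M (deg t)" using R.e_deg[OF x(1,3,2) std] True eq by simp
        \<comment> \<open>The removed \<open>s\<close> is replaced by another term \<open>y\<close>
          of \<open>D t\<close>: the augmentation kills \<open>D t\<close>, so the contribution of
          \<open>s\<close> has to be balanced, and \<open>deg y \<le> deg t = deg s\<close>.\<close>
        then have "pairing (B 0) e (D t) = 0" using R.eD t l by simp
        then have "e s * D t s + (\<Sum>y\<in>C 0. e y * D t y) = 0"
          using sum_Bs l by (simp add: pairing_def)
        then have "(\<Sum>y\<in>C 0. e y * D t y) \<noteq> 0" using nz x True by (auto simp: add_eq_0_iff)
        then obtain y where y: "y \<in> C 0" "e y * D t y \<noteq> 0"
          by (metis (mono_tags, lifting) sum.neutral)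
        then have "deg y \<le> deg t" using Dt by (auto simp: supp_def)
        then show ?thesis using y x True eq by (auto intro!: bexI[of _ y])
      next
        case False
        then show ?thesis using x t_iff by (auto simp: C_def)
      qed
    qed
    show "cycle M C E e i \<gamma> v \<longleftrightarrow> (\<exists>w\<in>supp deg (C (Suc i)) \<gamma>. v = lin_ext (C (Suc i)) E w)"
      if v: "v \<in> supp deg (C i) \<gamma>" for v i \<gamma>
      unfolding cyc[OF v] R.exact[OF \<iota>_supp[OF v]]
    proof
      assume "\<exists>w\<in>supp deg (B (Suc i)) \<gamma>. \<iota> i v = lin_ext (B (Suc i)) D w"
      then obtain w where w: "w \<in> supp deg (B (Suc i)) \<gamma>" "\<iota> i v = lin_ext (B (Suc i)) D w" by blast
      have "v = \<pi> (\<iota> i v)" using \<pi>\<iota>[OF v] by simp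
      also have "\<dots> = lin_ext (C (Suc i)) E (\<pi> w)" using D\<pi>[OF w(1)] w(2) by simp
      finally show "\<exists>w\<in>supp deg (C (Suc i)) \<gamma>. v = lin_ext (C (Suc i)) E w"
        using \<pi>_supp[OF w(1)] by blast
    next
      assume "\<exists>w\<in>supp deg (C (Suc i)) \<gamma>. v = lin_ext (C (Suc i)) E w"
      then obtain w where w: "w \<in> supp deg (C (Suc i)) \<gamma>" "v = lin_ext (C (Suc i)) E w" by blast
      then show "\<exists>w\<in>supp deg (B (Suc i)) \<gamma>. \<iota> i v = lin_ext (B (Suc i)) D w"
        using D\<iota>[OF w(1)] \<iota>_supp[OF w(1)] by metis
    qed
  qed
  then show ?thesis by (simp add: C_def[abs_def] E_def)
qed

subsection \<open>The Taylor complex\<close>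

definition sgn_at :: "nat \<Rightarrow> nat set \<Rightarrow> 'k::field"
  where "sgn_at j x = (-1) ^ card {k \<in> x. k < j}"

definition taylor :: "nat set \<Rightarrow> nat set \<Rightarrow> 'k::field"
  where "taylor y x = (if x \<subseteq> y \<and> card (y - x) = 1 then sgn_at (the_elem (y - x)) x else 0)"

definition faces :: "nat \<Rightarrow> nat \<Rightarrow> nat set set"
  where "faces q i = {\<sigma> \<in> Pow {..<q}. card \<sigma> = i}"

lemma sgn_at_square [simp]: "sgn_at j x * sgn_at j x = (1 :: 'k::field)"
  by (simp add: sgn_at_def flip: power_add mult_2)

lemma sgn_at_square_left [simp]: "sgn_at j x * (sgn_at j x * a) = (a :: 'k::field)"
  by (simp flip: mult.assoc)

lemma sgn_at_swap:
  assumes "j \<noteq> k" "j \<notin> x" "k \<notin> x" "finite x"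
  shows "sgn_at j x * sgn_at k (insert j x) = - (sgn_at k x * sgn_at j (insert k x) :: 'k::field)"
proof -
  have *: "sgn_at j x * sgn_at k (insert j x) = - (sgn_at k x * sgn_at j (insert k x) :: 'k)"
    if "j < k" "j \<notin> x" for j k
  proof -
    have "{l \<in> insert j x. l < k} = insert j {l \<in> x. l < k}" "{l \<in> insert k x. l < j} = {l \<in> x. l < j}"
      using that by auto
    then show ?thesis using that assms(4) by (simp add: sgn_at_def)
  qed
  show ?thesis
  proof (cases "j < k")
    case False
    then have "k < j" using assms by simp
    then show ?thesis using *[of k j] assms by simp
  qed (use * assms in blast)
qed

lemma taylor_insert: "j \<notin> x \<Longrightarrow> taylor (insert j x) x = sgn_at j x"
proof -
  assume "j \<notin> x"
  then have "insert j x - x = {j}" by auto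
  then show ?thesis by (simp add: taylor_def subset_insertI)
qed

lemma taylor_nonzeroD: "taylor y x \<noteq> 0 \<Longrightarrow> \<exists>j. j \<notin> x \<and> y = insert j x"
  by (auto simp: taylor_def card_1_singleton_iff split: if_splits)

lemma finite_faces [simp]: "finite (faces q i)"
  by (simp add: faces_def)

lemma finite_face: "x \<in> faces q i \<Longrightarrow> finite x"
  by (auto simp: faces_def intro: finite_subset)

lemma insert_faceD:
  assumes "insert j x \<in> faces q (Suc i)" "j \<notin> x"
  shows "x \<in> faces q i" "j < q"
  using assms finite_face[OF assms(1)] by (simp_all add: faces_def)

lemma ext_taylor:
  fixes v :: "nat set \<Rightarrow> 'k::field"
  assumes x: "x \<in> faces q i"
  shows "lin_ext (faces q (Suc i)) taylor v x = (\<Sum>j\<in>{..<q} - x. sgn_at j x * v (insert j x))"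
proof -
  have fx: "finite x" "x \<subseteq> {..<q}" "card x = i" using x by (auto simp: faces_def intro: finite_subset)
  have "lin_ext (faces q (Suc i)) taylor v x = (\<Sum>y\<in>(\<lambda>j. insert j x) ` ({..<q} - x). taylor y x * v y)"
    unfolding lin_ext_def
  proof (rule sum.mono_neutral_right)
    show "(\<lambda>j. insert j x) ` ({..<q} - x) \<subseteq> faces q (Suc i)"
      using fx by (auto simp: faces_def)
    show "\<forall>y\<in>faces q (Suc i) - (\<lambda>j. insert j x) ` ({..<q} - x). taylor y x * v y = 0"
    proof
      fix y assume y: "y \<in> faces q (Suc i) - (\<lambda>j. insert j x) ` ({..<q} - x)"
      have "taylor y x = (0 :: 'k)"
      proof (rule ccontr)
        assume "taylor y x \<noteq> (0 :: 'k)"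
        then obtain j where "j \<notin> x" "y = insert j x" using taylor_nonzeroD by metis
        then show False using y by (auto simp: faces_def)
      qed
      then show "taylor y x * v y = 0" by simp
    qed
  qed simp
  also have "\<dots> = (\<Sum>j\<in>{..<q} - x. sgn_at j x * v (insert j x))"
    by (subst sum.reindex) (auto simp: inj_on_def taylor_insert)
  finally show ?thesis .
qed

text \<open>Swapping the two indices would only show that twice the sum is zero, which says nothing
  in characteristic 2. The induction pairs off the terms instead.\<close>

lemma sum_antisym:
  fixes f :: "'a \<Rightarrow> 'a \<Rightarrow> 'k::ab_group_add"
  assumes "finite A" "\<And>j k. j \<in> A \<Longrightarrow> k \<in> A \<Longrightarrow> j \<noteq> k \<Longrightarrow> f j k = - f k j"
  shows "(\<Sum>j\<in>A. \<Sum>k\<in>A - {j}. f j k) = 0"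
  using assms
proof (induction A rule: finite_induct)
  case (insert a A)
  have "(\<Sum>k\<in>insert a A - {j}. f j k) = f j a + (\<Sum>k\<in>A - {j}. f j k)" if "j \<in> A" for j
  proof -
    have "insert a A - {j} = insert a (A - {j})" using that insert.hyps by auto
    then show ?thesis using insert.hyps by simp
  qed
  then have "(\<Sum>j\<in>insert a A. \<Sum>k\<in>insert a A - {j}. f j k) =
      (\<Sum>k\<in>A. f a k) + ((\<Sum>j\<in>A. f j a) + (\<Sum>j\<in>A. \<Sum>k\<in>A - {j}. f j k))"
    using insert.hyps by (simp add: sum.distrib)
  also have "(\<Sum>k\<in>A. f a k) = - (\<Sum>j\<in>A. f j a)"
    unfolding sum_negf[symmetric]
  proof (intro sum.cong refl)
    fix k assume "k \<in> A"
    then show "f a k = - f k a" using insert.hyps by (intro insert.prems) auto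
  qed
  also have "(\<Sum>j\<in>A. \<Sum>k\<in>A - {j}. f j k) = 0"
    by (rule insert.IH) (blast intro: insert.prems)
  finally show ?case by simp
qed simp

lemma taylor_square:
  "lin_ext (faces q (Suc i)) taylor (lin_ext (faces q (Suc (Suc i))) taylor w) = (\<lambda>_. 0 :: 'k::field)"
proof
  fix x
  show "lin_ext (faces q (Suc i)) taylor (lin_ext (faces q (Suc (Suc i))) taylor w) x = 0"
  proof (cases "x \<in> faces q i")
    case True
    have fx: "finite x" "x \<subseteq> {..<q}" "card x = i"
      using True by (auto simp: faces_def intro: finite_subset)
    have "lin_ext (faces q (Suc i)) taylor (lin_ext (faces q (Suc (Suc i))) taylor w) x =
        (\<Sum>j\<in>{..<q} - x. \<Sum>k\<in>({..<q} - x) - {j}. sgn_at j x * sgn_at k (insert j x) * w (insert k (insert j x)))"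
      unfolding ext_taylor[OF True]
    proof (intro sum.cong refl)
      fix j assume "j \<in> {..<q} - x"
      then have "insert j x \<in> faces q (Suc i)" "{..<q} - insert j x = {..<q} - x - {j}"
        using fx by (auto simp: faces_def)
      then show "sgn_at j x * lin_ext (faces q (Suc (Suc i))) taylor w (insert j x) =
          (\<Sum>k\<in>({..<q} - x) - {j}. sgn_at j x * sgn_at k (insert j x) * w (insert k (insert j x)))"
        by (simp add: ext_taylor sum_distrib_left mult.assoc)
    qed
    also have "\<dots> = 0"
    proof (rule sum_antisym)
      show "finite ({..<q} - x)" by simp
      fix j k assume "j \<in> {..<q} - x" "k \<in> {..<q} - x" "j \<noteq> k"
      then have "sgn_at j x * sgn_at k (insert j x) = - (sgn_at k x * sgn_at j (insert k x) :: 'k)"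
        using fx by (intro sgn_at_swap) auto
      then show "sgn_at j x * sgn_at k (insert j x) * w (insert k (insert j x)) =
          - (sgn_at k x * sgn_at j (insert k x) * w (insert j (insert k x)))"
        by (simp only: insert_commute[of k j] mult_minus_left)
    qed
    finally show ?thesis .
  next
    case False
    have "taylor y x = (0 :: 'k)" if "y \<in> faces q (Suc i)" for y
    proof (rule ccontr)
      assume "taylor y x \<noteq> (0 :: 'k)"
      then obtain j where j: "j \<notin> x" "y = insert j x" using taylor_nonzeroD by metis
      then show False using insert_faceD(1)[of j x q i] that False by simp
    qed
    then show ?thesis by (simp add: lin_ext_def[of "faces q (Suc i)"])
  qed
qed

lemma mdeg_le_iff: "finite \<sigma> \<Longrightarrow> mdeg ms \<sigma> \<le> \<gamma> \<longleftrightarrow> (\<forall>x. 0 \<le> \<gamma> x) \<and> (\<forall>i\<in>\<sigma>. mon_exp (ms ! i) \<le> \<gamma>)"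
proof -
  assume "finite \<sigma>"
  then have "mdeg ms \<sigma> x \<le> \<gamma> x \<longleftrightarrow> 0 \<le> \<gamma> x \<and> (\<forall>i\<in>\<sigma>. mon_exp (ms ! i) x \<le> \<gamma> x)" for x
    unfolding mdeg_def mon_exp_def by (subst Max_le_iff) simp_all
  then show ?thesis unfolding le_fun_def by blast
qed

lemma mdeg_nonneg: "finite \<sigma> \<Longrightarrow> 0 \<le> mdeg ms \<sigma> x"
  by (simp add: mdeg_def)

lemma mdeg_mono: "finite \<tau> \<Longrightarrow> \<sigma> \<subseteq> \<tau> \<Longrightarrow> mdeg ms \<sigma> \<le> mdeg ms \<tau>"
  unfolding mdeg_def le_fun_def by (intro allI Max_mono) auto

text \<open>The faces of degree at most \<gamma> form the full simplex on the generators dividing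
  the monomial of degree \<gamma>. Such a generator \<open>p\<close> makes it contractible, with
  \<open>p\<close> as the apex of a cone. If there is none, only the empty face remains, matching
  \<open>R/I\<close> in degree \<gamma>; if \<gamma> has a negative entry, no face remains.\<close>

lemma taylor_based_resolution:
  fixes std :: "'n::finite mdegree \<Rightarrow> bool"
  assumes std: "\<And>\<gamma>. std \<gamma> \<longleftrightarrow> (\<forall>x. 0 \<le> \<gamma> x) \<and> \<not> (\<exists>i<length ms. mon_exp (ms ! i) \<le> \<gamma>)"
  shows "based_resolution std (faces (length ms)) (mdeg ms) taylor (\<lambda>x. if x = {} then 1 else 0 :: 'k::field)"
proof
  define q where "q = length ms"
  have fin: "finite x" if "x \<in> faces q i" for x i
    using finite_face[OF that] .
  have f0: "faces q 0 = {{}}"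
    using finite_subset[of _ "{..<q}"] by (auto simp: faces_def)
  have e0: "mdeg ms {} = (\<lambda>_. 0)" by (simp add: mdeg_def)
  have T_supp: "(taylor y :: nat set \<Rightarrow> 'k) \<in> supp (mdeg ms) (faces q i) (mdeg ms y)" if y: "y \<in> faces q (Suc i)" for y i
  proof -
    have "x \<in> faces q i \<and> mdeg ms x \<le> mdeg ms y" if nz: "taylor y x \<noteq> (0 :: 'k)" for x
    proof -
      obtain j where j: "j \<notin> x" "y = insert j x" using taylor_nonzeroD[OF nz] by blast
      have "mdeg ms x \<le> mdeg ms y" using j fin[OF y] by (intro mdeg_mono) auto
      then show ?thesis using insert_faceD(1)[of j x q i] y j by simp
    qed
    then show ?thesis by (simp add: supp_def)
  qed
  show "finite (faces (length ms) i)" for i by simp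
  show "(taylor y :: nat set \<Rightarrow> 'k) \<in> supp (mdeg ms) (faces (length ms) i) (mdeg ms y)" if "y \<in> faces (length ms) (Suc i)" for y i
    using T_supp that by (simp add: q_def)
  show "std (mdeg ms x)" if "x \<in> faces (length ms) 0" "mdeg ms x \<le> \<gamma>" "std \<gamma>" for x \<gamma>
  proof -
    have x: "x = {}" using that(1) f0 by (simp add: q_def)
    have "\<not> mon_exp (ms ! i) \<le> (\<lambda>_. 0)" if "i < length ms" for i
      using that \<open>std \<gamma>\<close> unfolding std by (metis le_fun_def order_trans)
    then show ?thesis unfolding std x e0 by auto
  qed
  show "\<exists>x\<in>faces (length ms) 0. mdeg ms x \<le> \<gamma> \<and> (if x = {} then 1 else 0 :: 'k) \<noteq> 0" if "std \<gamma>" for \<gamma>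
    using that f0 by (auto simp: q_def std e0 le_fun_def)
  show "cycle std (faces (length ms)) taylor (\<lambda>x. if x = {} then 1 else 0) i \<gamma> v \<longleftrightarrow>
      (\<exists>w\<in>supp (mdeg ms) (faces (length ms) (Suc i)) \<gamma>. v = lin_ext (faces (length ms) (Suc i)) taylor w)"
    (is "?c \<longleftrightarrow> ?b")
    if v: "v \<in> supp (mdeg ms) (faces (length ms) i) \<gamma>" for v :: "nat set \<Rightarrow> 'k" and i \<gamma>
  proof -
    consider (neg) "\<not> (\<forall>x. 0 \<le> \<gamma> x)" | (ok) "std \<gamma>"
      | (p) p where "p < q" "mon_exp (ms ! p) \<le> \<gamma>" "\<forall>x. 0 \<le> \<gamma> x" "\<not> std \<gamma>"
      unfolding q_def using std[of \<gamma>] by metis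
    then show ?thesis
    proof cases
      case neg
      have "v = (\<lambda>_. 0)"
      proof
        fix x show "v x = 0"
        proof (rule ccontr)
          assume "v x \<noteq> 0"
          then have "x \<in> faces q i" "mdeg ms x \<le> \<gamma>" using v by (auto simp: supp_def q_def)
          then show False using neg mdeg_le_iff[OF fin[of x i], of ms \<gamma>] by simp
        qed
      qed
      moreover have "?b" if "v = (\<lambda>_. 0)" using that by (intro bexI[of _ "\<lambda>_. 0"]) auto
      ultimately show ?thesis by (auto simp: cycle_def pairing_def split: nat.splits)
    next
      case std': ok
      have z: "w x = 0" if w: "w \<in> supp (mdeg ms) (faces q j) \<gamma>" and x: "x \<noteq> {}" for w :: "nat set \<Rightarrow> 'k" and j x
      proof (rule ccontr)
        assume "w x \<noteq> 0"
        then have "x \<in> faces q j" "mdeg ms x \<le> \<gamma>" using w by (auto simp: supp_def)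
        then have "\<forall>i\<in>x. i < q \<and> mon_exp (ms ! i) \<le> \<gamma>"
          using mdeg_le_iff[OF fin[of x j], of ms \<gamma>] by (auto simp: faces_def)
        moreover obtain i where "i \<in> x" using x by blast
        ultimately show False using std'[unfolded std] unfolding q_def by blast
      qed
      have zS: "w = (\<lambda>_. 0)" if w: "w \<in> supp (mdeg ms) (faces q (Suc j)) \<gamma>" for w :: "nat set \<Rightarrow> 'k" and j
      proof
        fix x show "w x = 0"
          using z[OF w, of x] w by (cases "x = {}") (auto simp: supp_def faces_def)
      qed
      have b: "?b \<longleftrightarrow> v = (\<lambda>_. 0)"
      proof
        assume ?b
        then obtain w where "w \<in> supp (mdeg ms) (faces q (Suc i)) \<gamma>" "v = lin_ext (faces q (Suc i)) taylor w"
          unfolding q_def by blast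
        then show "v = (\<lambda>_. 0)" using zS by fastforce
      qed (intro bexI[of _ "\<lambda>_. 0"], auto)
      show ?thesis
      proof (cases i)
        case 0
        have "pairing (faces q 0) (\<lambda>x. if x = {} then 1 else 0) v = v {}"
          by (simp add: pairing_def f0)
        moreover have "v = (\<lambda>_. 0) \<longleftrightarrow> v {} = 0"
          using z[of v i] v unfolding q_def by (metis (no_types, lifting) ext)
        ultimately show ?thesis using b std' 0 by (simp add: cycle_def q_def)
      next
        case (Suc j)
        then have "v = (\<lambda>_. 0)" using zS v by (simp add: q_def)
        then show ?thesis using b Suc by (simp add: cycle_def)
      qed
    next
      case p
      show ?thesis
      proof
        assume c: ?c
        \<comment> \<open>The cone over \<open>v\<close> with apex \<open>p\<close>, signed so that
          its boundary is \<open>v\<close> if \<open>v\<close> is a cycle. It stays in degree at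
          most \<gamma> because the generator \<open>p\<close> does.\<close>
        define w where "w = (\<lambda>y. if p \<in> y then sgn_at p (y - {p}) * v (y - {p}) else 0)"
        have w: "w \<in> supp (mdeg ms) (faces q (Suc i)) \<gamma>"
        proof -
          have "y \<in> faces q (Suc i) \<and> mdeg ms y \<le> \<gamma>" if "w y \<noteq> 0" for y
          proof -
            have py: "p \<in> y" "v (y - {p}) \<noteq> 0" using that by (auto simp: w_def split: if_splits)
            then have yp: "y - {p} \<in> faces q i" "mdeg ms (y - {p}) \<le> \<gamma>" using v by (auto simp: supp_def q_def)
            then have fy: "finite y" using fin by fastforce
            have "card y = Suc (card (y - {p}))" by (rule card.remove[OF fy py(1)])
            moreover have "y \<subseteq> {..<q}" using yp p(1) by (auto simp: faces_def)
            ultimately have "y \<in> faces q (Suc i)" using yp(1) by (simp add: faces_def)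
            moreover have "mdeg ms y \<le> \<gamma>"
              unfolding mdeg_le_iff[OF fy]
              using p(2,3) yp(2)[unfolded mdeg_le_iff[OF fin[OF yp(1)]]] by auto
            ultimately show ?thesis by simp
          qed
          then show ?thesis by (simp add: supp_def)
        qed
        have "v = lin_ext (faces q (Suc i)) taylor w"
        proof
          fix x
          show "v x = lin_ext (faces q (Suc i)) taylor w x"
          proof (cases "x \<in> faces q i")
            case False
            have "lin_ext (faces q (Suc i)) taylor w \<in> supp (mdeg ms) (faces q i) \<gamma>"
              by (rule lin_ext_supp[OF T_supp w])
            then have "lin_ext (faces q (Suc i)) taylor w x = 0"
              using False unfolding supp_def by blast
            moreover have "v x = 0" using False v unfolding supp_def q_def by blast
            ultimately show ?thesis by simp
          next
            case True
            have fx: "finite x" "x \<subseteq> {..<q}" "card x = i" using True fin[OF True] by (auto simp: faces_def)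
            show ?thesis
            proof (cases "p \<in> x")
              case False
              have "(\<Sum>j\<in>{..<q} - x. sgn_at j x * w (insert j x)) =
                  (\<Sum>j\<in>{..<q} - x. if p = j then v x else 0)"
                using False by (intro sum.cong refl) (auto simp: w_def)
              then show ?thesis using False p(1) by (simp add: ext_taylor[OF True])
            next
              case px: True
              \<comment> \<open>For a face containing the apex, the value of \<open>v\<close> is
                recovered from the cycle condition at \<open>u\<close>, whose term for
                \<open>p\<close> is \<open>v x\<close> up to sign; exchanging signs turns the
                remaining terms into the boundary of the cone.\<close>
              define u where "u = x - {p}"
              have xu: "x = insert p u" "p \<notin> u" using px by (auto simp: u_def)
              obtain j' where i: "i = Suc j'" using fx px by (cases i) auto
              have u: "u \<in> faces q j'" "finite u"
                using insert_faceD(1)[of p u q j'] True[unfolded i] xu fx(1) unfolding u_def by simp_all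
              have "lin_ext (faces q (Suc j')) taylor v u = 0"
                using c i by (simp add: cycle_def q_def)
              then have "(\<Sum>j\<in>{..<q} - u. sgn_at j u * v (insert j u)) = 0"
                by (simp only: ext_taylor[OF u(1)])
              moreover have "{..<q} - u = insert p ({..<q} - x)" using xu p(1) by auto
              moreover have "p \<notin> {..<q} - x" using px by simp
              ultimately have "(\<Sum>j\<in>insert p ({..<q} - x). sgn_at j u * v (insert j u)) = 0"
                by (simp only:)
              then have "sgn_at p u * v (insert p u) + (\<Sum>j\<in>{..<q} - x. sgn_at j u * v (insert j u)) = 0"
                by (simp only: sum.insert[OF finite_Diff[OF finite_lessThan] \<open>p \<notin> {..<q} - x\<close>])
              then have v_eq: "sgn_at p u * v x = - (\<Sum>j\<in>{..<q} - x. sgn_at j u * v (insert j u))"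
                unfolding xu(1)[symmetric] by (rule eq_neg_iff_add_eq_0[THEN iffD2])
              have "v x = sgn_at p u * (sgn_at p u * v x)" by simp
              also have "\<dots> = (\<Sum>j\<in>{..<q} - x. - (sgn_at p u * sgn_at j u) * v (insert j u))"
                unfolding v_eq by (simp add: sum_distrib_left sum_negf mult.assoc)
              also have "\<dots> = (\<Sum>j\<in>{..<q} - x. sgn_at j x * w (insert j x))"
              proof (intro sum.cong refl)
                fix j assume j: "j \<in> {..<q} - x"
                then have ju: "j \<noteq> p" "j \<notin> u" using xu by auto
                have "sgn_at j x * sgn_at p (insert j u) =
                    sgn_at j u * sgn_at j x * (sgn_at j u * sgn_at p (insert j u) :: 'k)"
                  by (simp add: mult_ac)
                also have "sgn_at j u * sgn_at p (insert j u) = - (sgn_at p u * sgn_at j x :: 'k)"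
                  unfolding xu(1) by (rule sgn_at_swap[OF ju xu(2) u(2)])
                also have "sgn_at j u * sgn_at j x * - (sgn_at p u * sgn_at j x) = - (sgn_at p u * sgn_at j u :: 'k)"
                  by (simp add: mult_ac)
                finally have "sgn_at j x * sgn_at p (insert j u) = - (sgn_at p u * sgn_at j u :: 'k)" .
                moreover have "w (insert j x) = sgn_at p (insert j u) * v (insert j u)"
                proof -
                  have "insert j x - {p} = insert j u" unfolding u_def using ju by blast
                  then show ?thesis using px unfolding w_def by simp
                qed
                ultimately show "- (sgn_at p u * sgn_at j u) * v (insert j u) = sgn_at j x * w (insert j x)"
                  by (metis mult.assoc)
              qed
              finally show ?thesis by (simp add: ext_taylor[OF True])
            qed
          qed
        qed
        then show ?b using w unfolding q_def by blast
      next
        assume ?b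
        then show ?c using p(4) taylor_square[of q]
          by (cases i) (auto simp: cycle_def q_def)
      qed
    qed
  qed
qed

subsection \<open>Cancelling the pruned edges\<close>

definition alive :: "'n mon list \<Rightarrow> nat \<Rightarrow> nat set set"
  where "alive ms j = Pow {..<length ms} - \<Union> (pruned_edges ms j)"

definition lex_greater :: "nat \<Rightarrow> nat set \<Rightarrow> nat set \<Rightarrow> bool"
  where "lex_greater j x y \<longleftrightarrow> (\<exists>k<j. k \<in> x \<and> k \<notin> y \<and> (\<forall>l<k. l \<in> x \<longleftrightarrow> l \<in> y))"

definition agree :: "nat \<Rightarrow> nat set \<Rightarrow> nat set \<Rightarrow> bool"
  where "agree j x y \<longleftrightarrow> (\<forall>l<j. l \<in> x \<longleftrightarrow> l \<in> y)"

lemma agree_sym: "agree j x y \<Longrightarrow> agree j y x"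
  by (simp add: agree_def)

lemma agree_trans: "agree j x y \<Longrightarrow> agree j y z \<Longrightarrow> agree j x z"
  by (simp add: agree_def)

lemma lex_agree: "lex_greater j x y \<Longrightarrow> agree j y z \<Longrightarrow> lex_greater j x z"
  unfolding lex_greater_def agree_def by (metis order_less_trans)

lemma agree_lex: "agree j x y \<Longrightarrow> lex_greater j y z \<Longrightarrow> lex_greater j x z"
  unfolding lex_greater_def agree_def by (metis order_less_trans)

lemma lex_trans: "lex_greater j x y \<Longrightarrow> lex_greater j y z \<Longrightarrow> lex_greater j x z"
proof -
  assume "lex_greater j x y" "lex_greater j y z"
  then obtain k m where k: "k < j" "k \<in> x" "k \<notin> y" "\<forall>l<k. l \<in> x \<longleftrightarrow> l \<in> y"
    and m: "m < j" "m \<in> y" "m \<notin> z" "\<forall>l<m. l \<in> y \<longleftrightarrow> l \<in> z"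
    unfolding lex_greater_def by metis
  have "k \<noteq> m" using k m by blast
  then have "k < m \<or> m < k" by arith
  then show ?thesis
  proof
    assume "k < m"
    then show ?thesis unfolding lex_greater_def using k m by (intro exI[of _ k]) (metis order_less_trans)
  next
    assume "m < k"
    then show ?thesis unfolding lex_greater_def using k m by (intro exI[of _ m]) (metis order_less_trans)
  qed
qed

lemma lex_not_agree: "lex_greater j x y \<Longrightarrow> \<not> agree j x y"
  by (auto simp: lex_greater_def agree_def)

lemma lex_Suc: "lex_greater j x y \<Longrightarrow> lex_greater (Suc j) x y"
  unfolding lex_greater_def using less_SucI by blast

lemma finite_alive: "finite (alive ms j)"
  by (simp add: alive_def)

lemma alive_finite: "x \<in> alive ms j \<Longrightarrow> finite x"
  by (auto simp: alive_def intro: finite_subset)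

definition eligible :: "'n mon list \<Rightarrow> nat \<Rightarrow> nat set set"
  where "eligible ms j =
    {\<sigma> \<in> alive ms j. j \<notin> \<sigma> \<and> insert j \<sigma> \<in> alive ms j \<and> mdeg ms \<sigma> = mdeg ms (insert j \<sigma>)}"

lemma alive_Suc:
  assumes "j < length ms"
  shows "alive ms (Suc j) = alive ms j - (\<Union>\<sigma>\<in>eligible ms j. {\<sigma>, insert j \<sigma>})"
proof -
  have "{{\<sigma>, insert j \<sigma>} | \<sigma>. \<sigma> \<subseteq> {..<length ms} \<and> j \<notin> \<sigma> \<and> mdeg ms \<sigma> = mdeg ms (insert j \<sigma>) \<and>
         \<sigma> \<notin> \<Union> (pruned_edges ms j) \<and> insert j \<sigma> \<notin> \<Union> (pruned_edges ms j)} =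
      (\<lambda>\<sigma>. {\<sigma>, insert j \<sigma>}) ` eligible ms j"
    using assms unfolding eligible_def alive_def by blast
  then have "pruned_edges ms (Suc j) = pruned_edges ms j \<union> (\<lambda>\<sigma>. {\<sigma>, insert j \<sigma>}) ` eligible ms j"
    by simp
  then show ?thesis unfolding alive_def by blast
qed

lemma critical_eq_alive: "critical_faces ms = alive ms (length ms)"
  by (simp add: critical_faces_def alive_def)

text \<open>Along the cancellations, the differential between faces of equal multidegree can only strictly
  decrease a face in the lexicographic order of the first \<open>j\<close> vertices, and it is unchanged between
  faces with the same first \<open>j\<close> vertices.\<close>

definition pruned_complex ::
  "('n::finite mdegree \<Rightarrow> bool) \<Rightarrow> 'n mon list \<Rightarrow> nat \<Rightarrow> nat set set \<Rightarrow> (nat set \<Rightarrow> nat set \<Rightarrow> 'k::field) \<Rightarrow> bool"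
  where "pruned_complex std ms j X D \<longleftrightarrow>
    based_resolution std (\<lambda>i. {x \<in> X. card x = i}) (mdeg ms) D (\<lambda>x. if x = {} then 1 else 0) \<and>
    (\<forall>x\<in>X. \<forall>y\<in>X. card y = Suc (card x) \<longrightarrow> mdeg ms x = mdeg ms y \<longrightarrow>
      (D y x \<noteq> 0 \<longrightarrow> lex_greater j x y \<or> agree j x y) \<and>
      (agree j x y \<longrightarrow> \<not> (j \<in> x \<and> j \<notin> y) \<longrightarrow> D y x = taylor y x))"

text \<open>A nonzero correction \<open>D t x * D y s / D t s\<close> gives
  \<open>lex_greater\<close> or \<open>agree\<close> both for \<open>x\<close>, \<open>t\<close> and
  for \<open>s\<close>, \<open>y\<close>, and \<open>s\<close>, \<open>t\<close> agree below
  \<open>j\<close>, so the relations compose. The pairs of one step are cancelled one at a time and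
  the invariant must hold in between. Coefficients with \<open>j \<in> x\<close> and
  \<open>j \<notin> y\<close> may change meanwhile, which is why its second clause exempts
  them.\<close>

lemma pruned_complex_eliminate:
  fixes D :: "nat set \<Rightarrow> nat set \<Rightarrow> 'k::field"
  assumes P: "pruned_complex std ms j X D"
    and s: "s \<in> X" "j \<notin> s" "insert j s \<in> X" "mdeg ms s = mdeg ms (insert j s)" "finite s"
  shows "pruned_complex std ms j (X - {s, insert j s}) (eliminate s (insert j s) D)"
proof -
  define t where "t = insert j s"
  define X' where "X' = X - {s, t}"
  have R: "based_resolution std (\<lambda>i. {x \<in> X. card x = i}) (mdeg ms) D (\<lambda>x. if x = {} then 1 else 0)"
    using P by (simp add: pruned_complex_def)
  interpret R: based_resolution std "\<lambda>i. {x \<in> X. card x = i}" "mdeg ms" D "\<lambda>x. if x = {} then 1 else 0"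
    by (rule R)
  have ct: "card t = Suc (card s)" using s by (simp add: t_def)
  have tX: "t \<in> X" using s by (simp add: t_def)
  have st: "mdeg ms s = mdeg ms t" using s by (simp add: t_def)
  have ag: "agree j s t" by (auto simp: agree_def t_def)
  have inv: "D y x \<noteq> 0 \<Longrightarrow> lex_greater j x y \<or> agree j x y"
    "agree j x y \<Longrightarrow> \<not> (j \<in> x \<and> j \<notin> y) \<Longrightarrow> D y x = taylor y x"
    if "x \<in> X" "y \<in> X" "card y = Suc (card x)" "mdeg ms x = mdeg ms y" for x y
    using P that by (auto simp: pruned_complex_def)
  have "D t s = taylor t s"
    using inv(2)[OF s(1) tX ct st ag] s(2) by blast
  also have "taylor t s = (sgn_at j s :: 'k)"
    unfolding t_def by (rule taylor_insert[OF s(2)])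
  finally have nz: "D t s \<noteq> 0"
    by (simp add: sgn_at_def)
  have res: "based_resolution std (\<lambda>i. {x \<in> X'. card x = i}) (mdeg ms) (eliminate s t D) (\<lambda>x. if x = {} then 1 else 0)"
  proof -
    have "based_resolution std (\<lambda>i. {x \<in> X. card x = i} - {s, t}) (mdeg ms) (eliminate s t D) (\<lambda>x. if x = {} then 1 else 0)"
      by (rule eliminate_based_resolution[OF R, of s "card s" t]) (use s tX ct st nz in auto)
    moreover have "(\<lambda>i. {x \<in> X. card x = i} - {s, t}) = (\<lambda>i. {x \<in> X'. card x = i})"
      by (auto simp: X'_def)
    ultimately show ?thesis by (simp only:)
  qed
  have "(eliminate s t D y x \<noteq> 0 \<longrightarrow> lex_greater j x y \<or> agree j x y) \<and>
      (agree j x y \<longrightarrow> \<not> (j \<in> x \<and> j \<notin> y) \<longrightarrow> eliminate s t D y x = taylor y x)"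
    if xy: "x \<in> X'" "y \<in> X'" "card y = Suc (card x)" "mdeg ms x = mdeg ms y" for x y
  proof -
    have X: "x \<in> X" "y \<in> X" and ne: "x \<noteq> s" "x \<noteq> t" "y \<noteq> s" "y \<noteq> t" using xy by (auto simp: X'_def)
    have el: "eliminate s t D y x = D y x - D t x * D y s / D t s"
      using ne by (simp add: eliminate_def)
    show ?thesis
    proof (cases "D t x * D y s = 0")
      case True
      then have eq: "eliminate s t D y x = D y x"
        unfolding el by (metis diff_0_right div_0)
      show ?thesis unfolding eq using inv[OF X xy(3,4)] by blast
    next
      case False
      then have nz': "D t x \<noteq> 0" "D y s \<noteq> 0" by auto
      have x: "card x = card s" "mdeg ms x \<le> mdeg ms t"
        using R.D_supp[of t "card s"] tX ct nz' by (auto simp: supp_def)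
      have "mdeg ms s \<le> mdeg ms y"
        using R.D_supp[of y "card x"] X xy nz' by (auto simp: supp_def)
      then have eqs: "mdeg ms x = mdeg ms t" "mdeg ms s = mdeg ms y"
        using x st xy(4) by auto
      have i1: "lex_greater j x t \<or> agree j x t"
        using inv(1)[OF X(1) tX _ eqs(1) nz'(1)] ct x by simp
      have i2: "lex_greater j s y \<or> agree j s y"
        using inv(1)[OF s(1) X(2) _ eqs(2) nz'(2)] xy(3) x by simp
      have main: "lex_greater j x y \<or> (agree j x t \<and> agree j s y)"
        using i1 i2 lex_agree[OF _ agree_sym[OF ag], of x] agree_trans[OF _ agree_sym[OF ag], of x]
          lex_trans[of j x s y] lex_agree[of j x s y] agree_lex[of j x s y] by blast
      \<comment> \<open>If both comparisons are mere agreement, both coefficients are still those of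
        the Taylor complex. So \<open>x\<close> is \<open>t\<close> without a vertex and
        \<open>y\<close> is \<open>s\<close> with an added one; neither vertex is \<open>j\<close>,
        as \<open>x\<close> differs from \<open>s\<close> and \<open>y\<close> from
        \<open>t\<close>. This is the exempted case.\<close>
      have "j \<in> x \<and> j \<notin> y" if a: "agree j x t" "agree j s y"
      proof
        have "D t x = taylor t x"
          using inv(2)[OF X(1) tX _ eqs(1) a(1)] ct x by (simp add: t_def)
        then obtain l where "l \<notin> x" "t = insert l x" using taylor_nonzeroD[of t x] nz' by metis
        then show "j \<in> x" using ne(1) s(2) unfolding t_def by (metis insert_ident insertE insertI1)
        have "D y s = taylor y s"
          using inv(2)[OF s(1) X(2) _ eqs(2) a(2)] s(2) xy(3) x by simp
        then obtain l where "l \<notin> s" "y = insert l s" using taylor_nonzeroD[of y s] nz' by metis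
        then show "j \<notin> y" using ne(4) s(2) unfolding t_def by blast
      qed
      moreover have "agree j x y" if "agree j x t" "agree j s y"
        using agree_trans[OF agree_trans[OF that(1) agree_sym[OF ag]] that(2)] .
      ultimately show ?thesis
        using main lex_not_agree[of j x y] by blast
    qed
  qed
  then show ?thesis
    using res unfolding pruned_complex_def X'_def t_def by blast
qed

text \<open>Once all pairs at \<open>j\<close> are cancelled, the exempted coefficients between
  faces agreeing below \<open>j\<close> have their first difference at \<open>j\<close>, in
  \<open>x\<close>, so they fall under \<open>lex_greater (Suc j)\<close>.\<close>

lemma pruned_complex_step:
  assumes "pruned_complex std ms j (alive ms j) (D :: nat set \<Rightarrow> nat set \<Rightarrow> 'k::field)" "j < length ms"
  shows "\<exists>D' :: nat set \<Rightarrow> nat set \<Rightarrow> 'k. pruned_complex std ms (Suc j) (alive ms (Suc j)) D'"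
proof -
  have "\<exists>D' :: nat set \<Rightarrow> nat set \<Rightarrow> 'k. pruned_complex std ms j (alive ms j - (\<Union>\<sigma>\<in>F. {\<sigma>, insert j \<sigma>})) D'"
    if "finite F" "F \<subseteq> eligible ms j" for F
    using that
  proof (induction F rule: finite_induct)
    case empty
    then show ?case using assms by auto
  next
    case (insert s F)
    define X where "X = alive ms j - (\<Union>\<sigma>\<in>F. {\<sigma>, insert j \<sigma>})"
    obtain D' :: "nat set \<Rightarrow> nat set \<Rightarrow> 'k" where D': "pruned_complex std ms j X D'"
      using insert by (auto simp: X_def)
    have s: "s \<in> alive ms j" "j \<notin> s" "insert j s \<in> alive ms j" "mdeg ms s = mdeg ms (insert j s)"
      using insert.prems by (auto simp: eligible_def)
    have F: "\<And>\<sigma>. \<sigma> \<in> F \<Longrightarrow> j \<notin> \<sigma>" using insert.prems by (auto simp: eligible_def)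
    have "s \<in> X" "insert j s \<in> X"
      using s F insert.hyps(2) unfolding X_def by (simp_all, blast, metis insert_ident insertI1)
    then have "pruned_complex std ms j (X - {s, insert j s}) (eliminate s (insert j s) D')"
      using s alive_finite by (intro pruned_complex_eliminate[OF D']) auto
    moreover have "X - {s, insert j s} = alive ms j - (\<Union>\<sigma>\<in>insert s F. {\<sigma>, insert j \<sigma>})"
      by (auto simp: X_def)
    ultimately show ?case by (metis (no_types, lifting))
  qed
  moreover have "finite (eligible ms j)"
    unfolding eligible_def by (rule finite_subset[OF _ finite_alive[of ms j]]) blast
  ultimately obtain D' :: "nat set \<Rightarrow> nat set \<Rightarrow> 'k" where D': "pruned_complex std ms j (alive ms (Suc j)) D'"
    unfolding alive_Suc[OF assms(2)] by blast
  have "(D' y x \<noteq> 0 \<longrightarrow> lex_greater (Suc j) x y \<or> agree (Suc j) x y) \<and>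
      (agree (Suc j) x y \<longrightarrow> D' y x = taylor y x)"
    if xy: "x \<in> alive ms (Suc j)" "y \<in> alive ms (Suc j)" "card y = Suc (card x)" "mdeg ms x = mdeg ms y" for x y
  proof -
    have inv: "D' y x \<noteq> 0 \<Longrightarrow> lex_greater j x y \<or> agree j x y"
      "agree j x y \<Longrightarrow> \<not> (j \<in> x \<and> j \<notin> y) \<Longrightarrow> D' y x = taylor y x"
      using D' xy by (auto simp: pruned_complex_def)
    have agS: "agree (Suc j) x y \<longleftrightarrow> agree j x y \<and> (j \<in> x \<longleftrightarrow> j \<in> y)"
      by (auto simp: agree_def less_Suc_eq)
    \<comment> \<open>Such a coefficient is still that of the Taylor complex, so it would force
      \<open>y = insert j x\<close>; but that pair is eligible and has been removed.\<close>
    have "D' y x = 0" if a: "agree j x y" "j \<notin> x" "j \<in> y"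
    proof (rule ccontr)
      assume "D' y x \<noteq> 0"
      then have "taylor y x \<noteq> (0 :: 'k)" using inv(2)[OF a(1)] a by simp
      then obtain l where "l \<notin> x" "y = insert l x" using taylor_nonzeroD by metis
      then have y: "y = insert j x" using a by blast
      then have "x \<in> eligible ms j"
        using xy a alive_Suc[OF assms(2)] by (auto simp: eligible_def)
      then show False using xy(1) alive_Suc[OF assms(2)] by blast
    qed
    moreover have "lex_greater (Suc j) x y" if "agree j x y" "j \<in> x" "j \<notin> y"
      using that unfolding lex_greater_def agree_def by blast
    ultimately show ?thesis using inv agS lex_Suc by blast
  qed
  then have "pruned_complex std ms (Suc j) (alive ms (Suc j)) D'"
    using D' unfolding pruned_complex_def by blast
  then show ?thesis by blast
qed

lemma critical_based_resolution:
  fixes std :: "'n::finite mdegree \<Rightarrow> bool"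
  assumes std: "\<And>\<gamma>. std \<gamma> \<longleftrightarrow> (\<forall>x. 0 \<le> \<gamma> x) \<and> \<not> (\<exists>i<length ms. mon_exp (ms ! i) \<le> \<gamma>)"
  obtains D :: "nat set \<Rightarrow> nat set \<Rightarrow> 'k::field" where
    "based_resolution std (\<lambda>i. {x \<in> critical_faces ms. card x = i}) (mdeg ms) D (\<lambda>x. if x = {} then 1 else 0)"
    "\<And>x y. x \<in> critical_faces ms \<Longrightarrow> y \<in> critical_faces ms \<Longrightarrow> card y = Suc (card x) \<Longrightarrow>
       mdeg ms x = mdeg ms y \<Longrightarrow> D y x \<noteq> 0 \<Longrightarrow> lex_greater (length ms) x y"
proof -
  have "\<exists>D :: nat set \<Rightarrow> nat set \<Rightarrow> 'k. pruned_complex std ms j (alive ms j) D" if "j \<le> length ms" for j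
    using that
  proof (induction j)
    case 0
    have "based_resolution std (faces (length ms)) (mdeg ms) taylor (\<lambda>x. if x = {} then 1 else 0 :: 'k)"
      using taylor_based_resolution[OF std] .
    moreover have "faces (length ms) = (\<lambda>i. {x \<in> alive ms 0. card x = i})"
      by (simp add: faces_def alive_def fun_eq_iff)
    ultimately have "pruned_complex std ms 0 (alive ms 0) (taylor :: nat set \<Rightarrow> nat set \<Rightarrow> 'k)"
      by (simp add: pruned_complex_def agree_def)
    then show ?case by blast
  next
    case (Suc j)
    then show ?case using pruned_complex_step[of std ms j] by auto
  qed
  then obtain D :: "nat set \<Rightarrow> nat set \<Rightarrow> 'k" where
    D: "pruned_complex std ms (length ms) (critical_faces ms) D"
    unfolding critical_eq_alive by blast
  show ?thesis
  proof (rule that[of D])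
    show "based_resolution std (\<lambda>i. {x \<in> critical_faces ms. card x = i}) (mdeg ms) D (\<lambda>x. if x = {} then 1 else 0)"
      using D by (simp add: pruned_complex_def)
    fix x y assume xy: "x \<in> critical_faces ms" "y \<in> critical_faces ms" "card y = Suc (card x)"
      "mdeg ms x = mdeg ms y" "D y x \<noteq> 0"
    have "\<not> agree (length ms) x y"
    proof
      assume "agree (length ms) x y"
      moreover have "x \<subseteq> {..<length ms}" "y \<subseteq> {..<length ms}"
        using xy by (auto simp: critical_faces_def)
      ultimately have "x = y" unfolding agree_def by blast
      then show False using xy by simp
    qed
    then show "lex_greater (length ms) x y"
      using D xy unfolding pruned_complex_def by blast
  qed
qed

subsection \<open>Betti numbers of monomial ideals\<close>

lemma mult_module: "Modules.module ((*) :: 'a::comm_ring_1 \<Rightarrow> 'a \<Rightarrow> 'a)"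
  by unfold_locales (simp_all add: algebra_simps)

lemma single_mem_monomial_ideal:
  fixes T :: "'n mon set"
  assumes "m \<in> T"
  shows "Poly_Mapping.single (s + m) a \<in> Modules.module.span (*) (mpoly_monom ` T :: ('n, 'k::field) mpoly set)"
proof -
  interpret Modules.module "(*) :: ('n, 'k) mpoly \<Rightarrow> ('n, 'k) mpoly \<Rightarrow> ('n, 'k) mpoly" by (rule mult_module)
  have "Poly_Mapping.single s a * mpoly_monom m \<in> span (mpoly_monom ` T)"
    using assms by (intro span_scale span_base) auto
  then show ?thesis by (simp add: mpoly_monom_def mult_single)
qed

lemma mem_monomial_ideal_iff:
  fixes T :: "'n mon set" and f :: "('n, 'k::field) mpoly"
  shows "f \<in> Modules.module.span (*) (mpoly_monom ` T) \<longleftrightarrow>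
    (\<forall>t\<in>Poly_Mapping.keys f. \<exists>m\<in>T. \<exists>s. t = s + m)"
proof -
  interpret Modules.module "(*) :: ('n, 'k) mpoly \<Rightarrow> ('n, 'k) mpoly \<Rightarrow> ('n, 'k) mpoly" by (rule mult_module)
  show ?thesis
  proof
    assume "f \<in> span (mpoly_monom ` T)"
    then show "\<forall>t\<in>Poly_Mapping.keys f. \<exists>m\<in>T. \<exists>s. t = s + m"
    proof (induction rule: span_induct_alt)
      case base
      then show ?case by simp
    next
      case (step c x y)
      show ?case
      proof
        fix t assume "t \<in> Poly_Mapping.keys (c * x + y)"
        then have "t \<in> Poly_Mapping.keys (c * x) \<union> Poly_Mapping.keys y"
          by (rule subsetD[OF Poly_Mapping.keys_add])
        then show "\<exists>m\<in>T. \<exists>s. t = s + m"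
        proof (rule UnE)
          assume t: "t \<in> Poly_Mapping.keys (c * x)"
          obtain m where m: "m \<in> T" "x = mpoly_monom m" using step(1) by blast
          have "t \<in> {a + b |a b. a \<in> Poly_Mapping.keys c \<and> b \<in> Poly_Mapping.keys x}"
            by (rule subsetD[OF keys_mult t])
          then show ?thesis using m by (auto simp: mpoly_monom_def)
        qed (use step in blast)
      qed
    qed
  next
    assume *: "\<forall>t\<in>Poly_Mapping.keys f. \<exists>m\<in>T. \<exists>s. t = s + m"
    show "f \<in> span (mpoly_monom ` T)"
    proof (subst mpoly_eq_sum[of f], rule span_sum)
      fix u assume "u \<in> Poly_Mapping.keys f"
      then obtain m s where u: "m \<in> T" "u = s + m" using * by blast
      show "Poly_Mapping.single u (Poly_Mapping.lookup f u) \<in> span (mpoly_monom ` T)"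
        unfolding u(2) by (rule single_mem_monomial_ideal[OF u(1)])
    qed
  qed
qed

lemma exists_add_iff_le: "(\<exists>s. t = s + m) \<longleftrightarrow> mon_exp m \<le> mon_exp (t :: 'n::finite mon)"
proof
  assume "\<exists>s. t = s + m"
  then show "mon_exp m \<le> mon_exp t" by (auto simp: le_fun_def mon_exp_def lookup_add)
next
  assume "mon_exp m \<le> mon_exp t"
  then have le: "Poly_Mapping.lookup m x \<le> Poly_Mapping.lookup t x" for x
    by (simp add: le_fun_def mon_exp_def)
  have "t = Abs_poly_mapping (\<lambda>x. Poly_Mapping.lookup t x - Poly_Mapping.lookup m x) + m"
    using le by (intro poly_mapping_eqI) (simp add: lookup_add)
  then show "\<exists>s. t = s + m" by blast
qed

lemma count_list_map_distinct:
  "distinct xs \<Longrightarrow> count_list (map f xs) a = card {x \<in> set xs. f x = a}"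
proof -
  assume "distinct xs"
  have "count_list (map f xs) a = length (filter (\<lambda>x. f x = a) xs)"
    by (induction xs) auto
  also have "\<dots> = card (set (filter (\<lambda>x. f x = a) xs))"
    by (rule distinct_card[symmetric]) (simp add: \<open>distinct xs\<close>)
  finally show ?thesis by simp
qed

locale monomial_ideal =
  fixes I :: "('n::finite, 'k::field) mpoly set" and ms :: "'n mon list"
  assumes I: "I = Modules.module.span (*) (mpoly_monom ` set ms)"
begin

lemma I_iff: "f \<in> I \<longleftrightarrow> (\<forall>t\<in>Poly_Mapping.keys f. \<exists>m\<in>set ms. mon_exp m \<le> mon_exp t)"
  unfolding I mem_monomial_ideal_iff exists_add_iff_le ..

lemma monom_iff: "mpoly_monom t \<in> I \<longleftrightarrow> (\<exists>i<length ms. mon_exp (ms ! i) \<le> mon_exp t)"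
proof -
  have "mpoly_monom t \<in> I \<longleftrightarrow> (\<exists>m\<in>set ms. mon_exp m \<le> mon_exp t)"
    unfolding I_iff by (simp add: mpoly_monom_def)
  then show ?thesis by (metis in_set_conv_nth)
qed

lemma I_monomial: "f \<in> I \<longleftrightarrow> (\<forall>t\<in>Poly_Mapping.keys f. mpoly_monom t \<in> I)"
  unfolding I_iff by (simp add: mpoly_monom_def)

lemma I_add: "mpoly_monom t \<in> I \<Longrightarrow> mpoly_monom (s + t) \<in> I"
proof -
  have "mon_exp t \<le> mon_exp (s + t)"
    by (simp add: le_fun_def mon_exp_def lookup_add)
  then show "mpoly_monom t \<in> I \<Longrightarrow> mpoly_monom (s + t) \<in> I"
    unfolding monom_iff by (blast intro: order_trans)
qed

definition standard :: "'n mdegree \<Rightarrow> bool"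
  where "standard \<gamma> \<longleftrightarrow> (\<forall>x. 0 \<le> \<gamma> x) \<and> mpoly_monom (exp_mon \<gamma>) \<notin> I"

lemma standard_iff:
  "standard \<gamma> \<longleftrightarrow> (\<forall>x. 0 \<le> \<gamma> x) \<and> \<not> (\<exists>i<length ms. mon_exp (ms ! i) \<le> \<gamma>)"
proof (cases "\<forall>x. 0 \<le> \<gamma> x")
  case True
  then have "mon_exp (exp_mon \<gamma>) = \<gamma>" by (simp add: mon_exp_exp_mon)
  then show ?thesis by (simp add: standard_def monom_iff)
qed (auto simp: standard_def)

text \<open>A nonzero scalar \<open>e x\<close> is realized by a homogeneous polynomial of degree
  \<open>deg x\<close> only if that degree is nonnegative; this is the purpose of
  \<open>nn\<close>.\<close>

lemma minimal_resolution_of_based: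
  fixes B :: "nat \<Rightarrow> 'b set" and D :: "'b \<Rightarrow> 'b \<Rightarrow> 'k"
  assumes R: "based_resolution standard B deg D e" "based_resolution.minimal B deg D"
    and nn: "\<And>x. x \<in> B 0 \<Longrightarrow> e x \<noteq> 0 \<Longrightarrow> \<forall>i. 0 \<le> deg x i"
  shows "\<exists>sh d \<epsilon>. minimal_graded_free_resolution I sh d \<epsilon> \<and>
    count_list (sh i) \<alpha> = card {x \<in> B i. deg x = \<alpha>}"
proof -
  interpret R: based_resolution standard B deg D e by (rule R)
  obtain xs where xs: "\<And>i. set (xs i) = B i" "\<And>i. distinct (xs i)"
    using finite_distinct_list[OF R.fin] by metis
  define d where "d i = mat (length (xs i)) (length (xs (Suc i)))
    (\<lambda>(a, b). hterm (\<lambda>j. deg (xs (Suc i) ! b) j - deg (xs i ! a) j) (D (xs (Suc i) ! b) (xs i ! a)))" for i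
  define \<epsilon> where "\<epsilon> = vec (length (xs 0)) (\<lambda>a. hterm (deg (xs 0 ! a)) (e (xs 0 ! a)))"
  have B_eq: "(\<lambda>i. set (xs i)) = B" using xs by auto
  interpret graded_data I xs deg d \<epsilon> D e
  proof (rule graded_data.intro)
    show "f \<in> I \<longleftrightarrow> (\<forall>t\<in>Poly_Mapping.keys f. mpoly_monom t \<in> I)" for f by (rule I_monomial)
    show "mpoly_monom (s + t) \<in> I" if "mpoly_monom t \<in> I" for s t using I_add[OF that] .
    show "graded_presentation (xs i) (xs (Suc i)) deg (d i) D" for i
    proof
      show "distinct (xs i)" "distinct (xs (Suc i))" by (simp_all add: xs)
      show "d i \<in> carrier_mat (length (xs i)) (length (xs (Suc i)))" by (simp add: d_def)
      show "homogeneous (\<lambda>j. deg (xs (Suc i) ! b) j - deg (xs i ! a) j) (d i $$ (a, b))"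
        if "a < length (xs i)" "b < length (xs (Suc i))" for a b
        using that by (simp add: d_def homogeneous_hterm)
      show "D (xs (Suc i) ! b) (xs i ! a) =
          hcoeff (\<lambda>j. deg (xs (Suc i) ! b) j - deg (xs i ! a) j) (d i $$ (a, b))"
        if ab: "a < length (xs i)" "b < length (xs (Suc i))" for a b
      proof -
        have "D (xs (Suc i) ! b) (xs i ! a) \<noteq> 0 \<Longrightarrow> deg (xs i ! a) \<le> deg (xs (Suc i) ! b)"
          using R.D_supp[of "xs (Suc i) ! b" i] ab xs(1) nth_mem by (fastforce simp: supp_def)
        then show ?thesis using ab by (auto simp: d_def hcoeff_hterm le_fun_def)
      qed
      show "D y x = 0" if "y \<in> set (xs (Suc i))" "x \<notin> set (xs i)" for x y
        using R.D_supp[of y i] that xs by (auto simp: supp_def)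
    qed
    show "\<epsilon> \<in> carrier_vec (length (xs 0))" by (simp add: \<epsilon>_def)
    show "homogeneous (deg (xs 0 ! a)) (\<epsilon> $ a)" if "a < length (xs 0)" for a
      using that by (simp add: \<epsilon>_def homogeneous_hterm)
    show "e (xs 0 ! a) = hcoeff (deg (xs 0 ! a)) (\<epsilon> $ a)" if "a < length (xs 0)" for a
      using that nn[of "xs 0 ! a"] xs(1)[of 0] nth_mem[OF that] by (auto simp: \<epsilon>_def hcoeff_hterm)
  qed
  have std: "std = standard" by (simp add: fun_eq_iff std_def standard_def)
  have "minimal_graded_free_resolution I (\<lambda>i. map deg (xs i)) d \<epsilon>"
    using minimal_resolution_iff R unfolding std B_eq by blast
  moreover have "count_list (map deg (xs i)) \<alpha> = card {x \<in> B i. deg x = \<alpha>}"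
    using count_list_map_distinct[OF xs(2)] xs(1) by metis
  ultimately show ?thesis by blast
qed

text \<open>Basis elements are pairs of homological degree and position: a degree may be repeated in
  \<open>sh i\<close>, and one function \<open>D\<close> has to serve all homological
  degrees.\<close>

lemma based_of_minimal_resolution:
  assumes min: "minimal_graded_free_resolution I sh d \<epsilon>"
  obtains B :: "nat \<Rightarrow> (nat \<times> nat) set" and deg D e where
    "based_resolution standard B deg (D :: _ \<Rightarrow> _ \<Rightarrow> 'k) e" "based_resolution.minimal B deg D"
    "\<And>i \<alpha>. count_list (sh i) \<alpha> = card {x \<in> B i. deg x = \<alpha>}"
proof -
  define xs where "xs i = map (Pair i) [0..<length (sh i)]" for i
  define deg where "deg x = sh (fst x) ! snd x" for x :: "nat \<times> nat"
  define D where "D y x = (if fst y = Suc (fst x) \<and> snd x < length (sh (fst x)) then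
    hcoeff (\<lambda>j. deg y j - deg x j) (d (fst x) $$ (snd x, snd y)) else 0)" for y x :: "nat \<times> nat"
  define e where "e x = hcoeff (deg x) (\<epsilon> $ snd x)" for x :: "nat \<times> nat"
  have len: "length (xs i) = length (sh i)" for i by (simp add: xs_def)
  have nth: "xs i ! a = (i, a)" if "a < length (sh i)" for i a using that by (simp add: xs_def)
  have dist: "distinct (xs i)" for i by (simp add: xs_def distinct_map inj_on_def)
  have g: "graded_free_resolution I sh d \<epsilon>"
    using min by (simp add: minimal_graded_free_resolution_def)
  have sh: "(\<lambda>i. map deg (xs i)) = sh"
    by (rule ext, rule nth_equalityI) (simp_all add: len nth deg_def)
  interpret graded_data I xs deg d \<epsilon> D e
  proof (rule graded_data.intro)
    show "f \<in> I \<longleftrightarrow> (\<forall>t\<in>Poly_Mapping.keys f. mpoly_monom t \<in> I)" for f by (rule I_monomial)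
    show "mpoly_monom (s + t) \<in> I" if "mpoly_monom t \<in> I" for s t using I_add[OF that] .
    show "graded_presentation (xs i) (xs (Suc i)) deg (d i) D" for i
    proof
      show "distinct (xs i)" "distinct (xs (Suc i))" by (simp_all add: dist)
      show "d i \<in> carrier_mat (length (xs i)) (length (xs (Suc i)))"
        using g by (simp add: graded_free_resolution_def len)
      show "homogeneous (\<lambda>j. deg (xs (Suc i) ! b) j - deg (xs i ! a) j) (d i $$ (a, b))"
        if "a < length (xs i)" "b < length (xs (Suc i))" for a b
        using that g by (simp add: graded_free_resolution_def len nth deg_def)
      show "D (xs (Suc i) ! b) (xs i ! a) =
          hcoeff (\<lambda>j. deg (xs (Suc i) ! b) j - deg (xs i ! a) j) (d i $$ (a, b))"
        if "a < length (xs i)" "b < length (xs (Suc i))" for a b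
        using that by (simp add: len nth D_def)
      show "D y x = 0" if "y \<in> set (xs (Suc i))" "x \<notin> set (xs i)" for x y
        using that by (cases x) (auto simp: xs_def D_def)
    qed
    show "\<epsilon> \<in> carrier_vec (length (xs 0))"
      using g by (simp add: graded_free_resolution_def len)
    show "homogeneous (deg (xs 0 ! a)) (\<epsilon> $ a)" if "a < length (xs 0)" for a
      using that g by (simp add: graded_free_resolution_def len nth deg_def)
    show "e (xs 0 ! a) = hcoeff (deg (xs 0 ! a)) (\<epsilon> $ a)" if "a < length (xs 0)" for a
      using that by (simp add: len nth e_def)
  qed
  have std: "std = standard" by (simp add: fun_eq_iff std_def standard_def)
  have R: "based_resolution standard (\<lambda>i. set (xs i)) deg D e"
    using resolution_iff g unfolding sh std by blast
  show ?thesis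
  proof (rule that[OF R])
    show "based_resolution.minimal (\<lambda>i. set (xs i)) deg D"
      using minimal_resolution_iff R min unfolding sh std by blast
    show "count_list (sh i) \<alpha> = card {x \<in> set (xs i). deg x = \<alpha>}" for i \<alpha>
      using count_list_map_distinct[OF dist, of deg i \<alpha>] fun_cong[OF sh, of i] by simp
  qed
qed

text \<open>The given based resolution provides a witness, and any other minimal resolution has the
  same ranks by \<open>minimal_card_le\<close> in both directions. This makes the definite
  description in \<open>betti\<close> well defined.\<close>

lemma betti_eq:
  assumes R: "based_resolution standard B deg (D :: 'b \<Rightarrow> 'b \<Rightarrow> 'k) e" "based_resolution.minimal B deg D"
    and nn: "\<And>x. x \<in> B 0 \<Longrightarrow> e x \<noteq> 0 \<Longrightarrow> \<forall>i. 0 \<le> deg x i"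
  shows "betti I i \<alpha> = card {x \<in> B i. deg x = \<alpha>}"
  unfolding betti_def
proof (rule the_equality)
  show "\<exists>sh d \<epsilon>. minimal_graded_free_resolution I sh d \<epsilon> \<and> card {x \<in> B i. deg x = \<alpha>} = count_list (sh i) \<alpha>"
    using minimal_resolution_of_based[OF R nn, of i \<alpha>] by metis
next
  fix b assume "\<exists>sh d \<epsilon>. minimal_graded_free_resolution I sh d \<epsilon> \<and> b = count_list (sh i) \<alpha>"
  then obtain sh d \<epsilon> where s: "minimal_graded_free_resolution I sh d \<epsilon>" "b = count_list (sh i) \<alpha>"
    by blast
  from s(1) show "b = card {x \<in> B i. deg x = \<alpha>}"
  proof (rule based_of_minimal_resolution)
    fix B' :: "nat \<Rightarrow> (nat \<times> nat) set" and deg' and D' :: "_ \<Rightarrow> _ \<Rightarrow> 'k" and e'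
    assume R': "based_resolution standard B' deg' D' e'" "based_resolution.minimal B' deg' D'"
      and c: "\<And>i \<alpha>. count_list (sh i) \<alpha> = card {x \<in> B' i. deg' x = \<alpha>}"
    show ?thesis
      unfolding s(2) c by (rule antisym[OF minimal_card_le[OF R' R(1)] minimal_card_le[OF R R'(1)]])
  qed
qed

end

text \<open>By \<open>critical_based_resolution\<close> this forbids every nonzero coefficient
  between critical faces of equal multidegree. It is only a sufficient condition for minimality, but
  a purely combinatorial one.\<close>

definition lex_good :: "'n mon list \<Rightarrow> bool"
  where "lex_good ms \<longleftrightarrow> (\<forall>x\<in>critical_faces ms. \<forall>y\<in>critical_faces ms.
    card y = Suc (card x) \<longrightarrow> mdeg ms x = mdeg ms y \<longrightarrow> \<not> lex_greater (length ms) x y)"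

lemma pruned_resolution_minimal_if_lex_good:
  fixes I :: "('n::finite, 'k::field) mpoly set"
  assumes "minimal_generators I ms" "lex_good ms"
  shows "pruned_resolution_minimal I ms"
proof -
  interpret monomial_ideal I ms
    using assms(1) by unfold_locales (simp add: minimal_generators_def)
  obtain D :: "nat set \<Rightarrow> nat set \<Rightarrow> 'k" where
    R: "based_resolution standard (\<lambda>i. {x \<in> critical_faces ms. card x = i}) (mdeg ms) D (\<lambda>x. if x = {} then 1 else 0)"
    and D: "\<And>x y. x \<in> critical_faces ms \<Longrightarrow> y \<in> critical_faces ms \<Longrightarrow> card y = Suc (card x) \<Longrightarrow>
       mdeg ms x = mdeg ms y \<Longrightarrow> D y x \<noteq> 0 \<Longrightarrow> lex_greater (length ms) x y"
    by (rule critical_based_resolution[of standard ms, OF standard_iff]) (rule that)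
  have "based_resolution.minimal (\<lambda>i. {x \<in> critical_faces ms. card x = i}) (mdeg ms) D"
    unfolding based_resolution.minimal_def[OF R] using D assms(2) unfolding lex_good_def by blast
  then have "betti I i \<alpha> = card {x \<in> {x \<in> critical_faces ms. card x = i}. mdeg ms x = \<alpha>}" for i \<alpha>
    by (rule betti_eq[OF R]) (auto simp: mdeg_def split: if_splits)
  then show ?thesis
    unfolding pruned_resolution_minimal_def by (auto intro!: arg_cong[where f = card])
qed

subsection \<open>Pruning families of subsets of a five-element set\<close>

text \<open>A family of subsets of \<open>{0, 1, 2, 3, 4}\<close> is given by its characteristic function on five truth
  values, and \<open>prune_i\<close> is step \<open>i\<close> of the pruning algorithm.\<close>

type_synonym fam = "bool \<Rightarrow> bool \<Rightarrow> bool \<Rightarrow> bool \<Rightarrow> bool \<Rightarrow> bool"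

definition prune_0 :: "fam \<Rightarrow> fam" where "prune_0 f a b c d e \<longleftrightarrow> f a b c d e \<and> \<not> f (\<not> a) b c d e"
definition prune_1 :: "fam \<Rightarrow> fam" where "prune_1 f a b c d e \<longleftrightarrow> f a b c d e \<and> \<not> f a (\<not> b) c d e"
definition prune_2 :: "fam \<Rightarrow> fam" where "prune_2 f a b c d e \<longleftrightarrow> f a b c d e \<and> \<not> f a b (\<not> c) d e"
definition prune_3 :: "fam \<Rightarrow> fam" where "prune_3 f a b c d e \<longleftrightarrow> f a b c d e \<and> \<not> f a b c (\<not> d) e"
definition prune_4 :: "fam \<Rightarrow> fam" where "prune_4 f a b c d e \<longleftrightarrow> f a b c d e \<and> \<not> f a b c d (\<not> e)"

definition crit :: "fam \<Rightarrow> fam" where "crit f = prune_4 (prune_3 (prune_2 (prune_1 (prune_0 f))))"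

definition upset :: "fam \<Rightarrow> bool" where
  "upset f \<longleftrightarrow> (\<forall>a b c d e. f a b c d e \<longrightarrow>
     f True b c d e \<and> f a True c d e \<and> f a b True d e \<and> f a b c True e \<and> f a b c d True)"

text \<open>The pairs of faces of consecutive cardinality at least two, both containing \<open>0\<close>, whose first
  difference belongs to the smaller face.\<close>

definition bad_pair :: "fam \<Rightarrow> bool" where
  "bad_pair f \<longleftrightarrow>
    crit f True True False False False \<and>
      (crit f True False True True False \<or> crit f True False True False True \<or> crit f True False False True True) \<or>
    (crit f True True True False False \<or> crit f True True False True False \<or> crit f True True False False True) \<and>
      crit f True False True True True \<or>
    crit f True False True False False \<and> crit f True False False True True \<or>
    crit f True True True False False \<and> crit f True True False True True"

definition small :: "fam \<Rightarrow> bool" where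
  "small f \<longleftrightarrow> \<not> f True False False False False \<and> \<not> f False True False False False \<and> \<not> f False False True False False
    \<and> \<not> f False False False True False \<and> \<not> f False False False False True \<and> \<not> f False False False False False"

text \<open>For an up-closed family, the faces left after steps \<open>0\<close> and \<open>1\<close> are the \<open>{0} \<union> a\<close> with \<open>a\<close> in \<open>in_A f\<close>
  and the \<open>{0, 1} \<union> a\<close> with \<open>a\<close> in \<open>in_B f\<close>.\<close>

definition in_A :: "fam \<Rightarrow> bool \<Rightarrow> bool \<Rightarrow> bool \<Rightarrow> bool" where
  "in_A f c d e \<longleftrightarrow> \<not> f False False c d e \<and> f True False c d e \<and> f False True c d e"

definition in_B :: "fam \<Rightarrow> bool \<Rightarrow> bool \<Rightarrow> bool \<Rightarrow> bool" where
  "in_B f c d e \<longleftrightarrow> \<not> f True False c d e \<and> \<not> f False True c d e \<and> f True True c d e"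

text \<open>The arguments stand for the vertices 2, 3, 4. If \<open>{2}\<close> and
  \<open>{3, 4}\<close> are both to survive steps 2 to 4 on \<open>A\<close>, this must hold: if
  just one of \<open>{3}\<close>, \<open>{2, 3}\<close> were in \<open>A\<close>, it would survive
  step 2 and lead to the cancellation of \<open>{3, 4}\<close> or \<open>{2}\<close>; likewise for
  \<open>{4}\<close>, \<open>{2, 4}\<close>.\<close>

definition split_bad :: "(bool \<Rightarrow> bool \<Rightarrow> bool \<Rightarrow> bool) \<Rightarrow> bool" where
  "split_bad A \<longleftrightarrow> A True False False \<and> A False True True \<and>
     (A False True False \<longleftrightarrow> A True True False) \<and> (A False False True \<longleftrightarrow> A True False True)"

lemmas steps = crit_def prune_4_def prune_3_def prune_2_def prune_1_def prune_0_def

section \<open>Pruning on four vertices and the propositional lemmas\<close>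

type_synonym fam4 = "bool \<Rightarrow> bool \<Rightarrow> bool \<Rightarrow> bool \<Rightarrow> bool"

definition prune4_0 :: "fam4 \<Rightarrow> fam4" where "prune4_0 f a b c d \<longleftrightarrow> f a b c d \<and> \<not> f (\<not> a) b c d"
definition prune4_1 :: "fam4 \<Rightarrow> fam4" where "prune4_1 f a b c d \<longleftrightarrow> f a b c d \<and> \<not> f a (\<not> b) c d"
definition prune4_2 :: "fam4 \<Rightarrow> fam4" where "prune4_2 f a b c d \<longleftrightarrow> f a b c d \<and> \<not> f a b (\<not> c) d"
definition prune4_3 :: "fam4 \<Rightarrow> fam4" where "prune4_3 f a b c d \<longleftrightarrow> f a b c d \<and> \<not> f a b c (\<not> d)"
definition crit4 :: "fam4 \<Rightarrow> fam4" where "crit4 f = prune4_3 (prune4_2 (prune4_1 (prune4_0 f)))"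
lemmas steps4 = crit4_def prune4_3_def prune4_2_def prune4_1_def prune4_0_def

definition upset4 :: "fam4 \<Rightarrow> bool" where
  "upset4 f \<longleftrightarrow> (\<forall>a b c d. f a b c d \<longrightarrow> f True b c d \<and> f a True c d \<and> f a b True d \<and> f a b c True)"

definition small4 :: "fam4 \<Rightarrow> bool" where
  "small4 f \<longleftrightarrow> \<not> f True False False False \<and> \<not> f False True False False \<and> \<not> f False False True False
    \<and> \<not> f False False False True \<and> \<not> f False False False False"

text \<open>In the graph formed by the pairs outside \<open>g\<close>: the first two vertices are not adjacent, the last two
  are, and each of the last two is adjacent to exactly one of the first two.\<close>

definition bad4 :: "fam4 \<Rightarrow> bool" where
  "bad4 g \<longleftrightarrow> g True True False False \<and> \<not> g False False True True \<and>
     (g True False True False \<noteq> g False True True False) \<and> (g True False False True \<noteq> g False True False True)"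

definition triples4 :: "fam4 \<Rightarrow> bool" where
  "triples4 g \<longleftrightarrow> g False True True True \<and> g True False True True \<and> g True True False True \<and> g True True True False"

text \<open>If no member contains a vertex, the step at this vertex prunes nothing, and the five
  steps reduce to the four others.\<close>

lemma crit_miss0: "(\<And>b c d e. \<not> f True b c d e) \<Longrightarrow> crit f False b c d e = crit4 (f False) b c d e"
  by (simp add: steps steps4)
lemma crit_miss1: "(\<And>a c d e. \<not> f a True c d e) \<Longrightarrow> crit f a False c d e = crit4 (\<lambda>a. f a False) a c d e"
  by (simp add: steps steps4)
lemma crit_miss2: "(\<And>a b d e. \<not> f a b True d e) \<Longrightarrow> crit f a b False d e = crit4 (\<lambda>a b. f a b False) a b d e"
  by (simp add: steps steps4)
lemma crit_miss3: "(\<And>a b c e. \<not> f a b c True e) \<Longrightarrow> crit f a b c False e = crit4 (\<lambda>a b c. f a b c False) a b c e"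
  by (simp add: steps steps4)
lemma crit_miss4: "(\<And>a b c d. \<not> f a b c d True) \<Longrightarrow> crit f a b c d False = crit4 (\<lambda>a b c d. f a b c d False) a b c d"
  by (simp add: steps steps4)

text \<open>The relation excluded by \<open>lex_good\<close>, that is \<open>lex_greater\<close>
  with consecutive cardinalities, on truth values.\<close>

definition rel4 :: "bool \<Rightarrow> bool \<Rightarrow> bool \<Rightarrow> bool \<Rightarrow> bool \<Rightarrow> bool \<Rightarrow> bool \<Rightarrow> bool \<Rightarrow> bool" where
  "rel4 a b c d a' b' c' d' \<longleftrightarrow>
    of_bool a' + of_bool b' + of_bool c' + of_bool d' = Suc (of_bool a + of_bool b + of_bool c + of_bool d) \<and>
    (a \<and> \<not> a' \<or> (a = a' \<and> (b \<and> \<not> b' \<or> (b = b' \<and> (c \<and> \<not> c' \<or> (c = c' \<and> d \<and> \<not> d'))))))"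

definition rel5 :: "bool \<Rightarrow> bool \<Rightarrow> bool \<Rightarrow> bool \<Rightarrow> bool \<Rightarrow> bool \<Rightarrow> bool \<Rightarrow> bool \<Rightarrow> bool \<Rightarrow> bool \<Rightarrow> bool" where
  "rel5 a b c d e a' b' c' d' e' \<longleftrightarrow>
    of_bool a' + of_bool b' + of_bool c' + of_bool d' + of_bool e' =
      Suc (of_bool a + of_bool b + of_bool c + of_bool d + of_bool e) \<and>
    (a \<and> \<not> a' \<or> (a = a' \<and> (b \<and> \<not> b' \<or> (b = b' \<and> (c \<and> \<not> c' \<or> (c = c' \<and> (d \<and> \<not> d' \<or> (d = d' \<and> e \<and> \<not> e'))))))))"

lemma crit_le: "crit f a b c d e \<Longrightarrow> f a b c d e"
  unfolding steps by (elim conjE)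

lemma crit4_le: "crit4 f a b c d \<Longrightarrow> f a b c d"
  unfolding steps4 by (elim conjE)

lemma crit4_first: "upset4 g \<Longrightarrow> \<not> crit4 g False b c d"
  unfolding upset4_def steps4 by auto

text \<open>In an upward closed family step 0 pairs every member without the first vertex with a
  member containing it.\<close>

lemma crit_first: "upset f \<Longrightarrow> \<not> crit f False b c d e"
  unfolding upset_def steps by auto

text \<open>To spare \<open>{0, 2, 3}\<close>, step 0 needs \<open>{2, 3}\<close> outside
  \<open>g\<close> and step 1 needs \<open>{1, 2, 3}\<close> inside. Steps 2 and 3 spare
  \<open>{0, 1}\<close> only if each of 2 and 3 forms a pair in \<open>g\<close> with 0 or 1, and
  spare \<open>{0, 2, 3}\<close> only if neither does so with both.\<close>

lemma crit4_pair:
  assumes "upset4 g" "small4 g" "crit4 g True True False False" "crit4 g True False True True"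
  shows "bad4 g \<and> triples4 g"
  using assms unfolding upset4_def small4_def all_bool_eq bad4_def triples4_def
  unfolding steps4 not_True_eq_False not_False_eq_True
  by (simp only: simp_thms) satx

lemma rel4_bad:
  assumes "upset4 g" "small4 g" "crit4 g a b c d" "crit4 g a' b' c' d'" "rel4 a b c d a' b' c' d'"
  shows "bad4 g \<and> triples4 g"
proof -
  have a: "a = True" "a' = True" using assms(3,4) crit4_first[OF assms(1)] by metis+
  have "\<not> crit4 g True False False False" using crit4_le assms(2) unfolding small4_def by metis
  then have "b \<and> \<not> c \<and> \<not> d \<and> \<not> b' \<and> c' \<and> d'"
    using assms(3,5) unfolding a by (cases b; cases c; cases d; cases b'; cases c'; cases d'; simp add: rel4_def)
  then show ?thesis using crit4_pair[OF assms(1,2)] assms(3,4) unfolding a by simp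
qed

lemma rel5_cases:
  assumes "rel5 True b c d e True b' c' d' e'" "b \<or> c \<or> d \<or> e"
  shows "(b, c, d, e, b', c', d', e') \<in>
    {(True, False, False, False, False, True, True, False), (True, False, False, False, False, True, False, True),
     (True, False, False, False, False, False, True, True), (True, True, False, False, False, True, True, True),
     (True, False, True, False, False, True, True, True), (True, False, False, True, False, True, True, True),
     (False, True, False, False, False, False, True, True), (True, True, False, False, True, False, True, True)}"
  using assms unfolding rel5_def
  by (cases b; cases c; cases d; cases e; cases b'; cases c'; cases d'; cases e') simp_all

lemma rel5_bad:
  assumes "upset f" "small f" "crit f a b c d e" "crit f a' b' c' d' e'" "rel5 a b c d e a' b' c' d' e'"
  shows "bad_pair f"
proof -
  have a: "a = True" "a' = True" using assms(3,4) crit_first[OF assms(1)] by metis+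
  have "\<not> crit f True False False False False" using crit_le assms(2) unfolding small_def by metis
  have ne: "b \<or> c \<or> d \<or> e"
  proof (rule ccontr)
    assume "\<not> (b \<or> c \<or> d \<or> e)"
    then have "b = False" "c = False" "d = False" "e = False" by simp_all
    then show False using \<open>\<not> crit f True False False False False\<close> assms(3) unfolding a by simp
  qed
  show ?thesis
    using rel5_cases[OF assms(5)[unfolded a] ne] assms(3,4) unfolding a bad_pair_def
    by (elim insertE emptyE) simp_all
qed

text \<open>For the family of the top multidegree this says that no set of four generators is
  closed.\<close>

definition quads :: "fam \<Rightarrow> bool" where
  "quads f \<longleftrightarrow> f False True True True True \<and> f True False True True True \<and> f True True False True True
    \<and> f True True True False True \<and> f True True True True False"

definition good3 :: "fam \<Rightarrow> bool" where
  "good3 f \<longleftrightarrow> \<not> f True True False False False \<and> f False False True True True \<and>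
    \<not> split_bad (in_A f) \<and> \<not> split_bad (in_B f)"

text \<open>The ten pairwise disjunctions say that at most one of the five four-element sets lies
  outside \<open>f\<close>, that is, at most one set of four generators is closed.\<close>

definition one_quad :: "fam \<Rightarrow> bool" where
  "one_quad f \<longleftrightarrow> (f False True True True True \<or> f True False True True True) \<and>
   (f False True True True True \<or> f True True False True True) \<and>
   (f False True True True True \<or> f True True True False True) \<and>
   (f False True True True True \<or> f True True True True False) \<and>
   (f True False True True True \<or> f True True False True True) \<and>
   (f True False True True True \<or> f True True True False True) \<and>
   (f True False True True True \<or> f True True True True False) \<and>
   (f True True False True True \<or> f True True True False True) \<and>
   (f True True False True True \<or> f True True True True False) \<and>
   (f True True True False True \<or> f True True True True False)"

text \<open>The conjuncts of \<open>good3\<close> dispose of the four disjuncts of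
  \<open>bad_pair\<close> in order: \<open>{0, 1}\<close> is not even a member,
  \<open>{0, 2, 3, 4}\<close> is cancelled with \<open>{2, 3, 4}\<close> in step 0, and the last two
  cases would make \<open>in_A f\<close> or \<open>in_B f\<close> satisfy
  \<open>split_bad\<close>.\<close>

lemma good3_not_bad:
  assumes "upset f" "small f" "good3 f"
  shows "\<not> bad_pair f"
  using assms unfolding upset_def small_def all_bool_eq good3_def split_bad_def in_A_def in_B_def
  unfolding bad_pair_def steps not_True_eq_False not_False_eq_True
  by (simp only: simp_thms) satx

text \<open>If two four-element sets were outside \<open>f\<close>, every member would contain both
  omitted vertices, and the steps at these would do nothing. All critical faces would then also
  contain the first of the other three vertices, whereas the faces of a bad pair differ in at least
  three vertices.\<close>

lemma bad_one_quad:
  assumes "upset f" "small f" "bad_pair f"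
  shows "one_quad f"
  using assms unfolding upset_def small_def all_bool_eq one_quad_def
  unfolding bad_pair_def steps not_True_eq_False not_False_eq_True
  by (simp only: simp_thms) satx

text \<open>If \<open>{0, 1, 2, 3}\<close> lies outside \<open>f\<close>, all members of \<open>f\<close> contain \<open>4\<close>, which then plays no role.\<close>

lemma bad_link:
  assumes "upset f" "small f" "bad_pair f" "\<not> f True True True True False"
  shows "bad4 (\<lambda>a b c d. f a b c d True)"
  using assms unfolding upset_def small_def all_bool_eq bad4_def
  unfolding bad_pair_def steps not_True_eq_False not_False_eq_True
  by (simp only: simp_thms) satx

text \<open>For a bad pair \<open>x\<close>, \<open>y\<close> the set \<open>y - x\<close> has at
  least two elements. Since \<open>y\<close> survives step 0, \<open>y - {0}\<close> is outside
  \<open>f\<close>, and so is any pair inside \<open>y - x\<close>; the complement of such a pair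
  contains \<open>x\<close> and is therefore in \<open>f\<close>.\<close>

lemma bad_edge:
  assumes "upset f" "small f" "bad_pair f" "quads f"
  shows "\<not> f True True False False False \<and> f False False True True True \<or>
    \<not> f True False True False False \<and> f False True False True True \<or>
    \<not> f True False False True False \<and> f False True True False True \<or>
    \<not> f True False False False True \<and> f False True True True False \<or>
    \<not> f False True True False False \<and> f True False False True True \<or>
    \<not> f False True False True False \<and> f True False True False True \<or>
    \<not> f False True False False True \<and> f True False True True False \<or>
    \<not> f False False True True False \<and> f True True False False True \<or>
    \<not> f False False True False True \<and> f True True False True False \<or>
    \<not> f False False False True True \<and> f True True True False False"
  using assms unfolding upset_def small_def all_bool_eq quads_def
  unfolding bad_pair_def steps not_True_eq_False not_False_eq_True
  by (simp only: simp_thms) satx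

text \<open>The first three orders keep the initial pair and put each other vertex third in turn. If
  \<open>in_A f\<close> is bad for two choices of the third vertex, it contains all singletons and
  pairs, and likewise \<open>in_B f\<close>. Otherwise each is bad for at most one choice, so one of
  the three orders works. In the two exceptional configurations the last order does, because it
  begins with two of the three other vertices.\<close>

lemma good3_exists:
  assumes "upset f" "quads f" "\<not> f True True False False False" "f False False True True True"
  shows "good3 f \<or> good3 (\<lambda>a b c d e. f a b d c e) \<or> good3 (\<lambda>a b c d e. f a b d e c) \<or>
    good3 (\<lambda>a b c d e. f d e a b c)"
  using assms unfolding upset_def quads_def good3_def split_bad_def in_A_def in_B_def
  unfolding all_bool_eq
  by (simp only: simp_thms) satx

text \<open>The six orders begin with the six pairs. A graph with a bad initial pair is either a
  path with three edges, where only the pair of its ends is bad, or a triangle with an isolated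
  vertex, where the three pairs through that vertex are bad. Two graphs of the second kind have a
  bad pair in common, so two graphs never exclude all six pairs.\<close>

lemma bad4_perms:
  "(\<not> bad4 g \<and> \<not> bad4 h) \<or>
   (\<not> bad4 (\<lambda>a b c d. g c d a b) \<and> \<not> bad4 (\<lambda>a b c d. h c d a b)) \<or>
   (\<not> bad4 (\<lambda>a b c d. g a c b d) \<and> \<not> bad4 (\<lambda>a b c d. h a c b d)) \<or>
   (\<not> bad4 (\<lambda>a b c d. g c a d b) \<and> \<not> bad4 (\<lambda>a b c d. h c a d b)) \<or>
   (\<not> bad4 (\<lambda>a b c d. g a c d b) \<and> \<not> bad4 (\<lambda>a b c d. h a c d b)) \<or>
   (\<not> bad4 (\<lambda>a b c d. g c a b d) \<and> \<not> bad4 (\<lambda>a b c d. h c a b d))"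
  unfolding bad4_def by sat

subsection \<open>The strands of the pruning algorithm\<close>

definition pick :: "'a \<Rightarrow> 'a \<Rightarrow> 'a \<Rightarrow> 'a \<Rightarrow> 'a \<Rightarrow> bool \<Rightarrow> bool \<Rightarrow> bool \<Rightarrow> bool \<Rightarrow> bool \<Rightarrow> 'a set"
  where "pick v w x y z a b c d e =
    (if a then {v} else {}) \<union> (if b then {w} else {}) \<union> (if c then {x} else {}) \<union>
    (if d then {y} else {}) \<union> (if e then {z} else {})"

definition ipick :: "bool \<Rightarrow> bool \<Rightarrow> bool \<Rightarrow> bool \<Rightarrow> bool \<Rightarrow> nat set"
  where "ipick = pick 0 1 2 3 4"

definition flip :: "nat \<Rightarrow> nat set \<Rightarrow> nat set"
  where "flip j \<sigma> = (if j \<in> \<sigma> then \<sigma> - {j} else insert j \<sigma>)"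

lemma mem_ipick: "i \<in> ipick a b c d e \<longleftrightarrow> i = 0 \<and> a \<or> i = 1 \<and> b \<or> i = 2 \<and> c \<or> i = 3 \<and> d \<or> i = 4 \<and> e"
  by (simp add: ipick_def pick_def)

lemma mem_flip: "i \<in> flip j \<sigma> \<longleftrightarrow> (if i = j then i \<notin> \<sigma> else i \<in> \<sigma>)"
  by (simp add: flip_def)

lemma flip_ipick:
  "flip 0 (ipick a b c d e) = ipick (\<not> a) b c d e"
  "flip 1 (ipick a b c d e) = ipick a (\<not> b) c d e"
  "flip 2 (ipick a b c d e) = ipick a b (\<not> c) d e"
  "flip 3 (ipick a b c d e) = ipick a b c (\<not> d) e"
  "flip 4 (ipick a b c d e) = ipick a b c d (\<not> e)"
  by (simp_all add: set_eq_iff mem_flip mem_ipick)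

lemma ipick_eq:
  assumes "\<sigma> \<subseteq> {..<5}"
  shows "\<sigma> = ipick (0 \<in> \<sigma>) (1 \<in> \<sigma>) (2 \<in> \<sigma>) (3 \<in> \<sigma>) (4 \<in> \<sigma>)"
proof -
  have "i = 0 \<or> i = 1 \<or> i = 2 \<or> i = 3 \<or> i = 4" if "i \<in> \<sigma>" for i
    using subsetD[OF assms that] by auto
  then show ?thesis unfolding set_eq_iff mem_ipick by blast
qed

lemma alive_flip:
  assumes "j < length ms"
  shows "\<sigma> \<in> alive ms (Suc j) \<longleftrightarrow>
    \<sigma> \<in> alive ms j \<and> \<not> (flip j \<sigma> \<in> alive ms j \<and> mdeg ms (flip j \<sigma>) = mdeg ms \<sigma>)"
proof (cases "j \<in> \<sigma>")
  case True
  then have ins: "insert j (\<sigma> - {j}) = \<sigma>" by blast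
  have "\<sigma> \<in> (\<Union>\<tau>\<in>eligible ms j. {\<tau>, insert j \<tau>}) \<longleftrightarrow> \<sigma> - {j} \<in> eligible ms j"
  proof
    assume "\<sigma> \<in> (\<Union>\<tau>\<in>eligible ms j. {\<tau>, insert j \<tau>})"
    then obtain \<tau> where \<tau>: "\<tau> \<in> eligible ms j" "\<sigma> = \<tau> \<or> \<sigma> = insert j \<tau>" by blast
    then have "j \<notin> \<tau>" by (simp add: eligible_def)
    then have "\<sigma> - {j} = \<tau>" using True \<tau>(2) by blast
    then show "\<sigma> - {j} \<in> eligible ms j" using \<tau>(1) by simp
  next
    assume "\<sigma> - {j} \<in> eligible ms j"
    then show "\<sigma> \<in> (\<Union>\<tau>\<in>eligible ms j. {\<tau>, insert j \<tau>})" using ins by blast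
  qed
  moreover have "\<sigma> - {j} \<in> eligible ms j \<longleftrightarrow>
      \<sigma> - {j} \<in> alive ms j \<and> \<sigma> \<in> alive ms j \<and> mdeg ms (\<sigma> - {j}) = mdeg ms \<sigma>"
    using True by (simp add: eligible_def insert_absorb)
  moreover have "flip j \<sigma> = \<sigma> - {j}" using True by (simp add: flip_def)
  ultimately show ?thesis unfolding alive_Suc[OF assms] Diff_iff by metis
next
  case False
  then have "\<sigma> \<in> (\<Union>\<tau>\<in>eligible ms j. {\<tau>, insert j \<tau>}) \<longleftrightarrow> \<sigma> \<in> eligible ms j" by blast
  moreover have "\<sigma> \<in> eligible ms j \<longleftrightarrow>
      \<sigma> \<in> alive ms j \<and> insert j \<sigma> \<in> alive ms j \<and> mdeg ms \<sigma> = mdeg ms (insert j \<sigma>)"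
    using False by (simp add: eligible_def)
  moreover have "flip j \<sigma> = insert j \<sigma>" using False by (simp add: flip_def)
  ultimately show ?thesis unfolding alive_Suc[OF assms] Diff_iff by metis
qed

text \<open>The minimum allows five steps whatever the number of generators.\<close>

definition alive_strand :: "'n mon list \<Rightarrow> 'n mdegree \<Rightarrow> nat \<Rightarrow> nat set \<Rightarrow> bool"
  where "alive_strand ms \<alpha> j \<sigma> \<longleftrightarrow> \<sigma> \<in> alive ms (min j (length ms)) \<and> mdeg ms \<sigma> = \<alpha>"

lemma alive_strand_Suc:
  "alive_strand ms \<alpha> (Suc j) \<sigma> \<longleftrightarrow> alive_strand ms \<alpha> j \<sigma> \<and> \<not> alive_strand ms \<alpha> j (flip j \<sigma>)"
proof (cases "j < length ms")
  case True
  then show ?thesis using alive_flip[OF True, of \<sigma>] by (auto simp: alive_strand_def min_def Suc_le_eq)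
next
  case False
  \<comment> \<open>Beyond the last generator \<open>flip\<close> adds a number that is not a
    vertex, so no partner exists and the step is void.\<close>
  have "flip j \<sigma> \<notin> alive ms (length ms)" if "\<sigma> \<in> alive ms (length ms)"
    using that False by (auto simp: alive_def flip_def)
  then show ?thesis using False by (auto simp: alive_strand_def min_def)
qed

definition strand_fam :: "'n mon list \<Rightarrow> 'n mdegree \<Rightarrow> fam"
  where "strand_fam ms \<alpha> a b c d e \<longleftrightarrow>
    ipick a b c d e \<subseteq> {..<length ms} \<and> mdeg ms (ipick a b c d e) = \<alpha>"

text \<open>Partners must have the same multidegree, so each step acts on every multidegree
  separately and becomes \<open>prune_i\<close> on its family.\<close>

lemma crit_strand_fam:
  assumes "length ms \<le> 5"
  shows "ipick a b c d e \<in> critical_faces ms \<and> mdeg ms (ipick a b c d e) = \<alpha> \<longleftrightarrow>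
    crit (strand_fam ms \<alpha>) a b c d e"
proof -
  have 0: "alive_strand ms \<alpha> 0 (ipick a b c d e) = strand_fam ms \<alpha> a b c d e" for a b c d e
    by (auto simp: alive_strand_def strand_fam_def alive_def)
  have 1: "alive_strand ms \<alpha> 1 (ipick a b c d e) = prune_0 (strand_fam ms \<alpha>) a b c d e" for a b c d e
    using alive_strand_Suc[of ms \<alpha> 0] by (simp add: 0 prune_0_def flip_ipick)
  have 2: "alive_strand ms \<alpha> 2 (ipick a b c d e) = prune_1 (prune_0 (strand_fam ms \<alpha>)) a b c d e" for a b c d e
    using alive_strand_Suc[of ms \<alpha> 1 "ipick a b c d e"]
    unfolding flip_ipick 1 prune_1_def[symmetric] by (simp add: numeral_eq_Suc)
  have 3: "alive_strand ms \<alpha> 3 (ipick a b c d e) = prune_2 (prune_1 (prune_0 (strand_fam ms \<alpha>))) a b c d e" for a b c d e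
    using alive_strand_Suc[of ms \<alpha> 2 "ipick a b c d e"]
    unfolding flip_ipick 2 prune_2_def[symmetric] by (simp add: numeral_eq_Suc)
  have 4: "alive_strand ms \<alpha> 4 (ipick a b c d e) = prune_3 (prune_2 (prune_1 (prune_0 (strand_fam ms \<alpha>)))) a b c d e" for a b c d e
    using alive_strand_Suc[of ms \<alpha> 3 "ipick a b c d e"]
    unfolding flip_ipick 3 prune_3_def[symmetric] by (simp add: numeral_eq_Suc)
  have 5: "alive_strand ms \<alpha> 5 (ipick a b c d e) = crit (strand_fam ms \<alpha>) a b c d e" for a b c d e
    using alive_strand_Suc[of ms \<alpha> 4 "ipick a b c d e"]
    unfolding flip_ipick 4 prune_4_def[symmetric] crit_def by (simp add: numeral_eq_Suc)
  show ?thesis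
    using 5[of a b c d e] assms unfolding alive_strand_def critical_eq_alive by (simp add: min_absorb2)
qed

section \<open>Multidegrees and the generators dividing them\<close>

definition antichain :: "'n mon list \<Rightarrow> bool"
  where "antichain ms \<longleftrightarrow>
    (\<forall>i<length ms. \<forall>j<length ms. mon_exp (ms ! i) \<le> mon_exp (ms ! j) \<longrightarrow> i = j)"

lemma mdeg_insert_eq_iff:
  assumes "finite \<sigma>"
  shows "mdeg ms (insert i \<sigma>) = mdeg ms \<sigma> \<longleftrightarrow> mon_exp (ms ! i) \<le> mdeg ms \<sigma>"
proof -
  have "mdeg ms (insert i \<sigma>) = mdeg ms \<sigma> \<longleftrightarrow> mdeg ms (insert i \<sigma>) \<le> mdeg ms \<sigma>"
    using mdeg_mono[of "insert i \<sigma>" \<sigma> ms] assms by (auto simp: antisym subset_insertI)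
  also have "\<dots> \<longleftrightarrow> mon_exp (ms ! i) \<le> mdeg ms \<sigma>"
    using mdeg_le_iff[of \<sigma> ms "mdeg ms \<sigma>"] mdeg_le_iff[of "insert i \<sigma>" ms "mdeg ms \<sigma>"] assms by simp
  finally show ?thesis .
qed

lemma mdeg_squeeze:
  assumes "mdeg ms \<sigma> = \<alpha>" "\<sigma> \<subseteq> \<tau>" "finite \<tau>" "\<And>i. i \<in> \<tau> \<Longrightarrow> mon_exp (ms ! i) \<le> \<alpha>"
  shows "mdeg ms \<tau> = \<alpha>"
proof (rule antisym)
  have "finite \<sigma>" using assms(2,3) finite_subset by blast
  then show "mdeg ms \<tau> \<le> \<alpha>"
    using mdeg_le_iff[of \<tau> ms \<alpha>] mdeg_nonneg[of \<sigma> ms] assms by auto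
  show "\<alpha> \<le> mdeg ms \<tau>" using mdeg_mono[OF assms(3,2), of ms] assms(1) by simp
qed

lemma mon_exp_le_mdeg: "finite \<sigma> \<Longrightarrow> i \<in> \<sigma> \<Longrightarrow> mon_exp (ms ! i) \<le> mdeg ms \<sigma>"
  using mdeg_le_iff[of \<sigma> ms "mdeg ms \<sigma>"] by simp

definition drop_fam :: "nat \<Rightarrow> fam \<Rightarrow> fam4"
  where "drop_fam m F = (if m = 0 then F False else if m = 1 then (\<lambda>a. F a False)
    else if m = 2 then (\<lambda>a b. F a b False) else if m = 3 then (\<lambda>a b c. F a b c False)
    else (\<lambda>a b c d. F a b c d False))"

lemma less_5_cases: "(m::nat) < 5 \<Longrightarrow> m = 0 \<or> m = 1 \<or> m = 2 \<or> m = 3 \<or> m = 4"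
  by arith

lemma card_ipick:
  "card (ipick a b c d e) = of_bool a + of_bool b + of_bool c + of_bool d + of_bool e"
  by (cases a; cases b; cases c; cases d; cases e; simp add: ipick_def pick_def)

lemma ipick_mono:
  "ipick a b c d e \<subseteq> ipick True b c d e" "ipick a b c d e \<subseteq> ipick a True c d e"
  "ipick a b c d e \<subseteq> ipick a b True d e" "ipick a b c d e \<subseteq> ipick a b c True e"
  "ipick a b c d e \<subseteq> ipick a b c d True"
  by (auto simp: mem_ipick)

lemma ipick_sub: "ipick a b c d e \<subseteq> {..<5}"
  by (auto simp: mem_ipick)

lemma ipick_quads:
  "ipick False True True True True = {..<5} - {0}" "ipick True False True True True = {..<5} - {1}"
  "ipick True True False True True = {..<5} - {2}" "ipick True True True False True = {..<5} - {3}"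
  "ipick True True True True False = {..<5} - {4}"
  unfolding set_eq_iff mem_ipick Diff_iff lessThan_iff singleton_iff by (intro allI; arith)+

lemma finite_ipick [simp]: "finite (ipick a b c d e)"
  by (simp add: ipick_def pick_def)

lemma rel5_lex:
  assumes "lex_greater q (ipick a b c d e) (ipick a' b' c' d' e')"
    "card (ipick a' b' c' d' e') = Suc (card (ipick a b c d e))"
  shows "rel5 a b c d e a' b' c' d' e'"
proof -
  obtain k where k: "k \<in> ipick a b c d e" "k \<notin> ipick a' b' c' d' e'"
    "\<And>l. l < k \<Longrightarrow> l \<in> ipick a b c d e \<longleftrightarrow> l \<in> ipick a' b' c' d' e'"
    using assms(1) by (auto simp: lex_greater_def)
  have "a \<and> \<not> a' \<or> (a = a' \<and> (b \<and> \<not> b' \<or> (b = b' \<and> (c \<and> \<not> c' \<or> (c = c' \<and> (d \<and> \<not> d' \<or> (d = d' \<and> e \<and> \<not> e')))))))"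
    using k(1,2) k(3)[of 0] k(3)[of 1] k(3)[of 2] k(3)[of 3] unfolding mem_ipick by auto
  then show ?thesis using assms(2) unfolding rel5_def card_ipick by blast
qed

locale pruning_order =
  fixes ms :: "'n::finite mon list"
  assumes len: "length ms \<le> 5" and anti: "antichain ms"
begin

definition support :: "'n mdegree \<Rightarrow> nat set"
  where "support \<alpha> = {i. i < length ms \<and> mon_exp (ms ! i) \<le> \<alpha>}"

lemma finite_support [simp]: "finite (support \<alpha>)"
  by (simp add: support_def)

lemma subset_support: "\<sigma> \<subseteq> {..<length ms} \<Longrightarrow> mdeg ms \<sigma> = \<alpha> \<Longrightarrow> \<sigma> \<subseteq> support \<alpha>"
  using mon_exp_le_mdeg[of \<sigma> _ ms] finite_subset[of \<sigma> "{..<length ms}"] by (auto simp: support_def)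

lemma mdeg_up: "mdeg ms \<sigma> = \<alpha> \<Longrightarrow> \<sigma> \<subseteq> \<tau> \<Longrightarrow> \<tau> \<subseteq> support \<alpha> \<Longrightarrow> mdeg ms \<tau> = \<alpha>"
proof -
  assume a: "mdeg ms \<sigma> = \<alpha>" "\<sigma> \<subseteq> \<tau>" "\<tau> \<subseteq> support \<alpha>"
  have "finite \<tau>" by (rule finite_subset[OF a(3) finite_support])
  then show "mdeg ms \<tau> = \<alpha>" using a by (intro mdeg_squeeze[OF a(1,2)]) (auto simp: support_def)
qed

lemma support_singleton:
  assumes "i < length ms"
  shows "support (mdeg ms {i}) = {i}"
proof -
  have "mdeg ms {i} = mon_exp (ms ! i)"
    by (auto simp: mdeg_def mon_exp_def fun_eq_iff)
  then show ?thesis using anti assms by (auto simp: support_def antichain_def)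
qed

text \<open>The bound is 1 and not 0 because the ideal may be the whole ring, with 1 as its single
  generator.\<close>

lemma support_empty_degree:
  assumes "mdeg ms {} = \<alpha>"
  shows "card (support \<alpha>) \<le> 1"
proof -
  have "i = j" if "i \<in> support \<alpha>" "j \<in> support \<alpha>" for i j
  proof -
    have "mdeg ms {j} = \<alpha>" by (rule mdeg_up[OF assms]) (use that in auto)
    then have "support \<alpha> = {j}" using support_singleton that by (auto simp: support_def)
    then show ?thesis using that by auto
  qed
  then show ?thesis by (metis card_le_Suc0_iff_eq finite_support One_nat_def)
qed

text \<open>No generator divides another, so if \<open>x\<close> were a single vertex, the support
  would be that vertex and \<open>y\<close> would be empty. Hence \<open>y\<close> has at least
  three vertices, and the first difference supplies a fourth one in \<open>x\<close>.\<close>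

lemma lex_bad_support:
  assumes x: "x \<in> critical_faces ms" "mdeg ms x = \<alpha>" and y: "y \<in> critical_faces ms" "mdeg ms y = \<alpha>"
    and c: "card y = Suc (card x)" and l: "lex_greater (length ms) x y"
  shows "4 \<le> card (support \<alpha>)"
proof -
  have xy: "x \<subseteq> {..<length ms}" "y \<subseteq> {..<length ms}" using x y by (auto simp: critical_faces_def)
  have xs: "x \<subseteq> support \<alpha>" and ys: "y \<subseteq> support \<alpha>" using subset_support xy x y by auto
  have fin: "finite x" "finite y" using xy finite_subset by auto
  obtain k where k: "k \<in> x" "k \<notin> y" using l by (auto simp: lex_greater_def)
  have "card x \<noteq> 1"
  proof
    assume "card x = 1"
    then have "x = {k}" using k by (auto simp: card_1_singleton_iff)
    then have "support \<alpha> = {k}" using support_singleton[of k] x(2) xy by auto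
    then have "y = {}" using ys k by auto
    then show False using c by simp
  qed
  moreover have "card x \<noteq> 0" using k fin by auto
  ultimately have "3 \<le> card y" using c by simp
  moreover have "card (insert k y) \<le> card (support \<alpha>)"
    using ys xs k by (intro card_mono) auto
  ultimately show ?thesis using k fin by simp
qed

lemma strand_up:
  assumes "strand_fam ms \<alpha> a b c d e" "ipick a b c d e \<subseteq> ipick a' b' c' d' e'"
    "ipick a' b' c' d' e' \<subseteq> support \<alpha>"
  shows "strand_fam ms \<alpha> a' b' c' d' e'"
proof -
  have "support \<alpha> \<subseteq> {..<length ms}" by (auto simp: support_def)
  then show ?thesis using assms mdeg_up unfolding strand_fam_def by blast
qed

lemma strand_support: "strand_fam ms \<alpha> a b c d e \<Longrightarrow> ipick a b c d e \<subseteq> support \<alpha>"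
  unfolding strand_fam_def using subset_support by blast

lemma strand_small:
  assumes "4 \<le> card (support \<alpha>)"
  shows "small (strand_fam ms \<alpha>)"
proof -
  have "\<not> strand_fam ms \<alpha> a b c d e" if "card (ipick a b c d e) \<le> 1" for a b c d e
  proof
    assume F: "strand_fam ms \<alpha> a b c d e"
    from that consider "ipick a b c d e = {}" | i where "ipick a b c d e = {i}"
      using finite_ipick[of a b c d e] by (metis One_nat_def card_0_eq card_1_singletonE le_Suc_eq le_zero_eq)
    then show False
    proof cases
      case 1
      then show ?thesis using F assms support_empty_degree[of \<alpha>] by (simp add: strand_fam_def)
    next
      case (2 i)
      then have "support \<alpha> = {i}" using F support_singleton[of i] by (auto simp: strand_fam_def)
      then show ?thesis using assms by simp
    qed
  qed
  then show ?thesis unfolding small_def by (simp add: card_ipick)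
qed

lemma full_support:
  assumes "length ms = 5"
  shows "support (mdeg ms {..<5}) = {..<5}"
proof (intro equalityI subsetI)
  fix i :: nat assume "i \<in> {..<5}"
  then show "i \<in> support (mdeg ms {..<5})"
    using mon_exp_le_mdeg[of "{..<5}" i ms] assms by (simp add: support_def)
qed (simp add: support_def assms)

lemma full_strand_upset:
  assumes "length ms = 5"
  shows "upset (strand_fam ms (mdeg ms {..<5}))"
proof -
  have up: "ipick a b c d e \<subseteq> support (mdeg ms {..<5})" for a b c d e
    unfolding full_support[OF assms] by (rule ipick_sub)
  show ?thesis
    unfolding upset_def
    by (intro allI impI conjI; erule strand_up[OF _ ipick_mono(1) up] strand_up[OF _ ipick_mono(2) up]
      strand_up[OF _ ipick_mono(3) up] strand_up[OF _ ipick_mono(4) up] strand_up[OF _ ipick_mono(5) up])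
qed

lemma full_strand_small:
  assumes "length ms = 5"
  shows "small (strand_fam ms (mdeg ms {..<5}))"
  by (rule strand_small) (simp add: full_support[OF assms])

text \<open>With four generators the second case occurs with \<open>m = 4\<close>, which is then not
  a vertex. In this way four and five generators are treated together.\<close>

lemma support_cases:
  assumes "4 \<le> card (support \<alpha>)"
  obtains "length ms = 5" "support \<alpha> = {..<5}"
  | m where "m < 5" "support \<alpha> = {..<5} - {m}"
proof -
  have sub: "support \<alpha> \<subseteq> {..<5}" using len by (auto simp: support_def)
  show ?thesis
  proof (cases "support \<alpha> = {..<5}")
    case True
    then have "4 \<in> support \<alpha>" by auto
    then have "length ms = 5" using len by (simp add: support_def)
    then show ?thesis using that(1) True by blast
  next
    case False
    then obtain m where m: "m < 5" "m \<notin> support \<alpha>" using sub by blast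
    then have "support \<alpha> \<subseteq> {..<5} - {m}" using sub by blast
    moreover have "card ({..<5} - {m}) = 4" using m by simp
    ultimately have "support \<alpha> = {..<5} - {m}"
      using assms by (intro card_seteq) auto
    then show ?thesis using that(2) m by blast
  qed
qed

text \<open>A violating pair lies in the support of its multidegree. If the support omits
  \<open>m\<close>, no face of that multidegree contains \<open>m\<close>, and the four-vertex
  analysis applies; the inequality of degrees says that the support is closed whenever
  \<open>m\<close> is a vertex at all.\<close>

lemma lex_good_or_bad:
  assumes "\<not> lex_good ms"
  obtains "length ms = 5" "bad_pair (strand_fam ms (mdeg ms {..<5}))"
  | m where "m < 5" "{..<5} - {m} \<subseteq> {..<length ms}"
      "m < length ms \<longrightarrow> mdeg ms {..<5} \<noteq> mdeg ms ({..<5} - {m})"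
      "bad4 (drop_fam m (strand_fam ms (mdeg ms ({..<5} - {m}))))"
      "triples4 (drop_fam m (strand_fam ms (mdeg ms ({..<5} - {m}))))"
proof -
  obtain x y where x: "x \<in> critical_faces ms" and y: "y \<in> critical_faces ms" "mdeg ms y = mdeg ms x"
    and c: "card y = Suc (card x)" and l: "lex_greater (length ms) x y"
    using assms unfolding lex_good_def by metis
  define \<alpha> where "\<alpha> = mdeg ms x"
  define F where "F = strand_fam ms \<alpha>"
  have x5: "x \<subseteq> {..<5}" and y5: "y \<subseteq> {..<5}" using x y len by (auto simp: critical_faces_def)
  obtain a b cc d e where xe: "x = ipick a b cc d e" using ipick_eq[OF x5] by metis
  obtain a' b' c' d' e' where ye: "y = ipick a' b' c' d' e'" using ipick_eq[OF y5] by metis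
  have cx: "crit F a b cc d e" and cy: "crit F a' b' c' d' e'"
    unfolding F_def crit_strand_fam[OF len, symmetric] \<alpha>_def using x y xe ye by simp_all
  have rel: "rel5 a b cc d e a' b' c' d' e'"
    using rel5_lex l c unfolding xe ye by blast
  have card4: "4 \<le> card (support \<alpha>)"
    using lex_bad_support[OF x _ y(1) _ c l, of \<alpha>] y(2) by (simp add: \<alpha>_def)
  have small: "small F" unfolding F_def by (rule strand_small[OF card4])
  have xs: "x \<subseteq> support \<alpha>" and ys: "y \<subseteq> support \<alpha>"
    using subset_support x y by (auto simp: critical_faces_def \<alpha>_def)
  have deg_support: "mdeg ms (support \<alpha>) = \<alpha>"
    by (rule mdeg_up[OF _ xs]) (simp_all add: \<alpha>_def)
  from card4 show ?thesis
  proof (cases rule: support_cases)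
    case 1
    then have F: "F = strand_fam ms (mdeg ms {..<5})" using deg_support by (simp add: F_def)
    have "bad_pair F"
      by (rule rel5_bad[OF _ small cx cy rel]) (simp add: F full_strand_upset 1)
    then show ?thesis using that(1) 1 F by simp
  next
    case (2 m)
    have F: "F = strand_fam ms (mdeg ms ({..<5} - {m}))" using deg_support unfolding 2(2) F_def by simp
    have m_out: "m \<notin> x" "m \<notin> y" using xs ys unfolding 2(2) by blast+
    have van: "\<not> F a b c d e" if "m \<in> ipick a b c d e" for a b c d e
      using strand_support[of \<alpha> a b c d e] that unfolding 2(2) F_def by blast
    define G where "G = drop_fam m F"
    have up: "F p q r s t \<Longrightarrow> ipick p q r s t \<subseteq> ipick p' q' r' s' t' \<Longrightarrow> m \<notin> ipick p' q' r' s' t' \<Longrightarrow> F p' q' r' s' t'"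
      for p q r s t p' q' r' s' t'
    proof -
      assume a: "F p q r s t" "ipick p q r s t \<subseteq> ipick p' q' r' s' t'" "m \<notin> ipick p' q' r' s' t'"
      have "ipick p' q' r' s' t' \<subseteq> support \<alpha>" unfolding 2(2) using a(3) ipick_sub[of p' q' r' s' t'] by blast
      then show "F p' q' r' s' t'" unfolding F_def by (rule strand_up[OF a(1)[unfolded F_def] a(2)])
    qed
    note m5 = less_5_cases[OF 2(1)]
    have u0: "F True b c d e" if "F a b c d e" "m \<noteq> 0" for a b c d e
    proof (rule up[OF that(1) ipick_mono(1)])
      have "m \<notin> ipick a b c d e" using van that(1) by blast
      then show "m \<notin> ipick True b c d e" using that(2) unfolding mem_ipick by blast
    qed
    have u1: "F a True c d e" if "F a b c d e" "m \<noteq> 1" for a b c d e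
    proof (rule up[OF that(1) ipick_mono(2)])
      have "m \<notin> ipick a b c d e" using van that(1) by blast
      then show "m \<notin> ipick a True c d e" using that(2) unfolding mem_ipick by blast
    qed
    have u2: "F a b True d e" if "F a b c d e" "m \<noteq> 2" for a b c d e
    proof (rule up[OF that(1) ipick_mono(3)])
      have "m \<notin> ipick a b c d e" using van that(1) by blast
      then show "m \<notin> ipick a b True d e" using that(2) unfolding mem_ipick by blast
    qed
    have u3: "F a b c True e" if "F a b c d e" "m \<noteq> 3" for a b c d e
    proof (rule up[OF that(1) ipick_mono(4)])
      have "m \<notin> ipick a b c d e" using van that(1) by blast
      then show "m \<notin> ipick a b c True e" using that(2) unfolding mem_ipick by blast
    qed
    have u4: "F a b c d True" if "F a b c d e" "m \<noteq> 4" for a b c d e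
    proof (rule up[OF that(1) ipick_mono(5)])
      have "m \<notin> ipick a b c d e" using van that(1) by blast
      then show "m \<notin> ipick a b c d True" using that(2) unfolding mem_ipick by blast
    qed
    have "upset4 G"
      using m5
    proof (elim disjE)
      assume m: "m = 0"
      have n: "m \<noteq> 1" "m \<noteq> 2" "m \<noteq> 3" "m \<noteq> 4" and G: "G = F False" by (simp_all add: m G_def drop_fam_def)
      show ?thesis unfolding upset4_def G using u1[OF _ n(1)] u2[OF _ n(2)] u3[OF _ n(3)] u4[OF _ n(4)] by blast
    next
      assume m: "m = 1"
      have n: "m \<noteq> 0" "m \<noteq> 2" "m \<noteq> 3" "m \<noteq> 4" and G: "G = (\<lambda>a. F a False)" by (simp_all add: m G_def drop_fam_def)
      show ?thesis unfolding upset4_def G using u0[OF _ n(1)] u2[OF _ n(2)] u3[OF _ n(3)] u4[OF _ n(4)] by blast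
    next
      assume m: "m = 2"
      have n: "m \<noteq> 0" "m \<noteq> 1" "m \<noteq> 3" "m \<noteq> 4" and G: "G = (\<lambda>a b. F a b False)" by (simp_all add: m G_def drop_fam_def)
      show ?thesis unfolding upset4_def G using u0[OF _ n(1)] u1[OF _ n(2)] u3[OF _ n(3)] u4[OF _ n(4)] by blast
    next
      assume m: "m = 3"
      have n: "m \<noteq> 0" "m \<noteq> 1" "m \<noteq> 2" "m \<noteq> 4" and G: "G = (\<lambda>a b c. F a b c False)" by (simp_all add: m G_def drop_fam_def)
      show ?thesis unfolding upset4_def G using u0[OF _ n(1)] u1[OF _ n(2)] u2[OF _ n(3)] u4[OF _ n(4)] by blast
    next
      assume m: "m = 4"
      have n: "m \<noteq> 0" "m \<noteq> 1" "m \<noteq> 2" "m \<noteq> 3" and G: "G = (\<lambda>a b c d. F a b c d False)" by (simp_all add: m G_def drop_fam_def)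
      show ?thesis unfolding upset4_def G using u0[OF _ n(1)] u1[OF _ n(2)] u2[OF _ n(3)] u3[OF _ n(4)] by blast
    qed
    moreover have "small4 G"
      using m5 small unfolding small4_def small_def G_def drop_fam_def by (elim disjE) simp_all
    moreover obtain p q r s p' q' r' s' where "crit4 G p q r s" "crit4 G p' q' r' s'" "rel4 p q r s p' q' r' s'"
      using m5
    proof (elim disjE)
      assume m: "m = 0"
      then have f: "a = False" "a' = False" using m_out unfolding xe ye mem_ipick by simp_all
      have G: "G = F False" by (simp add: m G_def drop_fam_def)
      have v: "\<not> F True b c d e" for b c d e by (rule van) (simp add: m mem_ipick)
      have "crit4 G b cc d e" "crit4 G b' c' d' e'"
        using cx cy unfolding f G by (simp_all only: crit_miss0[of F, OF v])
      moreover have "rel4 b cc d e b' c' d' e'" using rel unfolding f rel4_def rel5_def by simp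
      ultimately show ?thesis by (rule that)
    next
      assume m: "m = 1"
      then have f: "b = False" "b' = False" using m_out unfolding xe ye mem_ipick by simp_all
      have G: "G = (\<lambda>a. F a False)" by (simp add: m G_def drop_fam_def)
      have v: "\<not> F a True c d e" for a c d e by (rule van) (simp add: m mem_ipick)
      have "crit4 G a cc d e" "crit4 G a' c' d' e'"
        using cx cy unfolding f G by (simp_all only: crit_miss1[of F, OF v])
      moreover have "rel4 a cc d e a' c' d' e'" using rel unfolding f rel4_def rel5_def by simp
      ultimately show ?thesis by (rule that)
    next
      assume m: "m = 2"
      then have f: "cc = False" "c' = False" using m_out unfolding xe ye mem_ipick by simp_all
      have G: "G = (\<lambda>a b. F a b False)" by (simp add: m G_def drop_fam_def)
      have v: "\<not> F a b True d e" for a b d e by (rule van) (simp add: m mem_ipick)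
      have "crit4 G a b d e" "crit4 G a' b' d' e'"
        using cx cy unfolding f G by (simp_all only: crit_miss2[of F, OF v])
      moreover have "rel4 a b d e a' b' d' e'" using rel unfolding f rel4_def rel5_def by simp
      ultimately show ?thesis by (rule that)
    next
      assume m: "m = 3"
      then have f: "d = False" "d' = False" using m_out unfolding xe ye mem_ipick by simp_all
      have G: "G = (\<lambda>a b c. F a b c False)" by (simp add: m G_def drop_fam_def)
      have v: "\<not> F a b c True e" for a b c e by (rule van) (simp add: m mem_ipick)
      have "crit4 G a b cc e" "crit4 G a' b' c' e'"
        using cx cy unfolding f G by (simp_all only: crit_miss3[of F, OF v])
      moreover have "rel4 a b cc e a' b' c' e'" using rel unfolding f rel4_def rel5_def by simp
      ultimately show ?thesis by (rule that)
    next
      assume m: "m = 4"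
      then have f: "e = False" "e' = False" using m_out unfolding xe ye mem_ipick by simp_all
      have G: "G = (\<lambda>a b c d. F a b c d False)" by (simp add: m G_def drop_fam_def)
      have v: "\<not> F a b c d True" for a b c d by (rule van) (simp add: m mem_ipick)
      have "crit4 G a b cc d" "crit4 G a' b' c' d'"
        using cx cy unfolding f G by (simp_all only: crit_miss4[of F, OF v])
      moreover have "rel4 a b cc d a' b' c' d'" using rel unfolding f rel4_def rel5_def by simp
      ultimately show ?thesis by (rule that)
    qed
    ultimately have bt: "bad4 G" "triples4 G" using rel4_bad by blast+
    have "support \<alpha> \<subseteq> {..<length ms}" by (auto simp: support_def)
    then have sub: "{..<5} - {m} \<subseteq> {..<length ms}" unfolding 2(2) .
    have neq: "m < length ms \<longrightarrow> mdeg ms {..<5} \<noteq> mdeg ms ({..<5} - {m})"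
    proof (intro impI notI)
      assume a: "m < length ms" "mdeg ms {..<5} = mdeg ms ({..<5} - {m})"
      have "mdeg ms {..<5} = \<alpha>" using a(2) deg_support unfolding 2(2) by simp
      then have "mon_exp (ms ! m) \<le> \<alpha>"
        using mon_exp_le_mdeg[of "{..<5}" m ms] 2(1) by simp
      then have "m \<in> support \<alpha>" using a(1) by (simp add: support_def)
      then show False unfolding 2(2) by simp
    qed
    show ?thesis
      by (rule that(2)[OF 2(1) sub neq bt(1)[unfolded G_def F] bt(2)[unfolded G_def F]])
  qed
qed

lemma triples4_drop:
  assumes "m < 5" "w < 5" "w \<noteq> m" "triples4 (drop_fam m (strand_fam ms \<alpha>))"
  shows "mdeg ms ({..<5} - {m} - {w}) = \<alpha>"
proof -
  have sets: "{..<5} - {m} - {w} =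
      ipick (m \<noteq> 0 \<and> w \<noteq> 0) (m \<noteq> 1 \<and> w \<noteq> 1) (m \<noteq> 2 \<and> w \<noteq> 2) (m \<noteq> 3 \<and> w \<noteq> 3) (m \<noteq> 4 \<and> w \<noteq> 4)"
  proof (intro equalityI subsetI)
    fix i assume "i \<in> {..<5} - {m} - {w}"
    then have "i < 5" "i \<noteq> m" "i \<noteq> w" by auto
    then show "i \<in> ipick (m \<noteq> 0 \<and> w \<noteq> 0) (m \<noteq> 1 \<and> w \<noteq> 1) (m \<noteq> 2 \<and> w \<noteq> 2) (m \<noteq> 3 \<and> w \<noteq> 3) (m \<noteq> 4 \<and> w \<noteq> 4)"
      using less_5_cases[of i] unfolding mem_ipick by auto
  next
    fix i assume "i \<in> ipick (m \<noteq> 0 \<and> w \<noteq> 0) (m \<noteq> 1 \<and> w \<noteq> 1) (m \<noteq> 2 \<and> w \<noteq> 2) (m \<noteq> 3 \<and> w \<noteq> 3) (m \<noteq> 4 \<and> w \<noteq> 4)"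
    then have "i < 5" "i \<noteq> m" "i \<noteq> w" unfolding mem_ipick by auto
    then show "i \<in> {..<5} - {m} - {w}" by simp
  qed
  have "strand_fam ms \<alpha> (m \<noteq> 0 \<and> w \<noteq> 0) (m \<noteq> 1 \<and> w \<noteq> 1) (m \<noteq> 2 \<and> w \<noteq> 2) (m \<noteq> 3 \<and> w \<noteq> 3) (m \<noteq> 4 \<and> w \<noteq> 4)"
    using less_5_cases[OF assms(1)] less_5_cases[OF assms(2)] assms(3,4)
    by (elim disjE) (simp_all add: triples4_def drop_fam_def)
  then show ?thesis unfolding sets strand_fam_def by (rule conjunct2)
qed

lemma two_closed_lex_good:
  assumes l: "length ms = 5" and uv: "u < 5" "v < 5" "u \<noteq> v"
    and u: "mdeg ms {..<5} \<noteq> mdeg ms ({..<5} - {u})" and v: "mdeg ms {..<5} \<noteq> mdeg ms ({..<5} - {v})"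
  shows "lex_good ms"
proof (rule ccontr)
  assume "\<not> lex_good ms"
  then show False
  proof (cases rule: lex_good_or_bad)
    case 1
    define F where "F = strand_fam ms (mdeg ms {..<5})"
    have "one_quad F" unfolding F_def
      by (rule bad_one_quad[OF full_strand_upset[OF l] full_strand_small[OF l] 1(2)])
    have q: "F False True True True True \<longleftrightarrow> mdeg ms ({..<5} - {0}) = mdeg ms {..<5}"
      "F True False True True True \<longleftrightarrow> mdeg ms ({..<5} - {1}) = mdeg ms {..<5}"
      "F True True False True True \<longleftrightarrow> mdeg ms ({..<5} - {2}) = mdeg ms {..<5}"
      "F True True True False True \<longleftrightarrow> mdeg ms ({..<5} - {3}) = mdeg ms {..<5}"
      "F True True True True False \<longleftrightarrow> mdeg ms ({..<5} - {4}) = mdeg ms {..<5}"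
      unfolding F_def strand_fam_def ipick_quads using l by auto
    show False
      using less_5_cases[OF uv(1)] less_5_cases[OF uv(2)] \<open>one_quad F\<close> u v uv(3)
      unfolding one_quad_def q by (elim disjE) simp_all
  next
    case (2 m)
    \<comment> \<open>One of the two closed sets omits a \<open>w\<close> other than
      \<open>m\<close>. By \<open>triples4\<close>, leaving out \<open>w\<close> as well does not
      change the least common multiple of the generators other than \<open>m\<close>, so
      \<open>w\<close> divides that of the remaining ones, against closedness.\<close>
    obtain w where w: "w < 5" "w \<noteq> m" "mdeg ms {..<5} \<noteq> mdeg ms ({..<5} - {w})"
      using u v uv by metis
    have "mdeg ms ({..<5} - {m} - {w}) = mdeg ms ({..<5} - {m})"
      by (rule triples4_drop[OF 2(1) w(1,2) 2(5)])
    then have "mon_exp (ms ! w) \<le> mdeg ms ({..<5} - {m} - {w})"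
      using mon_exp_le_mdeg[of "{..<5} - {m}" w ms] w by simp
    also have "\<dots> \<le> mdeg ms ({..<5} - {w})" by (intro mdeg_mono) auto
    finally have "mdeg ms (insert w ({..<5} - {w})) = mdeg ms ({..<5} - {w})"
      by (subst mdeg_insert_eq_iff) auto
    moreover have "insert w ({..<5} - {w}) = {..<5}" using w by auto
    ultimately show False using w by simp
  qed
qed

end

subsection \<open>The choice of the order\<close>

text \<open>This is \<open>mdeg\<close> without reference to an order: it depends on the set of
  generators alone, so families for different orders can be compared by permuting arguments.\<close>

definition lcm_deg :: "'n mon set \<Rightarrow> 'n mdegree"
  where "lcm_deg S = (\<lambda>x. Max (insert 0 ((\<lambda>m. int (Poly_Mapping.lookup m x)) ` S)))"

lemma mdeg_eq_lcm_deg: "mdeg ms \<sigma> = lcm_deg ((!) ms ` \<sigma>)"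
  by (simp add: mdeg_def lcm_deg_def image_image)

definition lcm_fam :: "'n mon \<Rightarrow> 'n mon \<Rightarrow> 'n mon \<Rightarrow> 'n mon \<Rightarrow> 'n mon \<Rightarrow> fam"
  where "lcm_fam v w x y z a b c d e \<longleftrightarrow> lcm_deg (pick v w x y z a b c d e) = lcm_deg {v, w, x, y, z}"

text \<open>The second \<open>y\<close> fills the unused fifth place of \<open>pick\<close>.\<close>

definition lcm_fam4 :: "'n mon \<Rightarrow> 'n mon \<Rightarrow> 'n mon \<Rightarrow> 'n mon \<Rightarrow> fam4"
  where "lcm_fam4 v w x y a b c d \<longleftrightarrow> lcm_deg (pick v w x y y a b c d False) = lcm_deg {v, w, x, y}"

lemma nth_ipick: "(!) [v, w, x, y, z] ` ipick a b c d e = pick v w x y z a b c d e"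
  by (simp add: ipick_def pick_def image_Un)

lemma nth_ipick4: "(!) [v, w, x, y] ` ipick a b c d False = pick v w x y y a b c d False"
  by (simp add: ipick_def pick_def image_Un)

lemma nth_lessThan_5: "(!) [v, w, x, y, z] ` {..<5} = {v, w, x, y, z}"
  using nth_image[of 5 "[v, w, x, y, z]"] by (simp add: atLeast0LessThan)

lemma ipick_sub_Suc:
  "ipick a b c d e \<subseteq> {..<Suc (Suc (Suc (Suc (Suc 0))))}"
  "ipick a b c d False \<subseteq> {..<Suc (Suc (Suc (Suc 0)))}"
  by (auto simp: mem_ipick)

lemma strand_fam_5: "strand_fam [v, w, x, y, z] (mdeg [v, w, x, y, z] {..<5}) = lcm_fam v w x y z"
  by (intro ext) (simp add: strand_fam_def lcm_fam_def mdeg_eq_lcm_deg nth_ipick nth_lessThan_5 ipick_sub_Suc)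

lemma less_5_diff_4: "{..<5} - {4} = {..<4 :: nat}"
  by auto

lemma drop_4_fam5:
  "drop_fam 4 (strand_fam [v, w, x, y, z] (mdeg [v, w, x, y, z] ({..<5} - {4}))) = lcm_fam4 v w x y"
proof -
  have im: "(!) [v, w, x, y, z] ` {..<4} = {v, w, x, y}"
    using nth_image[of 4 "[v, w, x, y, z]"] by (simp add: atLeast0LessThan)
  have pk: "pick v w x y z a b c d False = pick v w x y y a b c d False" for a b c d
    by (simp add: pick_def)
  show ?thesis
    unfolding less_5_diff_4
    by (intro ext) (simp add: drop_fam_def strand_fam_def lcm_fam4_def mdeg_eq_lcm_deg nth_ipick im pk ipick_sub_Suc)
qed

lemma drop_4_fam4:
  "drop_fam 4 (strand_fam [v, w, x, y] (mdeg [v, w, x, y] ({..<5} - {4}))) = lcm_fam4 v w x y"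
proof -
  have im: "(!) [v, w, x, y] ` {..<4} = {v, w, x, y}"
    using nth_image[of 4 "[v, w, x, y]"] by (simp add: atLeast0LessThan)
  show ?thesis
    unfolding less_5_diff_4
    by (intro ext) (simp add: drop_fam_def strand_fam_def lcm_fam4_def mdeg_eq_lcm_deg nth_ipick4 im ipick_sub_Suc)
qed

text \<open>These are the three other orders offered by \<open>good3_exists\<close>; the next two
  lemmas serve \<open>bad4_perms\<close>.\<close>

lemma lcm_fam_perm:
  "lcm_fam v w y x z = (\<lambda>a b c d e. lcm_fam v w x y z a b d c e)"
  "lcm_fam v w z x y = (\<lambda>a b c d e. lcm_fam v w x y z a b d e c)"
  "lcm_fam x y z v w = (\<lambda>a b c d e. lcm_fam v w x y z d e a b c)"
  by (intro ext; simp add: lcm_fam_def pick_def Un_ac insert_commute)+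

lemma lcm_fam_perm4:
  "lcm_fam x y v w z = (\<lambda>a b c d. lcm_fam v w x y z c d a b)"
  "lcm_fam v x w y z = (\<lambda>a b c d. lcm_fam v w x y z a c b d)"
  "lcm_fam w y v x z = (\<lambda>a b c d. lcm_fam v w x y z c a d b)"
  "lcm_fam v y w x z = (\<lambda>a b c d. lcm_fam v w x y z a c d b)"
  "lcm_fam w x v y z = (\<lambda>a b c d. lcm_fam v w x y z c a b d)"
  by (intro ext; simp add: lcm_fam_def pick_def Un_ac insert_commute)+

lemma lcm_fam4_perm:
  "lcm_fam4 x y v w = (\<lambda>a b c d. lcm_fam4 v w x y c d a b)"
  "lcm_fam4 v x w y = (\<lambda>a b c d. lcm_fam4 v w x y a c b d)"
  "lcm_fam4 w y v x = (\<lambda>a b c d. lcm_fam4 v w x y c a d b)"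
  "lcm_fam4 v y w x = (\<lambda>a b c d. lcm_fam4 v w x y a c d b)"
  "lcm_fam4 w x v y = (\<lambda>a b c d. lcm_fam4 v w x y c a b d)"
  by (intro ext; simp add: lcm_fam4_def pick_def Un_ac insert_commute)+

definition incomparable :: "'n::finite mon set \<Rightarrow> bool"
  where "incomparable S \<longleftrightarrow> (\<forall>m\<in>S. \<forall>m'\<in>S. mon_exp m \<le> mon_exp m' \<longrightarrow> m = m')"

lemma pruning_order_list:
  assumes "distinct ms" "incomparable (set ms)" "length ms \<le> 5"
  shows "pruning_order ms"
proof
  show "antichain ms"
    using assms(1,2) unfolding antichain_def incomparable_def by (metis nth_eq_iff_index_eq nth_mem)
qed (rule assms)

lemma lex_good_4:
  assumes P: "distinct [v, w, x, y]" "incomparable {v, w, x, y}" and g: "\<not> bad4 (lcm_fam4 v w x y)"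
  shows "lex_good [v, w, x, y]"
proof (rule ccontr)
  interpret pruning_order "[v, w, x, y]" using P by (intro pruning_order_list) auto
  assume "\<not> lex_good [v, w, x, y]"
  then show False
  proof (cases rule: lex_good_or_bad)
    case (2 m)
    have "m = 4"
    proof (rule ccontr)
      assume "m \<noteq> 4"
      then have "4 \<in> {..<5} - {m}" by simp
      then have "4 \<in> {..<length [v, w, x, y]}" using 2(2) by blast
      then show False by simp
    qed
    then show False using 2(4) g unfolding \<open>m = 4\<close> drop_4_fam4 by simp
  qed simp
qed

text \<open>By \<open>closed\<close>, only the set of the first four generators can be closed, and
  \<open>g4\<close> settles its multidegree.\<close>

lemma lex_good_5:
  assumes P: "distinct [v, w, x, y, z]" "incomparable {v, w, x, y, z}"
    and closed: "\<And>m. m < 4 \<Longrightarrow>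
      mdeg [v, w, x, y, z] {..<5} = mdeg [v, w, x, y, z] ({..<5} - {m})"
    and g5: "\<not> bad_pair (lcm_fam v w x y z)"
    and g4: "lcm_fam v w x y z True True True True False \<or> \<not> bad4 (lcm_fam4 v w x y)"
  shows "lex_good [v, w, x, y, z]"
proof (rule ccontr)
  interpret pruning_order "[v, w, x, y, z]" using P by (intro pruning_order_list) auto
  assume "\<not> lex_good [v, w, x, y, z]"
  then show False
  proof (cases rule: lex_good_or_bad)
    case 1
    then show False using g5 unfolding strand_fam_5 by blast
  next
    case (2 m)
    have "m = 4"
    proof (rule ccontr)
      assume "m \<noteq> 4"
      then have "m < 4" using 2(1) by simp
      then show False using closed 2(3) by simp
    qed
    have "\<not> bad4 (lcm_fam4 v w x y)"
    proof
      assume "bad4 (lcm_fam4 v w x y)"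
      then have "lcm_fam v w x y z True True True True False" using g4 by blast
      then have "lcm_deg {v, w, x, y} = lcm_deg {v, w, x, y, z}"
        by (simp add: lcm_fam_def pick_def insert_commute)
      moreover have "mdeg [v, w, x, y, z] ({..<5} - {4}) = lcm_deg {v, w, x, y}"
        unfolding less_5_diff_4 mdeg_eq_lcm_deg
        using nth_image[of 4 "[v, w, x, y, z]"] by (simp add: atLeast0LessThan)
      moreover have "mdeg [v, w, x, y, z] {..<5} = lcm_deg {v, w, x, y, z}"
        unfolding mdeg_eq_lcm_deg nth_lessThan_5 ..
      ultimately show False using 2(3) unfolding \<open>m = 4\<close> by simp
    qed
    then show False using 2(4) unfolding \<open>m = 4\<close> drop_4_fam5 by blast
  qed
qed

lemma drop_one_sets:
  "(!) [v, w, x, y, z] ` ({..<5} - {0}) = {w, x, y, z}"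
  "(!) [v, w, x, y, z] ` ({..<5} - {1}) = {v, x, y, z}"
  "(!) [v, w, x, y, z] ` ({..<5} - {2}) = {v, w, y, z}"
  "(!) [v, w, x, y, z] ` ({..<5} - {3}) = {v, w, x, z}"
  "(!) [v, w, x, y, z] ` ({..<5} - {4}) = {v, w, x, y}"
  unfolding ipick_quads[symmetric] nth_ipick pick_def by (simp_all add: insert_commute)

text \<open>The generator \<open>z\<close> is the one outside the closed set. Two multidegrees
  matter: that of the closed set, and the top one, where every face contains \<open>z\<close>. Each
  gives a graph on the same four vertices, and a single initial pair has to suit both.\<close>

lemma lex_good_exists_one_closed:
  assumes P: "distinct [v, w, x, y, z]" "incomparable {v, w, x, y, z}"
    and L: "lcm_deg {w, x, y, z} = L" "lcm_deg {v, x, y, z} = L" "lcm_deg {v, w, y, z} = L"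
      "lcm_deg {v, w, x, z} = L" "lcm_deg {v, w, x, y} \<noteq> L" "lcm_deg {v, w, x, y, z} = L"
  shows "\<exists>ms. set ms = {v, w, x, y, z} \<and> distinct ms \<and> lex_good ms"
proof -
  define G where "G p q r s \<longleftrightarrow> \<not> bad4 (lcm_fam4 p q r s) \<and> \<not> bad4 (\<lambda>a b c d. lcm_fam p q r s z a b c d True)"
    for p q r s
  have *: "lex_good [p, q, r, s, z]"
    if d: "distinct [p, q, r, s, z]" "{p, q, r, s, z} = {v, w, x, y, z}" "{p, q, r, s} = {v, w, x, y}"
      and L': "lcm_deg {q, r, s, z} = L" "lcm_deg {p, r, s, z} = L" "lcm_deg {p, q, s, z} = L" "lcm_deg {p, q, r, z} = L"
      and G: "G p q r s" for p q r s
  proof -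
    interpret pruning_order "[p, q, r, s, z]" using P d by (intro pruning_order_list) auto
    have F: "upset (lcm_fam p q r s z)" "small (lcm_fam p q r s z)"
      using full_strand_upset full_strand_small unfolding strand_fam_5 by simp_all
    have nq: "\<not> lcm_fam p q r s z True True True True False"
      using L(5,6) d(2,3) by (simp add: lcm_fam_def pick_def insert_commute)
    show ?thesis
    proof (rule lex_good_5)
      show "mdeg [p, q, r, s, z] {..<5} = mdeg [p, q, r, s, z] ({..<5} - {m})" if "m < 4" for m
      proof -
        have "m = 0 \<or> m = 1 \<or> m = 2 \<or> m = 3" using that by arith
        then show ?thesis
          unfolding mdeg_eq_lcm_deg nth_lessThan_5 d(2) L(6)
          by (elim disjE) (simp_all only: drop_one_sets L')
      qed
      show "\<not> bad_pair (lcm_fam p q r s z)" using bad_link[OF F _ nq] G unfolding G_def by blast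
      show "lcm_fam p q r s z True True True True False \<or> \<not> bad4 (lcm_fam4 p q r s)"
        using G unfolding G_def by blast
    qed (use P d in auto)
  qed
  define g where "g = lcm_fam4 v w x y"
  define h where "h a b c d \<longleftrightarrow> lcm_fam v w x y z a b c d True" for a b c d
  have p0: "G v w x y \<longleftrightarrow> \<not> bad4 g \<and> \<not> bad4 h"
    unfolding G_def g_def h_def ..
  have p1: "G x y v w \<longleftrightarrow> \<not> bad4 (\<lambda>a b c d. g c d a b) \<and> \<not> bad4 (\<lambda>a b c d. h c d a b)"
    unfolding G_def g_def h_def
      lcm_fam4_perm(1)[where v = v and w = w and x = x and y = y] lcm_fam_perm4(1)[where v = v and w = w and x = x and y = y and z = z] ..
  have p2: "G v x w y \<longleftrightarrow> \<not> bad4 (\<lambda>a b c d. g a c b d) \<and> \<not> bad4 (\<lambda>a b c d. h a c b d)"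
    unfolding G_def g_def h_def
      lcm_fam4_perm(2)[where v = v and w = w and x = x and y = y] lcm_fam_perm4(2)[where v = v and w = w and x = x and y = y and z = z] ..
  have p3: "G w y v x \<longleftrightarrow> \<not> bad4 (\<lambda>a b c d. g c a d b) \<and> \<not> bad4 (\<lambda>a b c d. h c a d b)"
    unfolding G_def g_def h_def
      lcm_fam4_perm(3)[where v = v and w = w and x = x and y = y] lcm_fam_perm4(3)[where v = v and w = w and x = x and y = y and z = z] ..
  have p4: "G v y w x \<longleftrightarrow> \<not> bad4 (\<lambda>a b c d. g a c d b) \<and> \<not> bad4 (\<lambda>a b c d. h a c d b)"
    unfolding G_def g_def h_def
      lcm_fam4_perm(4)[where v = v and w = w and x = x and y = y] lcm_fam_perm4(4)[where v = v and w = w and x = x and y = y and z = z] ..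
  have p5: "G w x v y \<longleftrightarrow> \<not> bad4 (\<lambda>a b c d. g c a b d) \<and> \<not> bad4 (\<lambda>a b c d. h c a b d)"
    unfolding G_def g_def h_def
      lcm_fam4_perm(5)[where v = v and w = w and x = x and y = y] lcm_fam_perm4(5)[where v = v and w = w and x = x and y = y and z = z] ..
  have "G v w x y \<or> G x y v w \<or> G v x w y \<or> G w y v x \<or> G v y w x \<or> G w x v y"
    unfolding p0 p1 p2 p3 p4 p5 by (rule bad4_perms)
  then show ?thesis
  proof (elim disjE)
    assume G: "G v w x y"
    have "lex_good [v, w, x, y, z]"
      by (rule *[OF _ _ _ _ _ _ _ G]) (use P(1) L(1-4) in \<open>auto simp: insert_commute\<close>)
    moreover have "set [v, w, x, y, z] = {v, w, x, y, z}" "distinct [v, w, x, y, z]" using P(1) by auto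
    ultimately show ?thesis by blast
  next
    assume G: "G x y v w"
    have "lex_good [x, y, v, w, z]"
      by (rule *[OF _ _ _ _ _ _ _ G]) (use P(1) L(1-4) in \<open>auto simp: insert_commute\<close>)
    moreover have "set [x, y, v, w, z] = {v, w, x, y, z}" "distinct [x, y, v, w, z]" using P(1) by auto
    ultimately show ?thesis by blast
  next
    assume G: "G v x w y"
    have "lex_good [v, x, w, y, z]"
      by (rule *[OF _ _ _ _ _ _ _ G]) (use P(1) L(1-4) in \<open>auto simp: insert_commute\<close>)
    moreover have "set [v, x, w, y, z] = {v, w, x, y, z}" "distinct [v, x, w, y, z]" using P(1) by auto
    ultimately show ?thesis by blast
  next
    assume G: "G w y v x"
    have "lex_good [w, y, v, x, z]"
      by (rule *[OF _ _ _ _ _ _ _ G]) (use P(1) L(1-4) in \<open>auto simp: insert_commute\<close>)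
    moreover have "set [w, y, v, x, z] = {v, w, x, y, z}" "distinct [w, y, v, x, z]" using P(1) by auto
    ultimately show ?thesis by blast
  next
    assume G: "G v y w x"
    have "lex_good [v, y, w, x, z]"
      by (rule *[OF _ _ _ _ _ _ _ G]) (use P(1) L(1-4) in \<open>auto simp: insert_commute\<close>)
    moreover have "set [v, y, w, x, z] = {v, w, x, y, z}" "distinct [v, y, w, x, z]" using P(1) by auto
    ultimately show ?thesis by blast
  next
    assume G: "G w x v y"
    have "lex_good [w, x, v, y, z]"
      by (rule *[OF _ _ _ _ _ _ _ G]) (use P(1) L(1-4) in \<open>auto simp: insert_commute\<close>)
    moreover have "set [w, x, v, y, z] = {v, w, x, y, z}" "distinct [w, x, v, y, z]" using P(1) by auto
    ultimately show ?thesis by blast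
  qed
qed

text \<open>If every order failed, the bad pair of the given one would yield through
  \<open>bad_edge\<close> a pair to begin with. The families of all reorderings would also be bad,
  contradicting \<open>good3_exists\<close>.\<close>

lemma lex_good_exists_none_closed:
  assumes P: "distinct [v, w, x, y, z]" "incomparable {v, w, x, y, z}"
    and L: "\<And>u. u \<in> {v, w, x, y, z} \<Longrightarrow> lcm_deg ({v, w, x, y, z} - {u}) = lcm_deg {v, w, x, y, z}"
  shows "\<exists>ms. set ms = {v, w, x, y, z} \<and> distinct ms \<and> lex_good ms"
proof (rule ccontr)
  assume N: "\<nexists>ms. set ms = {v, w, x, y, z} \<and> distinct ms \<and> lex_good ms"
  define K where "K = {v, w, x, y, z}"
  have main: "upset (lcm_fam p q r s t) \<and> small (lcm_fam p q r s t) \<and> quads (lcm_fam p q r s t) \<and>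
      bad_pair (lcm_fam p q r s t)"
    if d: "distinct [p, q, r, s, t]" and K: "{p, q, r, s, t} = K" for p q r s t
  proof -
    interpret pruning_order "[p, q, r, s, t]"
      using P(2) d K by (intro pruning_order_list) (simp_all add: K_def)
    have F: "upset (lcm_fam p q r s t)" "small (lcm_fam p q r s t)"
      using full_strand_upset full_strand_small unfolding strand_fam_5 by simp_all
    have "K - {p} = {q, r, s, t}" "K - {q} = {p, r, s, t}" "K - {r} = {p, q, s, t}"
      "K - {s} = {p, q, r, t}" "K - {t} = {p, q, r, s}" using d K by auto
    then have L': "lcm_deg {q, r, s, t} = lcm_deg K" "lcm_deg {p, r, s, t} = lcm_deg K"
      "lcm_deg {p, q, s, t} = lcm_deg K" "lcm_deg {p, q, r, t} = lcm_deg K" "lcm_deg {p, q, r, s} = lcm_deg K"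
      using L[folded K_def] K by (metis insertCI)+
    have pk: "pick p q r s t False True True True True = {q, r, s, t}"
      "pick p q r s t True False True True True = {p, r, s, t}"
      "pick p q r s t True True False True True = {p, q, s, t}"
      "pick p q r s t True True True False True = {p, q, r, t}"
      "pick p q r s t True True True True False = {p, q, r, s}"
      by (auto simp: pick_def)
    have Q: "quads (lcm_fam p q r s t)"
      unfolding quads_def lcm_fam_def pk K L' by simp
    have "bad_pair (lcm_fam p q r s t)"
    proof (rule ccontr)
      assume nb: "\<not> bad_pair (lcm_fam p q r s t)"
      have "lex_good [p, q, r, s, t]"
      proof (rule lex_good_5[OF d _ _ nb])
        show "incomparable {p, q, r, s, t}" using P(2) K by (simp add: K_def)
        show "mdeg [p, q, r, s, t] {..<5} = mdeg [p, q, r, s, t] ({..<5} - {m})" if "m < 4" for m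
        proof -
          have "m = 0 \<or> m = 1 \<or> m = 2 \<or> m = 3" using that by arith
          then show ?thesis
            unfolding mdeg_eq_lcm_deg nth_lessThan_5 K
            by (elim disjE) (simp_all only: drop_one_sets L')
        qed
        show "lcm_fam p q r s t True True True True False \<or> \<not> bad4 (lcm_fam4 p q r s)"
          using Q by (simp add: quads_def)
      qed
      moreover have "set [p, q, r, s, t] = {v, w, x, y, z}" using K by (simp add: K_def)
      ultimately show False using N d by blast
    qed
    then show ?thesis using F Q by blast
  qed
  have K0: "{v, w, x, y, z} = K" by (simp add: K_def)
  have m0: "upset (lcm_fam v w x y z)" "small (lcm_fam v w x y z)" "bad_pair (lcm_fam v w x y z)"
    "quads (lcm_fam v w x y z)" using main[OF P(1) K0] by blast+
  \<comment> \<open>Each of the ten alternatives of \<open>bad_edge\<close> names a pair outside the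
    family whose complementary triple is inside; the generators are relabelled so that this pair
    comes first.\<close>
  have "\<exists>p q r s t. distinct [p, q, r, s, t] \<and> {p, q, r, s, t} = K \<and>
      lcm_deg {p, q} \<noteq> lcm_deg K \<and> lcm_deg {r, s, t} = lcm_deg K"
    using bad_edge[OF m0]
  proof (elim disjE)
    assume "\<not> lcm_fam v w x y z True True False False False \<and> lcm_fam v w x y z False False True True True"
    then show ?thesis
      using P(1) by (intro exI[of _ v] exI[of _ w] exI[of _ x] exI[of _ y] exI[of _ z])
        (auto simp: lcm_fam_def pick_def K_def insert_commute)
  next
    assume "\<not> lcm_fam v w x y z True False True False False \<and> lcm_fam v w x y z False True False True True"
    then show ?thesis
      using P(1) by (intro exI[of _ v] exI[of _ x] exI[of _ w] exI[of _ y] exI[of _ z])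
        (auto simp: lcm_fam_def pick_def K_def insert_commute)
  next
    assume "\<not> lcm_fam v w x y z True False False True False \<and> lcm_fam v w x y z False True True False True"
    then show ?thesis
      using P(1) by (intro exI[of _ v] exI[of _ y] exI[of _ w] exI[of _ x] exI[of _ z])
        (auto simp: lcm_fam_def pick_def K_def insert_commute)
  next
    assume "\<not> lcm_fam v w x y z True False False False True \<and> lcm_fam v w x y z False True True True False"
    then show ?thesis
      using P(1) by (intro exI[of _ v] exI[of _ z] exI[of _ w] exI[of _ x] exI[of _ y])
        (auto simp: lcm_fam_def pick_def K_def insert_commute)
  next
    assume "\<not> lcm_fam v w x y z False True True False False \<and> lcm_fam v w x y z True False False True True"
    then show ?thesis
      using P(1) by (intro exI[of _ w] exI[of _ x] exI[of _ v] exI[of _ y] exI[of _ z])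
        (auto simp: lcm_fam_def pick_def K_def insert_commute)
  next
    assume "\<not> lcm_fam v w x y z False True False True False \<and> lcm_fam v w x y z True False True False True"
    then show ?thesis
      using P(1) by (intro exI[of _ w] exI[of _ y] exI[of _ v] exI[of _ x] exI[of _ z])
        (auto simp: lcm_fam_def pick_def K_def insert_commute)
  next
    assume "\<not> lcm_fam v w x y z False True False False True \<and> lcm_fam v w x y z True False True True False"
    then show ?thesis
      using P(1) by (intro exI[of _ w] exI[of _ z] exI[of _ v] exI[of _ x] exI[of _ y])
        (auto simp: lcm_fam_def pick_def K_def insert_commute)
  next
    assume "\<not> lcm_fam v w x y z False False True True False \<and> lcm_fam v w x y z True True False False True"
    then show ?thesis
      using P(1) by (intro exI[of _ x] exI[of _ y] exI[of _ v] exI[of _ w] exI[of _ z])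
        (auto simp: lcm_fam_def pick_def K_def insert_commute)
  next
    assume "\<not> lcm_fam v w x y z False False True False True \<and> lcm_fam v w x y z True True False True False"
    then show ?thesis
      using P(1) by (intro exI[of _ x] exI[of _ z] exI[of _ v] exI[of _ w] exI[of _ y])
        (auto simp: lcm_fam_def pick_def K_def insert_commute)
  next
    assume "\<not> lcm_fam v w x y z False False False True True \<and> lcm_fam v w x y z True True True False False"
    then show ?thesis
      using P(1) by (intro exI[of _ y] exI[of _ z] exI[of _ v] exI[of _ w] exI[of _ x])
        (auto simp: lcm_fam_def pick_def K_def insert_commute)
  qed
  then obtain p q r s t where d: "distinct [p, q, r, s, t]" and K: "{p, q, r, s, t} = K"
    and E: "lcm_deg {p, q} \<noteq> lcm_deg K" "lcm_deg {r, s, t} = lcm_deg K" by blast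
  define F where "F = lcm_fam p q r s t"
  have e: "\<not> F True True False False False" "F False False True True True"
    using E by (simp_all add: F_def lcm_fam_def pick_def K insert_commute)
  have mF: "upset F" "quads F" using main[OF d K] by (simp_all add: F_def)
  have bad3: "\<not> good3 (lcm_fam p' q' r' s' t')"
    if "distinct [p', q', r', s', t']" "{p', q', r', s', t'} = K" for p' q' r' s' t'
    using main[OF that] good3_not_bad[of "lcm_fam p' q' r' s' t'"] by blast
  have "good3 F \<or> good3 (lcm_fam p q s r t) \<or> good3 (lcm_fam p q t r s) \<or> good3 (lcm_fam r s t p q)"
    using good3_exists[OF mF e]
    unfolding F_def lcm_fam_perm(1)[where v = p and w = q and x = r and y = s and z = t]
      lcm_fam_perm(2)[where v = p and w = q and x = r and y = s and z = t]
      lcm_fam_perm(3)[where v = p and w = q and x = r and y = s and z = t] .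
  moreover have "\<not> good3 F" unfolding F_def by (rule bad3[OF d K])
  moreover have "\<not> good3 (lcm_fam p q s r t)" by (rule bad3) (use d K in auto)
  moreover have "\<not> good3 (lcm_fam p q t r s)" by (rule bad3) (use d K in auto)
  moreover have "\<not> good3 (lcm_fam r s t p q)" by (rule bad3) (use d K in auto)
  ultimately show False by blast
qed

lemma mdeg_drop:
  assumes "distinct ms" "i < length ms"
  shows "mdeg ms ({..<length ms} - {i}) = lcm_deg (set ms - {ms ! i})"
proof -
  have "inj_on ((!) ms) {..<length ms}" using assms(1) by (simp add: inj_on_nth)
  then have "(!) ms ` ({..<length ms} - {i}) = (!) ms ` {..<length ms} - (!) ms ` {i}"
    using assms(2) by (intro inj_on_image_set_diff) auto
  then show ?thesis
    using nth_image[of "length ms" ms] by (simp add: mdeg_eq_lcm_deg atLeast0LessThan)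
qed

lemma lex_good_exists_5:
  assumes P: "distinct ms" "incomparable (set ms)" "length ms = 5"
  shows "\<exists>ms'. set ms' = set ms \<and> distinct ms' \<and> lex_good ms'"
proof -
  interpret pruning_order ms using P by (intro pruning_order_list) auto
  define K where "K = set ms"
  \<comment> \<open>A closed set of four generators is represented by the generator \<open>u\<close>
    that it omits.\<close>
  define closed where "closed u \<longleftrightarrow> u \<in> K \<and> lcm_deg (K - {u}) \<noteq> lcm_deg K" for u
  have top: "mdeg ms {..<5} = lcm_deg K"
    using nth_image[of "length ms" ms] P(3) by (simp add: mdeg_eq_lcm_deg atLeast0LessThan K_def)
  have idx: "\<exists>i<5. mdeg ms {..<5} \<noteq> mdeg ms ({..<5} - {i}) \<and> ms ! i = u" if "closed u" for u
    using that mdeg_drop[OF P(1)] top P(3) unfolding closed_def K_def by (metis in_set_conv_nth)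
  show ?thesis
  proof (cases "\<exists>u. closed u")
    case False
    obtain v w x y z where ms: "ms = [v, w, x, y, z]"
      using P(3) by (auto simp: numeral_eq_Suc length_Suc_conv)
    show ?thesis
      using lex_good_exists_none_closed[of v w x y z] P(1,2) False unfolding ms closed_def K_def by auto
  next
    case True
    then obtain u where u: "closed u" by blast
    show ?thesis
    proof (cases "\<exists>u'. closed u' \<and> u' \<noteq> u")
      case True
      then obtain u' where u': "closed u'" "u' \<noteq> u" by blast
      obtain i where i: "i < 5" "mdeg ms {..<5} \<noteq> mdeg ms ({..<5} - {i})" "ms ! i = u" using idx[OF u] by blast
      obtain j where j: "j < 5" "mdeg ms {..<5} \<noteq> mdeg ms ({..<5} - {j})" "ms ! j = u'" using idx[OF u'(1)] by blast
      have "i \<noteq> j" using i j u' by blast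
      then have "lex_good ms" using two_closed_lex_good[OF P(3) i(1) j(1) _ i(2) j(2)] by blast
      then show ?thesis using P(1) by blast
    next
      case False
      have uK: "u \<in> set ms" using u by (simp add: closed_def K_def)
      \<comment> \<open>The omitted generator is moved to the last place, where
        \<open>lex_good_exists_one_closed\<close> expects it.\<close>
      have "length (remove1 u ms) = 4" using uK P(3) by (simp add: length_remove1)
      then obtain p q r s where rm: "remove1 u ms = [p, q, r, s]"
        by (auto simp: numeral_eq_Suc length_Suc_conv)
      have "set (remove1 u ms) = K - {u}" using P(1) by (simp add: set_remove1_eq K_def)
      then have K: "K - {u} = {p, q, r, s}" using rm by simp
      have "distinct (remove1 u ms)" using P(1) by (rule distinct_remove1)
      then have d: "distinct [p, q, r, s, u]" using rm K by auto
      have K5: "K = {p, q, r, s, u}" using K uK unfolding K_def[symmetric] by blast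
      have "K - {p} = {q, r, s, u}" "K - {q} = {p, r, s, u}" "K - {r} = {p, q, s, u}" "K - {s} = {p, q, r, u}"
        using d K5 by auto
      moreover have "lcm_deg (K - {u'}) = lcm_deg K" if "u' \<in> K" "u' \<noteq> u" for u'
        using False that by (auto simp: closed_def)
      ultimately have L: "lcm_deg {q, r, s, u} = lcm_deg K" "lcm_deg {p, r, s, u} = lcm_deg K"
        "lcm_deg {p, q, s, u} = lcm_deg K" "lcm_deg {p, q, r, u} = lcm_deg K"
        using d K5 by (metis distinct_length_2_or_more insertCI)+
      have "\<exists>ms'. set ms' = {p, q, r, s, u} \<and> distinct ms' \<and> lex_good ms'"
      proof (rule lex_good_exists_one_closed[OF d _ L])
        show "incomparable {p, q, r, s, u}" using P(2) K5 by (simp add: K_def)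
        show "lcm_deg {p, q, r, s} \<noteq> lcm_deg K" using u K by (simp add: closed_def)
        show "lcm_deg {p, q, r, s, u} = lcm_deg K" using K5 by simp
      qed
      then show ?thesis using K5 by (simp add: K_def)
    qed
  qed
qed

lemma lex_good_exists:
  assumes P: "distinct ms" "incomparable (set ms)" "length ms \<le> 5"
  shows "\<exists>ms'. set ms' = set ms \<and> distinct ms' \<and> lex_good ms'"
proof -
  interpret pruning_order ms using P by (intro pruning_order_list) auto
  consider "length ms \<le> 3" | "length ms = 4" | "length ms = 5" using P(3) by linarith
  then show ?thesis
  proof cases
    case 1
    have "lex_good ms"
    proof (rule ccontr)
      assume "\<not> lex_good ms"
      then show False
      proof (cases rule: lex_good_or_bad)
        case (2 m)
        have "card ({..<5} - {m}) = 4" using 2(1) by simp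
        then show False using card_mono[OF _ 2(2)] 1 by simp
      qed (use 1 in simp)
    qed
    then show ?thesis using P(1) by blast
  next
    case 2
    obtain v w x y where ms: "ms = [v, w, x, y]"
      using 2 by (auto simp: numeral_eq_Suc length_Suc_conv)
    define g where "g = lcm_fam4 v w x y"
    have *: ?thesis if "distinct [p, q, r, s]" "{p, q, r, s} = {v, w, x, y}" "\<not> bad4 (lcm_fam4 p q r s)" for p q r s
    proof -
      have "lex_good [p, q, r, s]" using that P(2) by (intro lex_good_4) (simp_all add: ms)
      then show ?thesis using that by (intro exI[of _ "[p, q, r, s]"]) (simp add: ms)
    qed
    have "\<not> bad4 (lcm_fam4 v w x y) \<or> \<not> bad4 (lcm_fam4 x y v w) \<or> \<not> bad4 (lcm_fam4 v x w y) \<or>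
        \<not> bad4 (lcm_fam4 w y v x) \<or> \<not> bad4 (lcm_fam4 v y w x) \<or> \<not> bad4 (lcm_fam4 w x v y)"
      \<comment> \<open>With four generators only the top multidegree has four divisors, so there is
        one graph and both arguments are the same.\<close>
      using bad4_perms[of "lcm_fam4 v w x y" "lcm_fam4 v w x y"]
      unfolding lcm_fam4_perm(1)[where v = v and w = w and x = x and y = y] lcm_fam4_perm(2)[where v = v and w = w and x = x and y = y] lcm_fam4_perm(3)[where v = v and w = w and x = x and y = y]
        lcm_fam4_perm(4)[where v = v and w = w and x = x and y = y] lcm_fam4_perm(5)[where v = v and w = w and x = x and y = y] by blast
    then show ?thesis
    proof (elim disjE)
      assume g: "\<not> bad4 (lcm_fam4 v w x y)"
      show ?thesis by (rule *[OF _ _ g]) (use P(1) ms in auto)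
    next
      assume g: "\<not> bad4 (lcm_fam4 x y v w)"
      show ?thesis by (rule *[OF _ _ g]) (use P(1) ms in auto)
    next
      assume g: "\<not> bad4 (lcm_fam4 v x w y)"
      show ?thesis by (rule *[OF _ _ g]) (use P(1) ms in auto)
    next
      assume g: "\<not> bad4 (lcm_fam4 w y v x)"
      show ?thesis by (rule *[OF _ _ g]) (use P(1) ms in auto)
    next
      assume g: "\<not> bad4 (lcm_fam4 v y w x)"
      show ?thesis by (rule *[OF _ _ g]) (use P(1) ms in auto)
    next
      assume g: "\<not> bad4 (lcm_fam4 w x v y)"
      show ?thesis by (rule *[OF _ _ g]) (use P(1) ms in auto)
    qed
  next
    case 3
    then show ?thesis using lex_good_exists_5 P by blast
  qed
qed

lemma monom_dvd_if_le:
  fixes m :: "'n::finite mon"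
  assumes "mon_exp m \<le> mon_exp m'"
  shows "(mpoly_monom m :: ('n, 'k::field) mpoly) dvd mpoly_monom m'"
proof -
  obtain s where s: "m' = s + m" using assms exists_add_iff_le by blast
  have "mpoly_monom m' = mpoly_monom m * (Poly_Mapping.single s 1 :: ('n, 'k) mpoly)"
    by (simp add: mpoly_monom_def s mult_single add.commute)
  then show ?thesis by (rule dvdI)
qed

text \<open>Apart from \<open>distinct ms\<close>, only \<open>set ms\<close> occurs on the right,
  so the generators may be reordered.\<close>

lemma minimal_generators_iff:
  "minimal_generators (I :: ('n, 'k::field) mpoly set) ms \<longleftrightarrow>
    I = Modules.module.span (*) (mpoly_monom ` set ms) \<and> distinct ms \<and>
    (\<forall>m\<in>set ms. \<forall>m'\<in>set ms. m \<noteq> m' \<longrightarrow> \<not> (mpoly_monom m :: ('n, 'k) mpoly) dvd mpoly_monom m')"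
  unfolding minimal_generators_def distinct_conv_nth
  by (auto simp: all_set_conv_all_nth) (metis dvd_refl)+

theorem theorem3p6:
  fixes I :: "('n::finite, 'k::field) mpoly set"
    and ms :: "'n mon list"
  assumes "minimal_generators I ms"
    and "\<forall>m \<in> set ms. squarefree_mon m"
    and "length ms \<le> 5"
  shows "admits_minimal_pruned_resolution I"
proof -
  have "distinct ms" using assms(1) by (simp add: minimal_generators_iff)
  moreover have "incomparable (set ms)"
    unfolding incomparable_def
    using assms(1) monom_dvd_if_le[where 'k = 'k] unfolding minimal_generators_iff by blast
  ultimately obtain ms' where ms': "set ms' = set ms" "distinct ms'" "lex_good ms'"
    using lex_good_exists assms(3) by blast
  have "minimal_generators I ms'"
    using assms(1) ms'(1,2) by (simp add: minimal_generators_iff)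
  then show ?thesis
    using pruned_resolution_minimal_if_lex_good ms'(3) unfolding admits_minimal_pruned_resolution_def by blast
qed

end
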